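(* (1) $\mathrm{SEL}(\Sigma^0_2,2^{\mathbb N})$ does not hold for $(<\omega,1)$-degrees. (2) $\mathrm{SEL}(\Sigma^0_2,2^{\mathbb N})$ holds for $(1,\omega)$-degrees. (3) $\mathrm{SEL}(\Pi^0_2,2^{\mathbb N})$ does not hold for $(1,\omega)$-degrees. (4) $\mathrm{SEL}(\Pi^0_2,\mathbb N^{\mathbb N})$ holds for $(<\omega,\omega)$-degrees. (5) $\mathrm{SEL}(\Sigma^0_3,2^{\mathbb N})$ does not hold for $(<\omega,\omega)$-degrees.
   Context: For a (lightface) pointclass $\Gamma$ in a space $X\in\{2^{\mathbb N},\mathbb N^{\mathbb N}\}$, $\mathrm{SEL}(\Gamma,X)$ holds for $(\alpha,\beta)$-degrees if, for every $\Gamma$ set $S\subseteq X$ and for every nonempty $\Pi^0_1$ set $Q\subseteq2^{\mathbb N}$, there exists a $\Pi^0_1$ set $P\subseteq2^{\mathbb N}$ such that $P\equiv^\alpha_\beta S\cup Q$. Let $\{\Phi_e\}_{e\in\mathbb N}$ be an effective enumeration of all partial computable functions $\Phi_e:\subseteq\mathbb N^{\mathbb N}\to\mathbb N^{\mathbb N}$. A learner is a total computable function $\Psi:\mathbb N^{<\mathbb N}\to\mathbb N$; let $\{\Psi_e\}_{e\in\mathbb N}$ be an effective enumeration of all learners. A partial function $\Gamma:\subseteq\mathbb N^{\mathbb N}\to\mathbb N^{\mathbb N}$ is identified by $\Psi$ on $g$ if $\lim_n\Psi(g\upharpoonright n)$ exists and $\Phi_{\lim_n\Psi(g\upharpoonright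 n)}(g)=\Gamma(g)$. $\Gamma$ is $(<\omega,1)$-computable if there is $b\in\mathbb N$ such that for every $g\in\mathrm{dom}(\Gamma)$, $\Gamma(g)=\Phi_e(g)$ for some $e<b$. $\Gamma$ is $(1,\omega)$-computable if a single learner identifies it on every $g\in\mathrm{dom}(\Gamma)$. $\Gamma$ is $(<\omega,\omega)$-computable if there is $b\in\mathbb N$ such that for every $g\in\mathrm{dom}(\Gamma)$, $\Gamma$ is identified by $\Psi_e$ on $g$ for some $e<b$. For $A,B\subseteq\mathbb N^{\mathbb N}$, $A\le^\alpha_\beta B$ means there is an $(\alpha,\beta)$-computable $\Gamma$ with $B\subseteq\mathrm{dom}(\Gamma)$ and $\Gamma(g)\in A$ for every $g\in B$; $A\equiv^\alpha_\beta B$ means $A\le^\alpha_\beta B$ and $B\le^\alpha_\beta A$. *)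

theory Defs
  imports Main "HOL-Library.Nat_Bijection"
begin

text \<open>
  Oracle computability on the natural numbers. Programs are the codes of unary partial recursive
  functions relative to an oracle; several arguments are passed as one number through
  \<^const>\<open>prod_encode\<close> or \<^const>\<open>list_encode\<close>.
\<close>

datatype code =
    Zero
  | Succ
  | Fst
  | Snd
  | Oracle
  | Pair code code
  | Comp code code
  | Prec code code
  | Mu code

primrec run :: "code \<Rightarrow> (nat \<Rightarrow> nat) \<Rightarrow> nat \<Rightarrow> nat option" where
  "run Zero g n = Some 0"
| "run Succ g n = Some (Suc n)"
| "run Fst g n = Some (fst (prod_decode n))"
| "run Snd g n = Some (snd (prod_decode n))"
| "run Oracle g n = Some (g n)"
| "run (Pair c d) g n =
     Option.bind (run c g n) (\<lambda>x. Option.bind (run d g n) (\<lambda>y. Some (prod_encode (x, y))))"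
| "run (Comp c d) g n = Option.bind (run d g n) (run c g)"
| "run (Prec c d) g n =
     rec_nat (run c g (fst (prod_decode n)))
       (\<lambda>k r. Option.bind r (\<lambda>y. run d g (prod_encode (fst (prod_decode n), prod_encode (k, y)))))
       (snd (prod_decode n))"
| "run (Mu c) g n =
     (if \<exists>k. run c g (prod_encode (n, k)) = Some 0 \<and>
             (\<forall>j<k. run c g (prod_encode (n, j)) \<noteq> None)
      then Some (LEAST k. run c g (prod_encode (n, k)) = Some 0)
      else None)"

text \<open>
  Programs are numbered effectively: \<open>0, ..., 4\<close> are the atomic ones, and
  \<open>5 + 4 * prod_encode (i, j) + k\<close> is the compound with constructor \<open>k\<close> and components
  numbered \<open>i\<close>, \<open>j\<close> (\<open>j\<close> is ignored for \<^const>\<open>Mu\<close>).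
\<close>

lemma prod_decode_div_less:
  assumes "5 \<le> e"
  shows "fst (prod_decode ((e - 5) div 4)) < e" "snd (prod_decode ((e - 5) div 4)) < e"
proof -
  obtain a b where ab: "prod_decode ((e - 5) div 4) = (a, b)"
    by fastforce
  then have "prod_encode (a, b) = (e - 5) div 4"
    by (metis prod_decode_inverse)
  moreover have "(e - 5) div 4 < e"
    using assms by simp
  ultimately have "a < e" "b < e"
    using le_prod_encode_1[of a b] le_prod_encode_2[of b a] by linarith+
  then show "fst (prod_decode ((e - 5) div 4)) < e" "snd (prod_decode ((e - 5) div 4)) < e"
    using ab by auto
qed

function code_of :: "nat \<Rightarrow> code" where
  "code_of e =
     (if e = 0 then Zero
      else if e = 1 then Succ
      else if e = 2 then Fst
      else if e = 3 then Snd
      else if e = 4 then Oracle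
      else
        let k = (e - 5) mod 4;
            i = fst (prod_decode ((e - 5) div 4));
            j = snd (prod_decode ((e - 5) div 4))
        in if k = 0 then Pair (code_of i) (code_of j)
           else if k = 1 then Comp (code_of i) (code_of j)
           else if k = 2 then Prec (code_of i) (code_of j)
           else Mu (code_of i))"
  by pat_completeness auto
termination
  by (relation "measure id") (simp_all add: prod_decode_div_less)

declare code_of.simps [simp del]

lemma surj_code_of: "surj code_of"
proof -
  have node: "code_of (5 + (4 * prod_encode (i, j) + k)) =
      (if k = 0 then Pair (code_of i) (code_of j)
       else if k = 1 then Comp (code_of i) (code_of j)
       else if k = 2 then Prec (code_of i) (code_of j)
       else Mu (code_of i))" if "k < 4" for i j k
    using that by (subst code_of.simps) (simp add: Let_def)
  have "\<exists>e. code_of e = c" for c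
  proof (induction c)
    case Zero
    show ?case by (rule exI[of _ 0]) (simp add: code_of.simps)
  next
    case Succ
    show ?case by (rule exI[of _ 1]) (simp add: code_of.simps)
  next
    case Fst
    show ?case by (rule exI[of _ 2]) (simp add: code_of.simps)
  next
    case Snd
    show ?case by (rule exI[of _ 3]) (simp add: code_of.simps)
  next
    case Oracle
    show ?case by (rule exI[of _ 4]) (simp add: code_of.simps)
  next
    case (Pair c d)
    then show ?case using node[of 0] by fastforce
  next
    case (Comp c d)
    then show ?case using node[of 1] by fastforce
  next
    case (Prec c d)
    then show ?case using node[of 2] by fastforce
  next
    case (Mu c)
    then show ?case using node[of 3] by fastforce
  qed
  then show ?thesis by (metis surjI)
qed

definition Phi :: "nat \<Rightarrow> (nat \<Rightarrow> nat) \<Rightarrow> (nat \<Rightarrow> nat) option" where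
  "Phi e g = (if \<forall>n. run (code_of e) g n \<noteq> None
              then Some (\<lambda>n. the (run (code_of e) g n)) else None)"

text \<open>
  The zero oracle gives computability without oracle. Totality of a program is undecidable, so the
  enumeration below lists exactly the learners, but not uniformly computably.
\<close>

definition learner :: "(nat list \<Rightarrow> nat) \<Rightarrow> bool" where
  "learner \<psi> \<longleftrightarrow> (\<exists>c. \<forall>\<sigma>. run c (\<lambda>_. 0) (list_encode \<sigma>) = Some (\<psi> \<sigma>))"

definition Psi :: "nat \<Rightarrow> nat list \<Rightarrow> nat" where
  "Psi e = (if \<forall>\<sigma>. run (code_of e) (\<lambda>_. 0) (list_encode \<sigma>) \<noteq> None
            then (\<lambda>\<sigma>. the (run (code_of e) (\<lambda>_. 0) (list_encode \<sigma>)))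
            else (\<lambda>_. 0))"

lemma range_Psi: "range Psi = Collect learner"
proof (intro equalityI subsetI)
  fix \<psi> assume "\<psi> \<in> range Psi"
  then obtain e where e: "\<psi> = Psi e" by auto
  show "\<psi> \<in> Collect learner"
  proof (cases "\<forall>\<sigma>. run (code_of e) (\<lambda>_. 0) (list_encode \<sigma>) \<noteq> None")
    case True
    then have "\<forall>\<sigma>. run (code_of e) (\<lambda>_. 0) (list_encode \<sigma>) = Some (\<psi> \<sigma>)"
      by (auto simp: e Psi_def)
    then show ?thesis by (auto simp: learner_def)
  next
    case False
    then have "\<psi> = (\<lambda>_. 0)" unfolding e Psi_def by (simp only: if_False)
    then have "\<forall>\<sigma>. run Zero (\<lambda>_. 0) (list_encode \<sigma>) = Some (\<psi> \<sigma>)" by simp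
    then show ?thesis unfolding learner_def by blast
  qed
next
  fix \<psi> assume "\<psi> \<in> Collect learner"
  then obtain c where c: "\<And>\<sigma>. run c (\<lambda>_. 0) (list_encode \<sigma>) = Some (\<psi> \<sigma>)"
    by (auto simp: learner_def)
  obtain e where "code_of e = c" using surj_code_of by (metis surjD)
  then have "Psi e = \<psi>" using c by (simp add: Psi_def)
  then show "\<psi> \<in> range Psi" by blast
qed

definition restrict_to :: "(nat \<Rightarrow> nat) \<Rightarrow> nat \<Rightarrow> nat list" where
  "restrict_to g n = map g [0..<n]"

definition identified_by ::
    "(nat list \<Rightarrow> nat) \<Rightarrow> ((nat \<Rightarrow> nat) \<Rightarrow> (nat \<Rightarrow> nat) option) \<Rightarrow> (nat \<Rightarrow> nat) \<Rightarrow> bool" where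
  "identified_by \<psi> \<Gamma> g \<longleftrightarrow>
     (\<exists>e. (\<forall>\<^sub>F n in sequentially. \<psi> (restrict_to g n) = e) \<and> Phi e g = \<Gamma> g)"

definition computable_fin_1 :: "((nat \<Rightarrow> nat) \<Rightarrow> (nat \<Rightarrow> nat) option) \<Rightarrow> bool" where
  "computable_fin_1 \<Gamma> \<longleftrightarrow> (\<exists>b. \<forall>g\<in>dom \<Gamma>. \<exists>e<b. \<Gamma> g = Phi e g)"

definition computable_1_omega :: "((nat \<Rightarrow> nat) \<Rightarrow> (nat \<Rightarrow> nat) option) \<Rightarrow> bool" where
  "computable_1_omega \<Gamma> \<longleftrightarrow> (\<exists>\<psi>. learner \<psi> \<and> (\<forall>g\<in>dom \<Gamma>. identified_by \<psi> \<Gamma> g))"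

definition computable_fin_omega :: "((nat \<Rightarrow> nat) \<Rightarrow> (nat \<Rightarrow> nat) option) \<Rightarrow> bool" where
  "computable_fin_omega \<Gamma> \<longleftrightarrow> (\<exists>b. \<forall>g\<in>dom \<Gamma>. \<exists>e<b. identified_by (Psi e) \<Gamma> g)"

text \<open>
  The parameter \<open>C\<close> is one of the three computability notions above; it plays the role of the
  pair of indices in \<open>(\<alpha>, \<beta>)\<close>-computability.
\<close>

definition reducible ::
    "(((nat \<Rightarrow> nat) \<Rightarrow> (nat \<Rightarrow> nat) option) \<Rightarrow> bool) \<Rightarrow> (nat \<Rightarrow> nat) set \<Rightarrow> (nat \<Rightarrow> nat) set \<Rightarrow> bool" where
  "reducible C A B \<longleftrightarrow> (\<exists>\<Gamma>. C \<Gamma> \<and> B \<subseteq> dom \<Gamma> \<and> (\<forall>g\<in>B. the (\<Gamma> g) \<in> A))"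

definition degree_equiv ::
    "(((nat \<Rightarrow> nat) \<Rightarrow> (nat \<Rightarrow> nat) option) \<Rightarrow> bool) \<Rightarrow> (nat \<Rightarrow> nat) set \<Rightarrow> (nat \<Rightarrow> nat) set \<Rightarrow> bool" where
  "degree_equiv C A B \<longleftrightarrow> reducible C A B \<and> reducible C B A"

abbreviation baire :: "(nat \<Rightarrow> nat) set" where
  "baire \<equiv> UNIV"

definition cantor :: "(nat \<Rightarrow> nat) set" where
  "cantor = {x. \<forall>n. x n < 2}"

text \<open>
  Alternating strings of \<open>n\<close> number quantifiers in front of a matrix, beginning with an
  existential respectively a universal one.
\<close>

fun ex_prefix :: "nat \<Rightarrow> (nat list \<Rightarrow> bool) \<Rightarrow> bool"
  and all_prefix :: "nat \<Rightarrow> (nat list \<Rightarrow> bool) \<Rightarrow> bool" where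
  "ex_prefix 0 R = R []"
| "ex_prefix (Suc n) R = (\<exists>a. all_prefix n (\<lambda>as. R (a # as)))"
| "all_prefix 0 R = R []"
| "all_prefix (Suc n) R = (\<forall>a. ex_prefix n (\<lambda>as. R (a # as)))"

text \<open>
  The lightface classes of subsets of \<open>X\<close> for \<open>n \<ge> 1\<close>. The matrix is a recursive
  relation between \<open>n\<close> numbers and a point of \<open>X\<close>, that is, it is decided by a
  computation with the point as oracle that halts on all of its inputs.
\<close>

definition recursive_relation ::
    "nat \<Rightarrow> (nat \<Rightarrow> nat) set \<Rightarrow> ((nat \<Rightarrow> nat) \<Rightarrow> nat list \<Rightarrow> bool) \<Rightarrow> bool" where
  "recursive_relation n X R \<longleftrightarrow>
     (\<exists>c. \<forall>x\<in>X. \<forall>as. length as = n \<longrightarrow>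
        run c x (list_encode as) = Some (if R x as then 1 else 0))"

definition Sigma0 :: "nat \<Rightarrow> (nat \<Rightarrow> nat) set \<Rightarrow> (nat \<Rightarrow> nat) set set" where
  "Sigma0 n X = {S. \<exists>R. recursive_relation n X R \<and> S = {x \<in> X. ex_prefix n (R x)}}"

definition Pi0 :: "nat \<Rightarrow> (nat \<Rightarrow> nat) set \<Rightarrow> (nat \<Rightarrow> nat) set set" where
  "Pi0 n X = {X - S | S. S \<in> Sigma0 n X}"

definition SEL ::
    "(nat \<Rightarrow> nat) set set \<Rightarrow> (((nat \<Rightarrow> nat) \<Rightarrow> (nat \<Rightarrow> nat) option) \<Rightarrow> bool) \<Rightarrow> bool" where
  "SEL G C \<longleftrightarrow>
     (\<forall>S\<in>G. \<forall>Q\<in>Pi0 1 cantor. Q \<noteq> {} \<longrightarrow>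
        (\<exists>P\<in>Pi0 1 cantor. degree_equiv C P (S \<union> Q)))"

end

theory Submission imports Defs begin

text \<open>
  For (1) take all finite shifts of \<open>DNC\<^sub>2\<close>, for (5) all finite shifts of a \<open>\<Delta>\<^sup>0\<^sub>2\<close> 1-generic point
  together with \<open>DNC\<^sub>2\<close>. Such a set is dense and has no computable member, and if it were equivalent
  to a closed set, a Cohen-generic point mapped there and back would, by a category argument,
  produce a computable member. For (3) add to \<open>DNC\<^sub>2\<close> only the 1-generic point \<open>z\<close>: as \<open>z\<close> computes
  no \<open>DNC\<close> function, going there and back fixes \<open>z\<close>, so some functional is constantly \<open>z\<close> on a
  nonempty \<open>\<Pi>\<^sup>0\<^sub>1\<close> class, and by compactness \<open>z\<close> would be computable. For (2) follow a point of \<open>Q\<close>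
  until a marker at \<open>m\<close> announces a point of the \<open>m\<close>-th closed part of \<open>S\<close>. For (4) interrupt
  points of the tree of \<open>Q\<close> by markers whose positions code longer and longer witnessed initial
  segments of a point of \<open>S\<close>: with infinitely many markers they yield a point of \<open>S\<close>, and otherwise
  the tail behind the last marker is a point of \<open>Q\<close>.
\<close>

section \<open>Oracle computable functions\<close>

text \<open>Sets with a computable member are all equivalent, since constant maps reduce them to
  each other; so a counterexample needs a \<open>Q\<close> without computable members. The obstacle
  in (1) and (5) is that a reduction only promises that one of finitely many candidates succeeds at
  a given point, without saying which. Forcing with binary strings removes it: since
  \<open>P\<close> is closed, one finite string can settle the behaviour of all candidates at once.
  Such a string is only found during the proof, hence the shifts, which put members of the set above
  every string. In (1) no candidate can change its mind and any member above the string serves. In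
  (5) a learner may be forced to change its mind for ever, and 1-genericity of the tail turns this
  into actual divergence; a limit approximation of that tail keeps the set
  \<open>\<Sigma>\<^sup>0\<^sub>3\<close>. In (3) one learner returns from all of \<open>P\<close>,
  so freezing its guess on an effectively closed class fixes the program that succeeds there. In (4)
  infinitely many markers is a \<open>\<Pi>\<^sup>0\<^sub>2\<close> event, so the two cases get
  separate learners and nobody has to decide between them.\<close>

definition computable_on :: "(nat \<Rightarrow> nat) set \<Rightarrow> ((nat \<Rightarrow> nat) \<Rightarrow> nat \<Rightarrow> nat) \<Rightarrow> bool" where
  "computable_on X F \<longleftrightarrow> (\<exists>c. \<forall>g\<in>X. \<forall>n. run c g n = Some (F g n))"

definition decidable_on :: "(nat \<Rightarrow> nat) set \<Rightarrow> ((nat \<Rightarrow> nat) \<Rightarrow> nat \<Rightarrow> bool) \<Rightarrow> bool" where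
  "decidable_on X P \<longleftrightarrow> computable_on X (\<lambda>g n. of_bool (P g n))"

lemma computable_onI: "(\<And>g n. g \<in> X \<Longrightarrow> run c g n = Some (F g n)) \<Longrightarrow> computable_on X F"
  by (auto simp: computable_on_def)

lemma computable_on_cong:
  "computable_on X F \<Longrightarrow> (\<And>g n. g \<in> X \<Longrightarrow> F g n = G g n) \<Longrightarrow> computable_on X G"
  by (auto simp: computable_on_def)

lemma decidable_on_cong:
  "decidable_on X P \<Longrightarrow> (\<And>g n. g \<in> X \<Longrightarrow> P g n = Q g n) \<Longrightarrow> decidable_on X Q"
  by (auto simp: computable_on_def decidable_on_def)

lemma computable_on_subset: "computable_on Y F \<Longrightarrow> X \<subseteq> Y \<Longrightarrow> computable_on X F"
  by (auto simp: computable_on_def)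

lemma computable_on_comp:
  assumes "computable_on X F" "computable_on X G"
  shows "computable_on X (\<lambda>g n. F g (G g n))"
proof -
  obtain c d where "\<forall>g\<in>X. \<forall>n. run c g n = Some (F g n)" "\<forall>g\<in>X. \<forall>n. run d g n = Some (G g n)"
    using assms by (auto simp: computable_on_def)
  then show ?thesis by (intro computable_onI[where c = "Comp c d"]) simp
qed

lemma computable_on_id: "computable_on X (\<lambda>g n. n)"
  \<comment> \<open>There is no identity program; \<open>Pair Fst Snd\<close> splits a number and
    puts it together again.\<close>
  by (rule computable_onI[where c = "Comp Fst (Pair (Pair Fst Snd) Zero)"]) simp

lemma computable_on_oracle:
  "computable_on X F \<Longrightarrow> computable_on X (\<lambda>g n. g (F g n))"
  by (erule computable_on_comp[rotated]) (rule computable_onI[where c = Oracle], simp)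

lemma computable_on_Suc:
  "computable_on X F \<Longrightarrow> computable_on X (\<lambda>g n. Suc (F g n))"
  by (erule computable_on_comp[rotated]) (rule computable_onI[where c = Succ], simp)

lemma computable_on_fst:
  "computable_on X F \<Longrightarrow> computable_on X (\<lambda>g n. fst (prod_decode (F g n)))"
  by (erule computable_on_comp[rotated]) (rule computable_onI[where c = Fst], simp)

lemma computable_on_snd:
  "computable_on X F \<Longrightarrow> computable_on X (\<lambda>g n. snd (prod_decode (F g n)))"
  by (erule computable_on_comp[rotated]) (rule computable_onI[where c = Snd], simp)

lemma computable_on_pair:
  assumes "computable_on X F" "computable_on X G"
  shows "computable_on X (\<lambda>g n. prod_encode (F g n, G g n))"
proof -
  obtain c d where "\<forall>g\<in>X. \<forall>n. run c g n = Some (F g n)" "\<forall>g\<in>X. \<forall>n. run d g n = Some (G g n)"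
    using assms by (auto simp: computable_on_def)
  then show ?thesis by (intro computable_onI[where c = "Pair c d"]) simp
qed

lemma computable_on_const: "computable_on X (\<lambda>g n. k)"
proof (induction k)
  case 0
  show ?case by (rule computable_onI[where c = Zero]) simp
next
  case (Suc k)
  then show ?case by (rule computable_on_Suc)
qed

text \<open>Extra arguments of a body are read off one number with \<open>prod_decode\<close>. Each
  premise is then again a unary statement that the closure rules can take apart, so computability is
  proved by following the syntax of the term.\<close>

lemma computable_on_rec:
  assumes "computable_on X B"
    and "computable_on X (\<lambda>g m. S g (fst (prod_decode m)) (fst (prod_decode (snd (prod_decode m))))
      (snd (prod_decode (snd (prod_decode m)))))"
    and "computable_on X N"
  shows "computable_on X (\<lambda>g n. rec_nat (B g n) (\<lambda>k y. S g n k y) (N g n))"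
proof -
  obtain c where c: "\<And>g n. g \<in> X \<Longrightarrow> run c g n = Some (B g n)"
    using assms(1) by (auto simp: computable_on_def)
  obtain d where d: "\<And>g n k y. g \<in> X \<Longrightarrow> run d g (prod_encode (n, prod_encode (k, y))) = Some (S g n k y)"
    using assms(2) unfolding computable_on_def
    by (metis fst_conv prod_encode_inverse snd_conv)
  have "run (Prec c d) g (prod_encode (n, N)) = Some (rec_nat (B g n) (\<lambda>k y. S g n k y) N)"
    if "g \<in> X" for g n N
    using that by (induction N) (simp_all add: c d)
  then have "computable_on X
      (\<lambda>g m. rec_nat (B g (fst (prod_decode m))) (\<lambda>k y. S g (fst (prod_decode m)) k y) (snd (prod_decode m)))"
    by (intro computable_onI[where c = "Prec c d"]) (metis prod.collapse prod_decode_inverse)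
  from computable_on_comp[OF this computable_on_pair[OF computable_on_id assms(3)]]
  show ?thesis by simp
qed

text \<open>Unbounded search is the reason for the parameter \<open>X\<close>: witnesses need to
  exist only for oracles in \<open>X\<close>, which later is a \<open>\<Pi>\<^sup>0\<^sub>2\<close>
  set or the domain of a functional.\<close>

lemma computable_on_Least:
  assumes "decidable_on X (\<lambda>g m. P g (fst (prod_decode m)) (snd (prod_decode m)))"
    and "\<And>g n. g \<in> X \<Longrightarrow> \<exists>k. P g n k"
  shows "computable_on X (\<lambda>g n. LEAST k. P g n k)"
proof -
  obtain c where c: "\<And>g n k. g \<in> X \<Longrightarrow> run c g (prod_encode (n, k)) = Some (of_bool (P g n k))"
    using assms(1) unfolding computable_on_def decidable_on_def
    by (metis fst_conv prod_encode_inverse snd_conv)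
  \<comment> \<open>\<open>Mu\<close> looks for the value 0 while \<open>of_bool\<close> is 1 for
    true. The recursion sends 0 to 1 and every successor to 0.\<close>
  define neg where "neg = Comp (Prec (Comp Succ Zero) Zero) (Pair Zero c)"
  have neg: "run neg g (prod_encode (n, k)) = Some (of_bool (\<not> P g n k))" if "g \<in> X" for g n k
    using that by (simp add: neg_def c)
  have "run (Mu neg) g n = Some (LEAST k. P g n k)" if "g \<in> X" for g n
    using that assms(2)[of g n] by (simp add: neg)
  then show ?thesis by (rule computable_onI)
qed

text \<open>A case distinction is a primitive recursion of length 0 or 1.\<close>

lemma computable_on_if:
  assumes "decidable_on X P" "computable_on X F" "computable_on X G"
  shows "computable_on X (\<lambda>g n. if P g n then F g n else G g n)"
proof -
  have "computable_on X (\<lambda>g n. rec_nat (G g n) (\<lambda>k y. F g n) (of_bool (P g n)))"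
    by (intro computable_on_rec assms(1)[unfolded decidable_on_def] assms(3)
      computable_on_comp[OF assms(2)] computable_on_fst computable_on_id)
  then show ?thesis by (rule computable_on_cong) simp
qed

lemma computable_on_plus:
  assumes "computable_on X F" "computable_on X G"
  shows "computable_on X (\<lambda>g n. F g n + G g n)"
proof -
  have "computable_on X (\<lambda>g n. rec_nat (F g n) (\<lambda>k y. Suc y) (G g n))"
    by (intro computable_on_rec assms computable_on_Suc computable_on_snd computable_on_id)
  moreover have "rec_nat a (\<lambda>k y. Suc y) b = a + b" for a b :: nat by (induction b) auto
  ultimately show ?thesis by simp
qed

lemma computable_on_times:
  assumes "computable_on X F" "computable_on X G"
  shows "computable_on X (\<lambda>g n. F g n * G g n)"
proof -
  have "computable_on X (\<lambda>g n. rec_nat 0 (\<lambda>k y. F g n + y) (G g n))"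
    by (intro computable_on_rec assms(2) computable_on_comp[OF assms(1)] computable_on_plus
      computable_on_snd computable_on_fst computable_on_id computable_on_const)
  moreover have "rec_nat 0 (\<lambda>k y. a + y) b = a * b" for a b :: nat by (induction b) auto
  ultimately show ?thesis by simp
qed

lemma computable_on_minus:
  assumes "computable_on X F" "computable_on X G"
  shows "computable_on X (\<lambda>g n. F g n - G g n)"
proof -
  have pred: "computable_on X (\<lambda>g n. F g n - 1)" if "computable_on X F" for F
  proof -
    have "computable_on X (\<lambda>g n. rec_nat 0 (\<lambda>k y. k) (F g n))"
      by (intro computable_on_rec that computable_on_fst computable_on_snd computable_on_id computable_on_const)
    moreover have "rec_nat 0 (\<lambda>k y. k) b = b - 1" for b :: nat by (cases b) auto
    ultimately show ?thesis by simp
  qed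
  have "computable_on X (\<lambda>g n. rec_nat (F g n) (\<lambda>k y. y - 1) (G g n))"
    by (intro computable_on_rec assms pred computable_on_snd computable_on_id)
  moreover have "rec_nat a (\<lambda>k y. y - 1) b = a - b" for a b :: nat by (induction b) auto
  ultimately show ?thesis by simp
qed

lemma decidable_on_zero: "computable_on X F \<Longrightarrow> decidable_on X (\<lambda>g n. F g n = 0)"
proof -
  assume "computable_on X F"
  then have "computable_on X (\<lambda>g n. 1 - F g n)"
    by (intro computable_on_minus computable_on_const)
  moreover have "1 - a = of_bool (a = 0)" for a :: nat by auto
  ultimately show ?thesis by (simp add: decidable_on_def)
qed

lemma decidable_on_le:
  assumes "computable_on X F" "computable_on X G"
  shows "decidable_on X (\<lambda>g n. F g n \<le> G g n)"
  using decidable_on_zero[OF computable_on_minus[OF assms]] by simp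

lemma decidable_on_not:
  assumes "decidable_on X P"
  shows "decidable_on X (\<lambda>g n. \<not> P g n)"
  using decidable_on_zero[OF assms[unfolded decidable_on_def]] by simp

lemma decidable_on_less:
  assumes "computable_on X F" "computable_on X G"
  shows "decidable_on X (\<lambda>g n. F g n < G g n)"
  using decidable_on_le[OF computable_on_Suc[OF assms(1)] assms(2)] by (simp add: Suc_le_eq)

lemma decidable_on_conj:
  assumes "decidable_on X P" "decidable_on X Q"
  shows "decidable_on X (\<lambda>g n. P g n \<and> Q g n)"
  using computable_on_times[OF assms[unfolded decidable_on_def]]
  by (simp add: decidable_on_def of_bool_conj)

lemma decidable_on_disj:
  assumes "decidable_on X P" "decidable_on X Q"
  shows "decidable_on X (\<lambda>g n. P g n \<or> Q g n)"
  using decidable_on_not[OF decidable_on_conj[OF assms[THEN decidable_on_not]]] by simp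

lemma decidable_on_imp:
  assumes "decidable_on X P" "decidable_on X Q"
  shows "decidable_on X (\<lambda>g n. P g n \<longrightarrow> Q g n)"
  using decidable_on_disj[OF decidable_on_not[OF assms(1)] assms(2)] by (simp only: imp_conv_disj)

lemma decidable_on_eq:
  assumes "computable_on X F" "computable_on X G"
  shows "decidable_on X (\<lambda>g n. F g n = G g n)"
  using decidable_on_conj[OF decidable_on_le[OF assms] decidable_on_le[OF assms(2,1)]]
  by (simp add: eq_iff)

lemma decidable_on_comp:
  "decidable_on X P \<Longrightarrow> computable_on X G \<Longrightarrow> decidable_on X (\<lambda>g n. P g (G g n))"
  unfolding decidable_on_def by (rule computable_on_comp)

lemma decidable_on_ex_less:
  assumes "computable_on X N"
    and "decidable_on X (\<lambda>g m. P g (fst (prod_decode m)) (snd (prod_decode m)))"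
  shows "decidable_on X (\<lambda>g n. \<exists>k<N g n. P g n k)"
proof -
  have "decidable_on X (\<lambda>g m. P g (fst (prod_decode m)) (fst (prod_decode (snd (prod_decode m)))))"
    using decidable_on_comp[OF assms(2), of "\<lambda>g m. prod_encode (fst (prod_decode m), fst (prod_decode (snd (prod_decode m))))"]
    by (simp add: computable_on_pair computable_on_fst computable_on_snd computable_on_id)
  then have "computable_on X (\<lambda>g n. rec_nat 0 (\<lambda>k y. if P g n k then 1 else y) (N g n))"
    by (intro computable_on_rec assms(1) computable_on_if computable_on_snd computable_on_id computable_on_const)
  moreover have "rec_nat 0 (\<lambda>k y. if P k then 1 else y) b = (of_bool (\<exists>k<b. P k) :: nat)" for b P
    by (induction b) (auto simp: less_Suc_eq)
  ultimately show ?thesis by (simp add: decidable_on_def)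
qed

lemma decidable_on_all_less:
  assumes "computable_on X N"
    and "decidable_on X (\<lambda>g m. P g (fst (prod_decode m)) (snd (prod_decode m)))"
  shows "decidable_on X (\<lambda>g n. \<forall>k<N g n. P g n k)"
  using decidable_on_not[OF decidable_on_ex_less[OF assms(1) decidable_on_not[OF assms(2)]]] by simp

lemma decidable_on_ex_le:
  assumes "computable_on X N"
    and "decidable_on X (\<lambda>g m. P g (fst (prod_decode m)) (snd (prod_decode m)))"
  shows "decidable_on X (\<lambda>g n. \<exists>k\<le>N g n. P g n k)"
  using decidable_on_ex_less[OF computable_on_Suc[OF assms(1)] assms(2)] by (simp add: less_Suc_eq_le)

lemma decidable_on_all_le:
  assumes "computable_on X N"
    and "decidable_on X (\<lambda>g m. P g (fst (prod_decode m)) (snd (prod_decode m)))"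
  shows "decidable_on X (\<lambda>g n. \<forall>k\<le>N g n. P g n k)"
  using decidable_on_all_less[OF computable_on_Suc[OF assms(1)] assms(2)] by (simp add: less_Suc_eq_le)

text \<open>Extending by zeros lets a finite string serve as a total oracle.\<close>

definition pad :: "nat list \<Rightarrow> nat \<Rightarrow> nat" where
  "pad l i = (if i < length l then l ! i else 0)"

lemma computable_on_list_decode:
  "computable_on X F \<Longrightarrow> computable_on X (\<lambda>g n. list_encode (list_decode (F g n)))"
  by simp

lemma prod_decode_0: "prod_decode 0 = (0, 0)"
proof -
  have "prod_encode (0, 0) = 0" by (simp add: prod_encode_def)
  then show ?thesis by (metis prod_encode_inverse)
qed

lemma computable_on_drop:
  assumes "computable_on X (\<lambda>g n. list_encode (L g n))" "computable_on X F"
  shows "computable_on X (\<lambda>g n. list_encode (drop (F g n) (L g n)))"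
proof -
  have "computable_on X (\<lambda>g n. rec_nat (list_encode (L g n)) (\<lambda>k y. snd (prod_decode (y - 1))) (F g n))"
    by (intro computable_on_rec assms computable_on_snd computable_on_minus computable_on_id computable_on_const)
  \<comment> \<open>The empty list is safe too: its code is 0, \<open>0 - 1 = 0\<close> and
    \<open>prod_decode 0 = (0, 0)\<close>, so the tail of 0 is 0 again.\<close>
  moreover have tl: "snd (prod_decode (list_encode l - 1)) = list_encode (tl l)" for l
    by (cases l) (simp_all add: prod_decode_0)
  have "rec_nat (list_encode l) (\<lambda>k y. snd (prod_decode (y - 1))) k = list_encode (drop k l)" for k l
    by (induction k) (simp_all add: tl[simplified] drop_Suc tl_drop)
  ultimately show ?thesis by simp
qed

lemma computable_on_pad:
  assumes "computable_on X (\<lambda>g n. list_encode (L g n))" "computable_on X F"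
  shows "computable_on X (\<lambda>g n. pad (L g n) (F g n))"
proof -
  have "computable_on X (\<lambda>g n. fst (prod_decode (list_encode (drop (F g n) (L g n)) - 1)))"
    by (intro computable_on_fst computable_on_minus computable_on_drop assms computable_on_const)
  moreover have "fst (prod_decode (list_encode (drop k l) - 1)) = pad l k" for k l
  proof (cases "k < length l")
    case True
    then show ?thesis by (simp add: pad_def flip: Cons_nth_drop_Suc)
  next
    case False
    then show ?thesis by (simp add: pad_def prod_decode_0)
  qed
  ultimately show ?thesis by simp
qed

lemma list_encode_eq_0_iff: "list_encode l = 0 \<longleftrightarrow> l = []"
  by (cases l) auto

lemma computable_on_length:
  assumes "computable_on X (\<lambda>g n. list_encode (L g n))"
  shows "computable_on X (\<lambda>g n. length (L g n))"
proof -
  have "computable_on X (\<lambda>g n. LEAST k. list_encode (drop k (L g n)) = 0)"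
    by (intro computable_on_Least decidable_on_zero computable_on_drop computable_on_comp[OF assms]
      computable_on_fst computable_on_snd computable_on_id) (auto simp: list_encode_eq_0_iff)
  moreover have "(LEAST k. list_encode (drop k l) = 0) = length l" for l
    by (rule Least_equality) (auto simp: list_encode_eq_0_iff)
  ultimately show ?thesis by simp
qed

lemma computable_on_map_upt:
  assumes f: "computable_on X (\<lambda>g m. f g (fst (prod_decode m)) (snd (prod_decode m)))"
    and "computable_on X A" "computable_on X B"
  shows "computable_on X (\<lambda>g n. list_encode (map (\<lambda>i. f g n i) [A g n..<B g n]))"
proof -
  have f': "computable_on X (\<lambda>g n. f g (F g n) (G g n))" if "computable_on X F" "computable_on X G" for F G
    using computable_on_comp[OF f computable_on_pair[OF that]] by simp
  \<comment> \<open>The head is the outermost pair of a list code, so the recursion has to start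
    with the last element, \<open>B g n - 1\<close>.\<close>
  have "computable_on X (\<lambda>g n. rec_nat 0 (\<lambda>k y. Suc (prod_encode (f g n (B g n - Suc k), y))) (B g n - A g n))"
    by (intro computable_on_rec computable_on_Suc computable_on_pair f' computable_on_minus
      computable_on_comp[OF assms(3)] computable_on_fst computable_on_snd computable_on_id
      assms(2,3) computable_on_const)
  moreover have "k \<le> b \<Longrightarrow> rec_nat 0 (\<lambda>k y. Suc (prod_encode (f (b - Suc k), y))) k
      = list_encode (map f [b - k..<b])" for f :: "nat \<Rightarrow> nat" and b k
  proof (induction k)
    case (Suc k)
    then have "[b - Suc k..<b] = (b - Suc k) # [b - k..<b]"
      by (simp add: upt_conv_Cons Suc_diff_Suc)
    with Suc show ?case by simp
  qed simp
  from this[of "b - a" b for a b]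
  have "rec_nat 0 (\<lambda>k y. Suc (prod_encode (f (b - Suc k), y))) (b - a)
      = list_encode (map f [a..<b])" for f :: "nat \<Rightarrow> nat" and a b
    by (cases "a \<le> b") auto
  ultimately show ?thesis by simp
qed

lemma computable_on_restrict:
  assumes "computable_on X (\<lambda>g m. f g (fst (prod_decode m)) (snd (prod_decode m)))"
    and "computable_on X N"
  shows "computable_on X (\<lambda>g n. list_encode (restrict_to (f g n) (N g n)))"
  unfolding restrict_to_def by (intro computable_on_map_upt assms computable_on_const)

lemma restrict_pad: "restrict_to (pad l) (length l) = l"
  by (rule nth_equalityI) (simp_all add: restrict_to_def pad_def)

lemma computable_on_take:
  assumes "computable_on X (\<lambda>g n. list_encode (L g n))" "computable_on X F"
  shows "computable_on X (\<lambda>g n. list_encode (take (F g n) (L g n)))"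
proof -
  have "computable_on X (\<lambda>g n. list_encode (restrict_to (\<lambda>i. pad (L g n) i)
      (if F g n < length (L g n) then F g n else length (L g n))))"
    by (intro computable_on_restrict computable_on_pad computable_on_comp[OF assms(1)] computable_on_if
        decidable_on_less computable_on_length assms
        computable_on_fst computable_on_snd computable_on_id)
  moreover have "restrict_to (pad l) (if k < length l then k else length l) = take k l" for k l
    by (auto simp: restrict_to_def pad_def intro!: nth_equalityI)
  ultimately show ?thesis by simp
qed

lemma computable_on_Cons:
  assumes "computable_on X F" "computable_on X (\<lambda>g n. list_encode (L g n))"
  shows "computable_on X (\<lambda>g n. list_encode (F g n # L g n))"
  using computable_on_Suc[OF computable_on_pair[OF assms]] by simp

lemma computable_on_Nil: "computable_on X (\<lambda>g n. list_encode [])"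
  by (rule computable_on_const)

lemma computable_on_snoc:
  assumes "computable_on X F" "computable_on X (\<lambda>g n. list_encode (L g n))"
  shows "computable_on X (\<lambda>g n. list_encode (L g n @ [F g n]))"
proof -
  have "computable_on X (\<lambda>g n. list_encode (restrict_to
      (\<lambda>i. if i < length (L g n) then pad (L g n) i else F g n) (Suc (length (L g n)))))"
    by (intro computable_on_restrict computable_on_pad computable_on_comp[OF assms(1)] 
        computable_on_comp[OF assms(2)] computable_on_if computable_on_Suc assms
        decidable_on_less computable_on_length computable_on_fst computable_on_snd computable_on_id)
  moreover have "restrict_to (\<lambda>i. if i < length l then pad l i else k) (Suc (length l)) = l @ [k]" for k l
    by (auto simp: restrict_to_def pad_def intro!: map_upt_eqI)
  ultimately show ?thesis by simp
qed

lemma decidable_on_list_eq: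
  assumes "computable_on X (\<lambda>g n. list_encode (L g n))" "computable_on X (\<lambda>g n. list_encode (L' g n))"
  shows "decidable_on X (\<lambda>g n. L g n = L' g n)"
  using decidable_on_eq[OF assms] by (simp add: list_encode_eq)

lemmas computable_intros =
  computable_on_id computable_on_const computable_on_oracle computable_on_Suc computable_on_fst
  computable_on_snd computable_on_pair computable_on_rec computable_on_if computable_on_plus
  computable_on_times computable_on_minus decidable_on_list_eq decidable_on_le decidable_on_less decidable_on_not
  decidable_on_conj decidable_on_disj decidable_on_imp decidable_on_eq decidable_on_ex_less
  decidable_on_all_less decidable_on_ex_le decidable_on_all_le computable_on_list_decode
  computable_on_drop computable_on_pad computable_on_length computable_on_map_upt
  computable_on_restrict computable_on_take computable_on_Cons computable_on_Nil computable_on_snoc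

text \<open>The program \<open>d\<close> simulates the oracle. Since the simulated oracle may depend
  on a parameter \<open>p\<close>, each subprogram has to carry \<open>p\<close> along. The equation
  is between options, so divergence is transferred as well, which composing two partial functionals
  requires.\<close>

lemma run_subst_oracle:
  "\<exists>c'. \<forall>g p h. (\<forall>i. run d g (prod_encode (p, i)) = Some (h i)) \<longrightarrow>
     (\<forall>n. run c' g (prod_encode (p, n)) = run c h n)"
proof (induction c)
  case Zero
  show ?case by (rule exI[of _ Zero]) simp
next
  case Succ
  show ?case by (rule exI[of _ "Comp Succ Snd"]) simp
next
  case Fst
  show ?case by (rule exI[of _ "Comp Fst Snd"]) simp
next
  case Snd
  show ?case by (rule exI[of _ "Comp Snd Snd"]) simp
next
  case Oracle
  show ?case by (rule exI[of _ d]) simp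
next
  case (Pair c1 c2)
  then obtain d1 d2 where *: "\<forall>g p h. (\<forall>i. run d g (prod_encode (p, i)) = Some (h i)) \<longrightarrow>
     (\<forall>n. run d1 g (prod_encode (p, n)) = run c1 h n \<and> run d2 g (prod_encode (p, n)) = run c2 h n)"
    by metis
  show ?case
  proof (intro exI[of _ "Pair d1 d2"] allI impI)
    fix g p h n
    assume "\<forall>i. run d g (prod_encode (p, i)) = Some (h i)"
    then have r: "run d1 g (prod_encode (p, n)) = run c1 h n" "run d2 g (prod_encode (p, n)) = run c2 h n" for n
      using * by blast+
    then show "run (Pair d1 d2) g (prod_encode (p, n)) = run (Pair c1 c2) h n"
      by simp
  qed
next
  case (Comp c1 c2)
  then obtain d1 d2 where *: "\<forall>g p h. (\<forall>i. run d g (prod_encode (p, i)) = Some (h i)) \<longrightarrow>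
     (\<forall>n. run d1 g (prod_encode (p, n)) = run c1 h n \<and> run d2 g (prod_encode (p, n)) = run c2 h n)"
    by metis
  show ?case
  proof (intro exI[of _ "Comp d1 (Pair Fst d2)"] allI impI)
    fix g p h n
    assume "\<forall>i. run d g (prod_encode (p, i)) = Some (h i)"
    then have r: "run d1 g (prod_encode (p, n)) = run c1 h n" "run d2 g (prod_encode (p, n)) = run c2 h n" for n
      using * by blast+
    then show "run (Comp d1 (Pair Fst d2)) g (prod_encode (p, n)) = run (Comp c1 c2) h n"
      by (cases "run c2 h n") simp_all
  qed
next
  case (Prec c1 c2)
  then obtain d1 d2 where *: "\<forall>g p h. (\<forall>i. run d g (prod_encode (p, i)) = Some (h i)) \<longrightarrow>
     (\<forall>n. run d1 g (prod_encode (p, n)) = run c1 h n \<and> run d2 g (prod_encode (p, n)) = run c2 h n)"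
    by metis
  \<comment> \<open>Recursion and search append their counter to the pair \<open>(p, n)\<close>,
    whereas the translated body expects \<open>p\<close> in front of everything else; this program
    reassociates.\<close>
  define step where "step = Comp d2 (Pair (Comp Fst Fst) (Pair (Comp Snd Fst) Snd))"
  show ?case
  proof (intro exI[of _ "Comp (Prec d1 step) (Pair (Pair Fst (Comp Fst Snd)) (Comp Snd Snd))"] allI impI)
    fix g p h n
    assume "\<forall>i. run d g (prod_encode (p, i)) = Some (h i)"
    then have r: "run d1 g (prod_encode (p, n)) = run c1 h n" "run d2 g (prod_encode (p, n)) = run c2 h n" for n
      using * by blast+
    have "run step g (prod_encode (prod_encode (p, n), m)) = run c2 h (prod_encode (n, m))" for n m
      by (simp add: step_def r)
    then show "run (Comp (Prec d1 step) (Pair (Pair Fst (Comp Fst Snd)) (Comp Snd Snd))) g (prod_encode (p, n))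
        = run (Prec c1 c2) h n"
      by (simp add: r)
  qed
next
  case (Mu c)
  then obtain d1 where *: "\<forall>g p h. (\<forall>i. run d g (prod_encode (p, i)) = Some (h i)) \<longrightarrow>
     (\<forall>n. run d1 g (prod_encode (p, n)) = run c h n)"
    by metis
  define d2 where "d2 = Comp d1 (Pair (Comp Fst Fst) (Pair (Comp Snd Fst) Snd))"
  show ?case
  proof (intro exI[of _ "Mu d2"] allI impI)
    fix g p h n
    assume "\<forall>i. run d g (prod_encode (p, i)) = Some (h i)"
    then have "run d1 g (prod_encode (p, n)) = run c h n" for n
      using * by blast
    then have "run d2 g (prod_encode (prod_encode (p, n), m)) = run c h (prod_encode (n, m))" for n m
      by (simp add: d2_def)
    then show "run (Mu d2) g (prod_encode (p, n)) = run (Mu c) h n"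
      by simp
  qed
qed

lemma computable_on_subst:
  assumes F: "computable_on Y F"
    and H: "computable_on X (\<lambda>g m. H g (fst (prod_decode m)) (snd (prod_decode m)))"
    and G: "computable_on X G"
    and Y: "\<And>g n. g \<in> X \<Longrightarrow> H g n \<in> Y"
  shows "computable_on X (\<lambda>g n. F (H g n) (G g n))"
proof -
  obtain c where c: "\<forall>g\<in>Y. \<forall>n. run c g n = Some (F g n)"
    using F by (auto simp: computable_on_def)
  obtain d where d: "\<And>g n i. g \<in> X \<Longrightarrow> run d g (prod_encode (n, i)) = Some (H g n i)"
    using H unfolding computable_on_def by (metis fst_conv prod_encode_inverse snd_conv)
  obtain c' where c': "\<And>g p h n. (\<And>i. run d g (prod_encode (p, i)) = Some (h i)) \<Longrightarrow>
     run c' g (prod_encode (p, n)) = run c h n"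
    using run_subst_oracle[of d c] by metis
  have "run c' g (prod_encode (p, n)) = Some (F (H g p) n)" if "g \<in> X" for g p n
    using c'[of g p "H g p"] d c Y that by simp
  then have "computable_on X (\<lambda>g m. F (H g (fst (prod_decode m))) (snd (prod_decode m)))"
    by (intro computable_onI[where c = c']) (metis prod.collapse prod_decode_inverse)
  from computable_on_comp[OF this computable_on_pair[OF computable_on_id G]]
  show ?thesis by simp
qed

lemma decidable_on_subst:
  assumes "decidable_on Y P"
    and "computable_on X (\<lambda>g m. H g (fst (prod_decode m)) (snd (prod_decode m)))"
    and "computable_on X G"
    and "\<And>g n. g \<in> X \<Longrightarrow> H g n \<in> Y"
  shows "decidable_on X (\<lambda>g n. P (H g n) (G g n))"
  using computable_on_subst[of Y "\<lambda>g n. of_bool (P g n)", OF assms[unfolded decidable_on_def]]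
  by (simp add: decidable_on_def)

section \<open>Derivations of computations\<close>

definition entry :: "nat \<Rightarrow> nat \<Rightarrow> nat \<Rightarrow> nat" where
  "entry e n y = prod_encode (e, prod_encode (n, y))"

definition node :: "nat \<Rightarrow> nat \<Rightarrow> nat \<Rightarrow> nat" where
  "node i j k = 5 + 4 * prod_encode (i, j) + k"

lemma code_of_node:
  "code_of (node i j 0) = Pair (code_of i) (code_of j)"
  "code_of (node i j 1) = Comp (code_of i) (code_of j)"
  "code_of (node i j 2) = Prec (code_of i) (code_of j)"
  "code_of (node i j 3) = Mu (code_of i)"
proof -
  have "code_of (node i j k) =
      (if k = 0 then Pair (code_of i) (code_of j)
       else if k = 1 then Comp (code_of i) (code_of j)
       else if k = 2 then Prec (code_of i) (code_of j)
       else Mu (code_of i))" if "k < 4" for k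
    using that unfolding node_def add.assoc by (subst code_of.simps) (simp add: Let_def)
  then show "code_of (node i j 0) = Pair (code_of i) (code_of j)"
    "code_of (node i j 1) = Comp (code_of i) (code_of j)"
    "code_of (node i j 2) = Prec (code_of i) (code_of j)"
    "code_of (node i j 3) = Mu (code_of i)"
    by simp_all
qed

lemma code_of_atom:
  "code_of 0 = Zero" "code_of 1 = Succ" "code_of 2 = Fst" "code_of 3 = Snd" "code_of 4 = Oracle"
  by (simp_all add: code_of.simps)

lemma less_node: "i < node i j k" "j < node i j k"
  using le_prod_encode_1[of i j] le_prod_encode_2[of j i] by (simp_all add: node_def)

lemma code_number_cases:
  obtains "e < 5" | i j k where "k < 4" "e = node i j k"
proof (cases "e < 5")
  case False
  then have "e = node (fst (prod_decode ((e - 5) div 4))) (snd (prod_decode ((e - 5) div 4))) ((e - 5) mod 4)"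
    by (simp add: node_def)
  then show ?thesis using that(2)[of "(e - 5) mod 4"] by simp
qed (use that in blast)

text \<open>
  Kleene's T predicate is realised by certificates instead of a step-indexed interpreter: a
  derivation is a list of triples (program, input, output) in which each triple is justified by
  triples further down the list, so that checking it needs only bounded quantifiers.
\<close>

definition justified :: "(nat \<Rightarrow> nat) \<Rightarrow> nat set \<Rightarrow> nat \<Rightarrow> nat \<Rightarrow> nat \<Rightarrow> bool" where
  "justified g M e n y \<longleftrightarrow>
     e = 0 \<and> y = 0 \<or> e = 1 \<and> y = Suc n \<or> e = 2 \<and> y = fst (prod_decode n) \<or>
     e = 3 \<and> y = snd (prod_decode n) \<or> e = 4 \<and> y = g n \<or>
     (\<exists>i<e. \<exists>j<e.
        e = node i j 0 \<and> entry i n (fst (prod_decode y)) \<in> M \<and> entry j n (snd (prod_decode y)) \<in> M \<or>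
        e = node i j 1 \<and> (\<exists>a. entry j n a \<in> M \<and> entry i a y \<in> M) \<or>
        e = node i j 2 \<and> snd (prod_decode n) = 0 \<and> entry i (fst (prod_decode n)) y \<in> M \<or>
        e = node i j 2 \<and> (\<exists>k<snd (prod_decode n). snd (prod_decode n) = Suc k \<and>
           (\<exists>a. entry e (prod_encode (fst (prod_decode n), k)) a \<in> M \<and>
             entry j (prod_encode (fst (prod_decode n), prod_encode (k, a))) y \<in> M)) \<or>
        e = node i j 3 \<and> entry i (prod_encode (n, y)) 0 \<in> M \<and>
          (\<forall>k<y. \<exists>a. entry i (prod_encode (n, k)) (Suc a) \<in> M))"

primrec derivation :: "(nat \<Rightarrow> nat) \<Rightarrow> nat list \<Rightarrow> bool" where
  "derivation g [] \<longleftrightarrow> True"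
| "derivation g (x # l) \<longleftrightarrow> justified g (set l) (fst (prod_decode x))
      (fst (prod_decode (snd (prod_decode x)))) (snd (prod_decode (snd (prod_decode x)))) \<and> derivation g l"

text \<open>\<open>M\<close> occurs only positively in \<open>justified\<close>, so the formula is
  rebuilt connective by connective.\<close>

lemma justified_mono:
  assumes "justified g M e n y" "M \<subseteq> N"
  shows "justified g N e n y"
  using assms(1) unfolding justified_def
  by - (assumption | erule subsetD[OF assms(2)] disj_forward conj_forward ex_forward all_forward imp_forward)+

lemma justified_sound:
  assumes M: "\<And>e n y. entry e n y \<in> M \<Longrightarrow> run (code_of e) g n = Some y"
    and "justified g M e n y"
  shows "run (code_of e) g n = Some y"
  using assms(2) unfolding justified_def
proof (elim disjE exE conjE)
  fix i j assume e: "e = node i j 3" and z: "entry i (prod_encode (n, y)) 0 \<in> M"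
    and s: "\<forall>k<y. \<exists>a. entry i (prod_encode (n, k)) (Suc a) \<in> M"
  have z: "run (code_of i) g (prod_encode (n, y)) = Some 0" using M z by blast
  have s: "\<exists>a. run (code_of i) g (prod_encode (n, k)) = Some (Suc a)" if "k < y" for k
    using M s that by blast
  have "(LEAST k. run (code_of i) g (prod_encode (n, k)) = Some 0) = y"
    using z s by (intro Least_equality) (auto, metis not_le_imp_less option.inject nat.distinct(1))
  moreover have "\<exists>k. run (code_of i) g (prod_encode (n, k)) = Some 0 \<and>
             (\<forall>j<k. run (code_of i) g (prod_encode (n, j)) \<noteq> None)"
    using z s by fastforce
  ultimately show ?thesis by (simp add: e code_of_node)
next
  fix i j k a
  assume e: "e = node i j 2" and k: "snd (prod_decode n) = Suc k"
    and a: "entry e (prod_encode (fst (prod_decode n), k)) a \<in> M"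
    and y: "entry j (prod_encode (fst (prod_decode n), prod_encode (k, a))) y \<in> M"
  show ?thesis using M[OF a] M[OF y] by (simp add: e code_of_node k)
qed (use M in \<open>auto simp: code_of_atom[simplified] code_of_node[simplified]\<close>)

lemma derivation_sound:
  assumes "derivation g l" "entry e n y \<in> set l"
  shows "run (code_of e) g n = Some y"
  using assms
proof (induction l arbitrary: e n y)
  case (Cons x l)
  then show ?case
    by (auto simp: entry_def intro: justified_sound[where M = "set l"])
qed simp

lemma derivation_append: "derivation g l \<Longrightarrow> derivation g l' \<Longrightarrow> derivation g (l @ l')"
  by (induction l) (auto elim: justified_mono)

definition derivable :: "(nat \<Rightarrow> nat) \<Rightarrow> nat \<Rightarrow> bool" where
  "derivable g x \<longleftrightarrow> (\<exists>l. derivation g l \<and> x \<in> set l)"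

lemma derivable_finite:
  assumes "finite M" "\<forall>x\<in>M. derivable g x"
  shows "\<exists>l. derivation g l \<and> M \<subseteq> set l"
  using assms
proof (induction M)
  case empty
  show ?case by (rule exI[of _ "[]"]) simp
next
  case (insert x M)
  then obtain l l' where "derivation g l" "M \<subseteq> set l" "derivation g l'" "x \<in> set l'"
    by (auto simp: derivable_def)
  then show ?case by (intro exI[of _ "l @ l'"]) (auto intro: derivation_append)
qed

lemma derivable_step:
  assumes "justified g M e n y" "finite M" "\<forall>x\<in>M. derivable g x"
  shows "derivable g (entry e n y)"
proof -
  obtain l where "derivation g l" "M \<subseteq> set l" using derivable_finite assms by blast
  then have "derivation g (entry e n y # l)"
    using justified_mono[OF assms(1), of "set l"] by (simp add: entry_def)
  then show ?thesis unfolding derivable_def by (metis list.set_intros(1))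
qed

text \<open>The bounds on \<open>i\<close> and \<open>j\<close> keep \<open>justified\<close>
  decidable; they come for free because a compound has a larger number than its components.\<close>

lemma justified_nodeI:
  assumes "e = node i j 0 \<and> entry i n (fst (prod_decode y)) \<in> M \<and> entry j n (snd (prod_decode y)) \<in> M \<or>
        e = node i j 1 \<and> (\<exists>a. entry j n a \<in> M \<and> entry i a y \<in> M) \<or>
        e = node i j 2 \<and> snd (prod_decode n) = 0 \<and> entry i (fst (prod_decode n)) y \<in> M \<or>
        e = node i j 2 \<and> (\<exists>k<snd (prod_decode n). snd (prod_decode n) = Suc k \<and>
           (\<exists>a. entry e (prod_encode (fst (prod_decode n), k)) a \<in> M \<and>
             entry j (prod_encode (fst (prod_decode n), prod_encode (k, a))) y \<in> M)) \<or>
        e = node i j 3 \<and> entry i (prod_encode (n, y)) 0 \<in> M \<and>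
          (\<forall>k<y. \<exists>a. entry i (prod_encode (n, k)) (Suc a) \<in> M)"
  shows "justified g M e n y"
proof -
  have "i < e \<and> j < e" using assms less_node by auto
  then show ?thesis using assms unfolding justified_def by blast
qed

lemma justified_Pair:
  "entry i n u \<in> M \<Longrightarrow> entry j n v \<in> M \<Longrightarrow> justified g M (node i j 0) n (prod_encode (u, v))"
  by (rule justified_nodeI[of _ i j]) simp

lemma justified_Comp:
  "entry j n u \<in> M \<Longrightarrow> entry i u y \<in> M \<Longrightarrow> justified g M (node i j 1) n y"
  by (rule justified_nodeI[of _ i j]) blast

lemma justified_Prec_0:
  "entry i x y \<in> M \<Longrightarrow> justified g M (node i j 2) (prod_encode (x, 0)) y"
  by (rule justified_nodeI[of _ i j]) simp

lemma justified_Prec_Suc: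
  "entry (node i j 2) (prod_encode (x, m)) u \<in> M \<Longrightarrow> entry j (prod_encode (x, prod_encode (m, u))) y \<in> M \<Longrightarrow>
    justified g M (node i j 2) (prod_encode (x, Suc m)) y"
  by (rule justified_nodeI[of _ i j]) auto

lemma justified_Mu:
  "entry i (prod_encode (n, y)) 0 \<in> M \<Longrightarrow> (\<And>k. k < y \<Longrightarrow> \<exists>a. entry i (prod_encode (n, k)) (Suc a) \<in> M) \<Longrightarrow>
    justified g M (node i j 3) n y"
  by (rule justified_nodeI[of _ i j]) blast

lemma derivable_complete: "run (code_of e) g n = Some y \<Longrightarrow> derivable g (entry e n y)"
proof (induction e arbitrary: n y rule: less_induct)
  case (less e)
  show ?case
  proof (cases rule: code_number_cases[of e])
    case 1
    then have "e = 0 \<or> e = 1 \<or> e = 2 \<or> e = 3 \<or> e = 4" by auto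
    then have "justified g {} e n y"
      using less.prems by (auto simp: justified_def code_of_atom[simplified])
    then show ?thesis by (rule derivable_step) auto
  next
    case (2 i j k)
    have lt: "i < e" "j < e" using 2(2) less_node by auto
    note IHi = less.IH[OF lt(1)] and IHj = less.IH[OF lt(2)]
    consider "k = 0" | "k = 1" | "k = 2" | "k = 3" using 2 by linarith
    then show ?thesis
    proof cases
      case a: 1
      then obtain u v where "run (code_of i) g n = Some u" "run (code_of j) g n = Some v" "y = prod_encode (u, v)"
        using less.prems 2 by (auto simp: code_of_node bind_eq_Some_conv)
      then show ?thesis
        using IHi IHj 2 a justified_Pair
        by (intro derivable_step[where M = "{entry i n u, entry j n v}"]) auto
    next
      case a: 2
      then obtain u where "run (code_of j) g n = Some u" "run (code_of i) g u = Some y"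
        using less.prems 2 by (auto simp: code_of_node[simplified] bind_eq_Some_conv)
      then show ?thesis
        using IHi IHj 2 a
        by (intro derivable_step[where M = "{entry j n u, entry i u y}"]) (auto simp del: One_nat_def intro!: justified_Comp[where u = u])
    next
      case a: 3
      \<comment> \<open>The value at \<open>Suc m\<close> rests on a triple for the same program
        \<open>e\<close> at \<open>m\<close>. The induction over program numbers does not reach it,
        hence an inner induction on \<open>m\<close>.\<close>
      have "derivable g (entry e (prod_encode (x, m)) y)"
        if "run (code_of e) g (prod_encode (x, m)) = Some y" for x m y
        using that
      proof (induction m arbitrary: y)
        case 0
        then show ?case
          using IHi 2 a justified_Prec_0
          by (intro derivable_step[where M = "{entry i x y}"]) (auto simp: code_of_node)
      next
        case (Suc m)
        then obtain u where u: "run (code_of e) g (prod_encode (x, m)) = Some u"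
            "run (code_of j) g (prod_encode (x, prod_encode (m, u))) = Some y"
          using 2 a by (auto simp: code_of_node bind_eq_Some_conv)
        show ?case
          using Suc.IH[OF u(1)] IHj[OF u(2)] 2 a
          by (intro derivable_step[where M = "{entry e (prod_encode (x, m)) u,
              entry j (prod_encode (x, prod_encode (m, u))) y}"]) (auto intro!: justified_Prec_Suc[where u = u])
      qed
      from this[of "fst (prod_decode n)" "snd (prod_decode n)" y] show ?thesis
        using less.prems by simp
    next
      case a: 4
      let ?r = "\<lambda>k. run (code_of i) g (prod_encode (n, k))"
      obtain k where k: "?r k = Some 0" "\<forall>j<k. ?r j \<noteq> None" and y: "y = (LEAST k. ?r k = Some 0)"
        using less.prems 2 a by (auto simp: code_of_node split: if_splits)
      have y0: "?r y = Some 0" unfolding y by (rule LeastI[of _ k]) (rule k)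
      have "y \<le> k" unfolding y by (rule Least_le) (rule k)
      have s: "\<exists>a. ?r l = Some (Suc a)" if "l < y" for l
        using not_less_Least[of l, folded y] that y k(2) \<open>y \<le> k\<close>
        by (metis (mono_tags, lifting) not0_implies_Suc not_None_eq order_less_le_trans)
      then obtain f where f: "\<And>l. l < y \<Longrightarrow> ?r l = Some (Suc (f l))" by metis
      show ?thesis
        using IHi[OF y0] IHi[OF f] 2 a
        by (intro derivable_step[where M = "insert (entry i (prod_encode (n, y)) 0)
              ((\<lambda>l. entry i (prod_encode (n, l)) (Suc (f l))) ` {..<y})"]) (auto intro!: justified_Mu)
    qed
  qed
qed

section \<open>Checking derivations with bounded quantifiers\<close>

lemma member_less_list_encode: "x \<in> set l \<Longrightarrow> x < list_encode l"
proof (induction l)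
  case (Cons a l)
  then show ?case
    using le_prod_encode_1[of a "list_encode l"] le_prod_encode_2[of "list_encode l" a] by auto
qed simp

lemma entry_bounds: "e \<le> entry e n y" "n \<le> entry e n y" "y \<le> entry e n y"
  unfolding entry_def
  using le_prod_encode_1[of e "prod_encode (n, y)"] le_prod_encode_2[of "prod_encode (n, y)" e]
    le_prod_encode_1[of n y] le_prod_encode_2[of y n] by linarith+

lemma entry_less_list_encode:
  assumes "entry e n y \<in> set l"
  shows "e < list_encode l" "n < list_encode l" "y < list_encode l"
  using member_less_list_encode[OF assms] entry_bounds[where e = e and n = n and y = y] by auto

lemma decidable_on_member:
  assumes "computable_on X F" "computable_on X (\<lambda>g n. list_encode (L g n))"
  shows "decidable_on X (\<lambda>g n. F g n \<in> set (L g n))"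
proof -
  have "decidable_on X (\<lambda>g n. \<exists>i<length (L g n). pad (L g n) i = F g n)"
    by (intro computable_intros assms computable_on_comp[OF assms(1)] computable_on_comp[OF assms(2)])
  then show ?thesis
    by (rule decidable_on_cong) (auto simp: in_set_conv_nth pad_def)
qed

text \<open>The intermediate values occur inside members of \<open>l\<close> and so lie below the
  code of \<open>l\<close>.\<close>

lemma justified_bounded:
  "justified g (set l) e n y \<longleftrightarrow>
     e = 0 \<and> y = 0 \<or> e = 1 \<and> y = Suc n \<or> e = 2 \<and> y = fst (prod_decode n) \<or>
     e = 3 \<and> y = snd (prod_decode n) \<or> e = 4 \<and> y = g n \<or>
     (\<exists>i<e. \<exists>j<e.
        e = node i j 0 \<and> entry i n (fst (prod_decode y)) \<in> set l \<and> entry j n (snd (prod_decode y)) \<in> set l \<or>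
        e = node i j 1 \<and> (\<exists>a<list_encode l. entry j n a \<in> set l \<and> entry i a y \<in> set l) \<or>
        e = node i j 2 \<and> snd (prod_decode n) = 0 \<and> entry i (fst (prod_decode n)) y \<in> set l \<or>
        e = node i j 2 \<and> (\<exists>k<snd (prod_decode n). snd (prod_decode n) = Suc k \<and>
           (\<exists>a<list_encode l. entry e (prod_encode (fst (prod_decode n), k)) a \<in> set l \<and>
             entry j (prod_encode (fst (prod_decode n), prod_encode (k, a))) y \<in> set l)) \<or>
        e = node i j 3 \<and> entry i (prod_encode (n, y)) 0 \<in> set l \<and>
          (\<forall>k<y. \<exists>a<list_encode l. entry i (prod_encode (n, k)) (Suc a) \<in> set l))"
proof -
  have 1: "(\<exists>a. entry j n a \<in> set l \<and> P a) \<longleftrightarrow> (\<exists>a<list_encode l. entry j n a \<in> set l \<and> P a)" for j n P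
    using entry_less_list_encode(3) by blast
  have 2: "(\<exists>a. entry j n (Suc a) \<in> set l) \<longleftrightarrow> (\<exists>a<list_encode l. entry j n (Suc a) \<in> set l)" for j n
    using entry_less_list_encode(3) Suc_lessD by blast
  show ?thesis unfolding justified_def 1 2 ..
qed

lemma derivation_nth:
  "derivation g l \<longleftrightarrow> (\<forall>k<length l. justified g (set (drop (Suc k) l)) (fst (prod_decode (pad l k)))
      (fst (prod_decode (snd (prod_decode (pad l k))))) (snd (prod_decode (snd (prod_decode (pad l k))))))"
proof (induction l)
  case (Cons x l)
  then show ?case by (simp add: pad_def All_less_Suc2)
qed simp

lemma decidable_derivation: "decidable_on X (\<lambda>g n. derivation g (list_decode n))"
  unfolding derivation_nth justified_bounded entry_def node_def
  by (intro computable_intros decidable_on_member)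

definition derives :: "(nat \<Rightarrow> nat) \<Rightarrow> nat \<Rightarrow> nat \<Rightarrow> nat \<Rightarrow> nat \<Rightarrow> bool" where
  "derives g t e n y \<longleftrightarrow> derivation g (list_decode t) \<and> entry e n y \<in> set (list_decode t)"

lemma derives_iff_run: "(\<exists>t. derives g t e n y) \<longleftrightarrow> run (code_of e) g n = Some y"
proof
  assume "run (code_of e) g n = Some y"
  then show "\<exists>t. derives g t e n y"
    using derivable_complete unfolding derivable_def derives_def by (metis list_encode_inverse)
qed (auto simp: derives_def intro: derivation_sound)

lemma derives_run: "derives g t e n y \<Longrightarrow> run (code_of e) g n = Some y"
  using derives_iff_run by blast

lemma derives_bounds: "derives g t e n y \<Longrightarrow> e < t \<and> n < t \<and> y < t"
  unfolding derives_def using entry_less_list_encode[of e n y "list_decode t"] by simp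

section \<open>The use principle\<close>

definition agree :: "nat \<Rightarrow> (nat \<Rightarrow> nat) \<Rightarrow> (nat \<Rightarrow> nat) \<Rightarrow> bool" where
  "agree n x y \<longleftrightarrow> (\<forall>i<n. x i = y i)"

lemma justified_agree:
  assumes "justified g M e n y" "e = 4 \<Longrightarrow> g n = h n"
  shows "justified h M e n y"
proof -
  have "e = 4 \<and> y = g n \<longleftrightarrow> e = 4 \<and> y = h n" using assms(2) by auto
  then show ?thesis using assms(1) unfolding justified_def by simp
qed

text \<open>A query at \<open>n\<close> is recorded as a triple with input \<open>n\<close>, and the
  code of the list exceeds all numbers in its triples. The code of a derivation thus also bounds its
  use.\<close>

lemma derivation_agree:
  "derivation g l \<Longrightarrow> agree (list_encode l) g h \<Longrightarrow> derivation h l"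
proof (induction l)
  case (Cons x l)
  have x: "x = entry (fst (prod_decode x)) (fst (prod_decode (snd (prod_decode x)))) (snd (prod_decode (snd (prod_decode x))))"
    by (simp add: entry_def)
  have "fst (prod_decode (snd (prod_decode x))) < list_encode (x # l)"
    by (rule entry_less_list_encode(2)[of "fst (prod_decode x)" _ "snd (prod_decode (snd (prod_decode x)))"]) (simp add: entry_def)
  moreover have "list_encode l \<le> list_encode (x # l)"
    using le_prod_encode_2[of "list_encode l" x] by simp
  ultimately show ?case
    using Cons by (auto simp: agree_def simp del: list_encode.simps intro: justified_agree)
qed simp

lemma derives_agree: "derives g t e n y \<Longrightarrow> agree t g h \<Longrightarrow> derives h t e n y"
  unfolding derives_def using derivation_agree[of g "list_decode t" h] by simp

lemma agree_sym: "agree n x y \<Longrightarrow> agree n y x"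
  by (simp add: agree_def)

lemma agree_trans: "agree n x y \<Longrightarrow> agree n y z \<Longrightarrow> agree n x z"
  by (simp add: agree_def)

lemma agree_mono: "agree n x y \<Longrightarrow> m \<le> n \<Longrightarrow> agree m x y"
  by (simp add: agree_def)

lemma agree_refl [simp]: "agree n x x"
  by (simp add: agree_def)

lemma agree_iff_restrict: "agree n x y \<longleftrightarrow> restrict_to x n = restrict_to y n"
  by (auto simp: agree_def restrict_to_def)

lemma agree_pad_restrict: "m \<le> n \<Longrightarrow> agree m x (pad (restrict_to x n))"
  by (simp add: agree_def pad_def restrict_to_def)

lemma decidable_derives:
  assumes "computable_on X (\<lambda>g m. H g (fst (prod_decode m)) (snd (prod_decode m)))"
    and "computable_on X T" "computable_on X E" "computable_on X N" "computable_on X Y"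
  shows "decidable_on X (\<lambda>g n. derives (H g n) (T g n) (E g n) (N g n) (Y g n))"
  unfolding derives_def entry_def
  by (intro computable_intros decidable_on_member assms
    decidable_on_subst[where Y = UNIV, OF decidable_derivation]) auto

lemma run_use:
  assumes "run c x n = Some y"
  shows "\<exists>m. \<forall>x'. agree m x x' \<longrightarrow> run c x' n = Some y"
proof -
  obtain e where "code_of e = c" using surj_code_of by (metis surjD)
  then show ?thesis using assms derives_iff_run derives_agree by metis
qed

section \<open>Halting extensions and computable generics\<close>

lemma computable_on_zero_oracle:
  assumes "computable_on {\<lambda>_. 0} (\<lambda>_. f)"
  shows "computable_on X (\<lambda>_. f)"
  using computable_on_subst[OF assms, of X "\<lambda>_ _ _. 0" "\<lambda>_ n. n"]
  by (simp add: computable_on_id computable_on_const)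

lemma learner_iff_computable:
  "learner \<psi> \<longleftrightarrow> computable_on UNIV (\<lambda>_ n. \<psi> (list_decode n))"
proof
  assume "learner \<psi>"
  then obtain c where c: "\<And>\<sigma>. run c (\<lambda>_. 0) (list_encode \<sigma>) = Some (\<psi> \<sigma>)"
    by (auto simp: learner_def)
  have "run c (\<lambda>_. 0) n = Some (\<psi> (list_decode n))" for n
    using c[of "list_decode n"] by simp
  then have "computable_on {\<lambda>_. 0} (\<lambda>_ n. \<psi> (list_decode n))"
    by (auto simp: computable_on_def)
  then show "computable_on UNIV (\<lambda>_ n. \<psi> (list_decode n))"
    by (rule computable_on_zero_oracle)
next
  assume "computable_on UNIV (\<lambda>_ n. \<psi> (list_decode n))"
  then obtain c where "\<And>g n. run c g n = Some (\<psi> (list_decode n))"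
    by (auto simp: computable_on_def)
  then have "\<forall>\<sigma>. run c (\<lambda>_. 0) (list_encode \<sigma>) = Some (\<psi> \<sigma>)" by simp
  then show "learner \<psi>" unfolding learner_def by blast
qed

lemma computable_on_learner:
  assumes "learner \<psi>" "computable_on X (\<lambda>g n. list_encode (L g n))"
  shows "computable_on X (\<lambda>g n. \<psi> (L g n))"
  using computable_on_comp[OF computable_on_subset[OF assms(1)[unfolded learner_iff_computable]] assms(2)]
  by simp

lemma semidecidable:
  assumes "decidable_on X (\<lambda>g m. P g (fst (prod_decode m)) (snd (prod_decode m)))"
  obtains c where "\<And>g n. g \<in> X \<Longrightarrow> run c g n \<noteq> None \<longleftrightarrow> (\<exists>k. P g n k)"
proof -
  have "computable_on X (\<lambda>g m. of_bool (\<not> P g (fst (prod_decode m)) (snd (prod_decode m))))"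
    using decidable_on_not[OF assms] by (simp add: decidable_on_def)
  then obtain c where "\<And>g n k. g \<in> X \<Longrightarrow> run c g (prod_encode (n, k)) = Some (of_bool (\<not> P g n k))"
    unfolding computable_on_def by (metis fst_conv prod_encode_inverse snd_conv)
  then have "g \<in> X \<Longrightarrow> run (Mu c) g n \<noteq> None \<longleftrightarrow> (\<exists>k. P g n k)" for g n by simp
  then show ?thesis using that by blast
qed

section \<open>Binary strings as forcing conditions\<close>

definition binary :: "nat list \<Rightarrow> bool" where
  "binary l \<longleftrightarrow> (\<forall>i<length l. pad l i < 2)"

lemma binary_restrict: "x \<in> cantor \<Longrightarrow> binary (restrict_to x n)"
  by (simp add: binary_def cantor_def restrict_to_def pad_def)

lemma pad_cantor: "binary l \<Longrightarrow> pad l \<in> cantor"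
  by (auto simp: binary_def cantor_def pad_def split: if_splits)

lemma length_restrict [simp]: "length (restrict_to x n) = n"
  by (simp add: restrict_to_def)

lemma take_restrict: "m \<le> n \<Longrightarrow> take m (restrict_to x n) = restrict_to x m"
  by (simp add: restrict_to_def take_map)

lemma decidable_binary:
  assumes "computable_on X (\<lambda>g n. list_encode (L g n))"
  shows "decidable_on X (\<lambda>g n. binary (L g n))"
  unfolding binary_def by (intro computable_intros assms computable_on_comp[OF assms])

text \<open>
  The witness \<open>p\<close> codes an extension of \<open>\<sigma>\<close> together with a derivation that queries the oracle
  only inside this extension.
\<close>

definition halting_extension :: "nat \<Rightarrow> nat \<Rightarrow> nat list \<Rightarrow> nat \<Rightarrow> bool" where
  "halting_extension e j \<sigma> p \<longleftrightarrow>
     binary (list_decode (fst (prod_decode p))) \<and>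
     length \<sigma> < length (list_decode (fst (prod_decode p))) \<and>
     take (length \<sigma>) (list_decode (fst (prod_decode p))) = \<sigma> \<and>
     snd (prod_decode p) \<le> length (list_decode (fst (prod_decode p))) \<and>
     (\<exists>y<snd (prod_decode p). derives (pad (list_decode (fst (prod_decode p)))) (snd (prod_decode p)) e j y)"

lemma decidable_halting_extension:
  assumes "computable_on X E" "computable_on X J" "computable_on X (\<lambda>g n. list_encode (L g n))"
    and "computable_on X P"
  shows "decidable_on X (\<lambda>g n. halting_extension (E g n) (J g n) (L g n) (P g n))"
proof -
  note c = assms assms[THEN computable_on_comp]
  show ?thesis
    unfolding halting_extension_def
    by (intro computable_intros decidable_binary decidable_derives c)
qed

lemma halting_extension_exists:
  assumes "x \<in> cantor" "run (code_of e) x j \<noteq> None"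
  shows "\<exists>p. halting_extension e j (restrict_to x n) p"
proof -
  obtain y t where t: "derives x t e j y" using assms(2) derives_iff_run by blast
  \<comment> \<open>Length \<open>t\<close> contains the use of the derivation, and
    \<open>Suc n\<close> makes the extension proper.\<close>
  define m where "m = max t (Suc n)"
  have "derives (pad (restrict_to x m)) t e j y"
    using derives_agree[OF t agree_pad_restrict] by (simp add: m_def)
  then have "halting_extension e j (restrict_to x n) (prod_encode (list_encode (restrict_to x m), t))"
    using derives_bounds[OF t]
    by (auto simp: halting_extension_def binary_restrict assms(1) take_restrict m_def)
  then show ?thesis ..
qed

lemma halting_extension_run:
  assumes "halting_extension e j \<sigma> p"
    and "restrict_to x (length (list_decode (fst (prod_decode p)))) = list_decode (fst (prod_decode p))"
  shows "run (code_of e) x j \<noteq> None"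
proof -
  let ?\<tau> = "list_decode (fst (prod_decode p))"
  obtain y where "derives (pad ?\<tau>) (snd (prod_decode p)) e j y" and t: "snd (prod_decode p) \<le> length ?\<tau>"
    using assms(1) by (auto simp: halting_extension_def)
  moreover have "agree (snd (prod_decode p)) (pad ?\<tau>) x"
    by (rule agree_mono[OF _ t]) (simp add: agree_iff_restrict restrict_pad assms(2))
  ultimately show ?thesis using derives_agree derives_run by blast
qed

text \<open>The strings grow strictly, so \<open>s (Suc n)\<close> has an entry at \<open>n\<close>
  and \<open>pad\<close> never falls back on its default.\<close>

lemma chain_limit:
  assumes "\<And>k. length (s k) < length (s (Suc k))" "\<And>k. take (length (s k)) (s (Suc k)) = s k"
  shows "restrict_to (\<lambda>n. pad (s (Suc n)) n) (length (s k)) = s k"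
proof -
  have len: "k \<le> length (s k)" for k
    by (induction k) (use assms(1) in \<open>auto intro: Suc_leI order_le_less_trans\<close>)
  have mono: "length (s k) \<le> length (s m) \<and> take (length (s k)) (s m) = s k" if "k \<le> m" for k m
    using that
  proof (induction m rule: dec_induct)
    case (step m)
    then show ?case
      using assms[of m] by (metis less_imp_le_nat min.absorb1 order_trans take_take)
  qed simp
  have "pad (s (Suc i)) i = s k ! i" if "i < length (s k)" for i
  proof -
    have i: "i < length (s (Suc i))" using len[of "Suc i"] by simp
    show ?thesis
    proof (cases "k \<le> Suc i")
      case True
      then show ?thesis using mono[OF True] that i by (metis nth_take pad_def)
    next
      case False
      then show ?thesis using mono[of "Suc i" k] that i by (metis nat_le_linear nth_take pad_def)
    qed
  qed
  then show ?thesis by (auto simp: restrict_to_def intro!: nth_equalityI)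
qed

lemma chain_limit_cantor:
  assumes "\<And>k. binary (s k)"
  shows "(\<lambda>n. pad (s (Suc n)) n) \<in> cantor"
  using pad_cantor[OF assms] by (auto simp: cantor_def)

text \<open>An effective Baire category argument. Density guarantees that the search for an
  extension making \<open>W\<close> halt at the next argument ends, and taking the least witness
  each time makes the chain of strings computable.\<close>

lemma computable_generic:
  assumes dense: "\<And>x n j. x \<in> cantor \<Longrightarrow> agree m x0 x \<Longrightarrow> m \<le> n \<Longrightarrow>
      \<exists>x'\<in>cantor. agree n x x' \<and> run W x' j \<noteq> None"
    and x0: "x0 \<in> cantor"
  shows "\<exists>x\<in>cantor. computable_on UNIV (\<lambda>_. x) \<and> agree m x0 x \<and> (\<forall>j. run W x j \<noteq> None)"
proof -
  obtain e where e: "code_of e = W" using surj_code_of by (metis surjD)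
  define good where "good = (\<lambda>\<sigma>. binary \<sigma> \<and> m \<le> length \<sigma> \<and> take m \<sigma> = restrict_to x0 m)"
  \<comment> \<open>Off the good strings nothing guarantees a witness. The implication then accepts
    0, which makes the search total as \<open>computable_on_Least\<close> demands.\<close>
  define nxt where "nxt = (\<lambda>j \<sigma>. LEAST p. good \<sigma> \<longrightarrow> halting_extension e j \<sigma> p)"
  define s where "s = rec_nat (restrict_to x0 m) (\<lambda>j \<sigma>. list_decode (fst (prod_decode (nxt j \<sigma>))))"
  have ex: "\<exists>p. good \<sigma> \<longrightarrow> halting_extension e j \<sigma> p" for j \<sigma>
  proof (cases "good \<sigma>")
    case True
    have "agree m x0 (pad \<sigma>)"
      unfolding agree_iff_restrict
      using True take_restrict[of m "length \<sigma>" "pad \<sigma>"] by (simp add: good_def restrict_pad)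
    then obtain x' where x': "x' \<in> cantor" "agree (length \<sigma>) (pad \<sigma>) x'" "run W x' j \<noteq> None"
      using dense[of "pad \<sigma>" "length \<sigma>" j] True by (auto simp: good_def pad_cantor)
    have "restrict_to x' (length \<sigma>) = \<sigma>"
      using x'(2) by (simp add: agree_iff_restrict restrict_pad)
    then show ?thesis
      using halting_extension_exists[of x' e j "length \<sigma>"] x' e by simp
  qed simp
  have "nxt j \<sigma> = (LEAST p. good \<sigma> \<longrightarrow> halting_extension e j \<sigma> p)" for j \<sigma> by (simp add: nxt_def)
  then have nxt: "halting_extension e j \<sigma> (nxt j \<sigma>)" if "good \<sigma>" for j \<sigma>
    using LeastI_ex[OF ex[of \<sigma> j]] that by simp
  have good: "good (s k)" for k
  proof (induction k)
    case 0
    then show ?case by (simp add: s_def good_def binary_restrict x0)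
  next
    case (Suc k)
    let ?\<tau> = "s (Suc k)"
    have \<tau>: "binary ?\<tau>" "length (s k) < length ?\<tau>" "take (length (s k)) ?\<tau> = s k"
      using nxt[OF Suc, of k] by (simp_all add: s_def halting_extension_def)
    have "take m ?\<tau> = take m (s k)"
      using Suc \<tau>(3) by (metis good_def min.absorb1 take_take)
    then show ?case using Suc \<tau>(1,2) by (simp add: good_def)
  qed
  have step: "halting_extension e k (s k) (nxt k (s k))" "s (Suc k) = list_decode (fst (prod_decode (nxt k (s k))))" for k
    using nxt[OF good] by (auto simp: s_def)
  then have len: "length (s k) < length (s (Suc k))" and take: "take (length (s k)) (s (Suc k)) = s k" for k
    by (simp_all add: halting_extension_def)
  define x where "x = (\<lambda>n. pad (s (Suc n)) n)"
  have lim: "restrict_to x (length (s k)) = s k" for k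
    unfolding x_def by (rule chain_limit[where s = s, OF len take])
  have "x \<in> cantor" unfolding x_def by (rule chain_limit_cantor[where s = s]) (use good in \<open>auto simp: good_def\<close>)
  moreover have "agree m x0 x"
    using lim[of 0] by (simp add: s_def agree_iff_restrict)
  moreover have "run W x j \<noteq> None" for j
    using halting_extension_run[OF step(1)[of j]] lim[of "Suc j"] step(2)[of j] e by metis
  moreover have "computable_on UNIV (\<lambda>_. x)"
  proof -
    have nxt_enc: "computable_on UNIV (\<lambda>g n. nxt (J g n) (list_decode (S g n)))"
      if "computable_on UNIV J" "computable_on UNIV S" for J S
      unfolding nxt_def good_def
      by (intro computable_on_Least ex[unfolded good_def] computable_intros decidable_halting_extension decidable_binary
          computable_on_comp[OF that(1)] computable_on_comp[OF that(2)])
    have "list_encode (s k) = rec_nat (list_encode (restrict_to x0 m))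
        (\<lambda>j t. fst (prod_decode (nxt j (list_decode t)))) k" for k
    proof (induction k)
      case (Suc k)
      have "list_encode (s (Suc k)) = fst (prod_decode (nxt k (list_decode (list_encode (s k)))))"
        by (simp add: s_def)
      then show ?case by (simp only: Suc.IH nat.rec)
    qed (simp add: s_def)
    then have "computable_on UNIV (\<lambda>_ k. list_encode (s k))"
      by (simp only:) (intro computable_intros nxt_enc)
    then have "computable_on UNIV (\<lambda>_ n. list_encode (s (Suc n)))"
      by (rule computable_on_comp) (intro computable_intros)
    then show ?thesis unfolding x_def by (intro computable_intros)
  qed
  ultimately show ?thesis by blast
qed

section \<open>A 1-generic point approximable in the limit\<close>

text \<open>Stage \<open>k\<close> makes program \<open>k\<close> halt on input 0 if some extension
  does. If \<open>B\<close> is an initial segment and contains a witness, it contains the least one,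
  so the choice does not depend on \<open>B\<close> and is never revised once found. The appended 0
  keeps the strings growing.\<close>

definition generic_step :: "(nat \<Rightarrow> bool) \<Rightarrow> nat \<Rightarrow> nat list \<Rightarrow> nat list" where
  "generic_step B k \<sigma> =
     (if \<exists>p. B p \<and> halting_extension k 0 \<sigma> p
      then list_decode (fst (prod_decode (LEAST p. halting_extension k 0 \<sigma> p))) else \<sigma> @ [0])"

text \<open>
  Stage \<open>s\<close> of the approximation only looks for extensions below \<open>s\<close>. Since it settles for every
  \<open>k\<close>, the generic point is a \<open>\<Pi>\<^sup>0\<^sub>2\<close> singleton.
\<close>

definition generic_approx :: "nat \<Rightarrow> nat \<Rightarrow> nat list" where
  "generic_approx s = rec_nat [] (generic_step (\<lambda>p. p < s))"

definition generic_string :: "nat \<Rightarrow> nat list" where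
  "generic_string = rec_nat [] (generic_step (\<lambda>_. True))"

definition generic :: "nat \<Rightarrow> nat" where
  "generic n = pad (generic_string (Suc n)) n"

lemma generic_step_extends:
  assumes "binary \<sigma>"
  shows "binary (generic_step B k \<sigma>) \<and> length \<sigma> < length (generic_step B k \<sigma>) \<and>
    take (length \<sigma>) (generic_step B k \<sigma>) = \<sigma>"
proof (cases "\<exists>p. B p \<and> halting_extension k 0 \<sigma> p")
  case True
  define q where "q = (LEAST p. halting_extension k 0 \<sigma> p)"
  have "halting_extension k 0 \<sigma> q" unfolding q_def using True by (auto intro: LeastI)
  moreover have "generic_step B k \<sigma> = list_decode (fst (prod_decode q))"
    using True by (simp add: generic_step_def q_def)
  ultimately show ?thesis by (simp add: halting_extension_def)
next
  case False
  then show ?thesis using assms unfolding generic_step_def if_not_P[OF False]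
    by (auto simp: binary_def pad_def nth_append less_Suc_eq)
qed

lemma generic_string_chain:
  "binary (generic_string k)" "length (generic_string k) < length (generic_string (Suc k))"
  "take (length (generic_string k)) (generic_string (Suc k)) = generic_string k"
proof -
  show bin: "binary (generic_string k)" for k
    by (induction k) (simp_all add: generic_string_def generic_step_extends, simp add: binary_def)
  show "length (generic_string k) < length (generic_string (Suc k))"
    "take (length (generic_string k)) (generic_string (Suc k)) = generic_string k"
    using generic_step_extends[OF bin[of k], of "\<lambda>_. True" k] by (simp_all add: generic_string_def)
qed

lemma le_length_generic_string: "k \<le> length (generic_string k)"
  by (induction k) (use generic_string_chain(2) in \<open>auto intro: Suc_leI order_le_less_trans\<close>)

lemma restrict_generic: "restrict_to generic (length (generic_string k)) = generic_string k"
  unfolding generic_def[abs_def]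
  by (rule chain_limit[where s = generic_string, OF generic_string_chain(2,3)])

lemma generic_cantor: "generic \<in> cantor"
  unfolding generic_def[abs_def] by (rule chain_limit_cantor[where s = generic_string]) (rule generic_string_chain)

text \<open>This is 1-genericity: a \<open>\<Sigma>\<^sup>0\<^sub>1\<close> event is represented by
  a program halting on input 0. Either stage \<open>e\<close> found an extension forcing the event,
  or no binary extension of the string of stage \<open>e\<close> allows it.\<close>

lemma generic_meets_or_avoids:
  "run c generic 0 \<noteq> None \<or> (\<exists>n. \<forall>x\<in>cantor. agree n generic x \<longrightarrow> run c x 0 = None)"
proof -
  obtain e where e: "code_of e = c" using surj_code_of by (metis surjD)
  show ?thesis
  proof (cases "\<exists>p. halting_extension e 0 (generic_string e) p")
    case True
    let ?p = "LEAST p. halting_extension e 0 (generic_string e) p"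
    have "halting_extension e 0 (generic_string e) ?p" using True by (auto intro: LeastI)
    moreover have "list_decode (fst (prod_decode ?p)) = generic_string (Suc e)"
      using True by (simp add: generic_string_def generic_step_def)
    ultimately have "run (code_of e) generic 0 \<noteq> None"
      using halting_extension_run restrict_generic by metis
    then show ?thesis by (simp add: e)
  next
    case False
    have "run c x 0 = None" if "x \<in> cantor" "agree (length (generic_string e)) generic x" for x
      using False halting_extension_exists[OF that(1), of e 0 "length (generic_string e)"] that(2)
      by (cases "run c x 0") (auto simp: e agree_iff_restrict restrict_generic)
    then show ?thesis by blast
  qed
qed

text \<open>Once the string of stage \<open>k\<close> has settled, the bounded search above it
  changes its answer at most once, from no to yes.\<close>

lemma generic_approx_limit: "\<exists>s0. \<forall>s\<ge>s0. generic_approx s k = generic_string k"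
proof (induction k)
  case 0
  show ?case by (simp add: generic_approx_def generic_string_def)
next
  case (Suc k)
  then obtain s0 where s0: "\<And>s. s \<ge> s0 \<Longrightarrow> generic_approx s k = generic_string k" by blast
  obtain s1 where s1: "\<And>s. s \<ge> s1 \<Longrightarrow>
      (\<exists>p. p < s \<and> halting_extension k 0 (generic_string k) p) \<longleftrightarrow>
      (\<exists>p. halting_extension k 0 (generic_string k) p)"
  proof (cases "\<exists>p. halting_extension k 0 (generic_string k) p")
    case True
    then obtain p where "halting_extension k 0 (generic_string k) p" by blast
    then have "\<And>s. s \<ge> Suc p \<Longrightarrow> (\<exists>p. p < s \<and> halting_extension k 0 (generic_string k) p)"
      using Suc_le_lessD by blast
    with True show ?thesis using that by blast
  qed (use that in blast)
  have "generic_approx s (Suc k) = generic_string (Suc k)" if "s \<ge> max s0 s1" for s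
  proof -
    have "generic_approx s (Suc k) = generic_step (\<lambda>p. p < s) k (generic_approx s k)"
      by (simp add: generic_approx_def)
    also have "\<dots> = generic_step (\<lambda>_. True) k (generic_string k)"
      using s0[of s] s1[of s] that by (simp add: generic_step_def)
    also have "\<dots> = generic_string (Suc k)" by (simp add: generic_string_def)
    finally show ?thesis .
  qed
  then show ?case by blast
qed

lemma computable_on_generic_approx:
  assumes "computable_on X S" "computable_on X K"
  shows "computable_on X (\<lambda>g n. list_encode (generic_approx (S g n) (K g n)))"
proof -
  \<comment> \<open>Guarding the search by the existence of a bounded witness makes it total,
    although its value matters only in the first branch.\<close>
  define f where "f s = (\<lambda>k t. if \<exists>p<s. halting_extension k 0 (list_decode t) p
      then fst (prod_decode (LEAST p. (\<exists>q<s. halting_extension k 0 (list_decode t) q) \<longrightarrow> halting_extension k 0 (list_decode t) p))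
      else list_encode (list_decode t @ [0]))" for s
  have "list_encode (generic_approx s k) = rec_nat 0 (f s) k" for s k
  proof (induction k)
    case (Suc k)
    have "list_encode (generic_approx s (Suc k)) = f s k (list_encode (generic_approx s k))"
      by (auto simp: generic_approx_def generic_step_def f_def)
    then show ?case by (simp only: Suc.IH nat.rec)
  qed (simp add: generic_approx_def)
  then have *: "(\<lambda>g n. list_encode (generic_approx (S g n) (K g n))) = (\<lambda>g n. rec_nat 0 (f (S g n)) (K g n))"
    by simp
  have ex: "\<exists>p. (\<exists>q<s. halting_extension k 0 \<sigma> q) \<longrightarrow> halting_extension k 0 \<sigma> p" for s k \<sigma>
    by blast
  show ?thesis
    unfolding * f_def
    by (intro computable_intros decidable_halting_extension computable_on_Least ex assms
        computable_on_comp[OF assms(1)])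
qed

text \<open>As the approximations converge, agreeing with them infinitely often is the same as
  agreeing eventually. Stated with infinitely often, the condition is
  \<open>\<Pi>\<^sup>0\<^sub>2\<close>.\<close>

lemma eq_generic_iff:
  "x = generic \<longleftrightarrow> (\<forall>k s0. \<exists>s\<ge>s0. restrict_to x (length (generic_approx s k)) = generic_approx s k)"
proof (intro iffI allI)
  fix k s0
  assume "x = generic"
  moreover obtain s1 where "\<And>s. s \<ge> s1 \<Longrightarrow> generic_approx s k = generic_string k"
    using generic_approx_limit by blast
  ultimately show "\<exists>s\<ge>s0. restrict_to x (length (generic_approx s k)) = generic_approx s k"
    using restrict_generic by (intro exI[of _ "max s0 s1"]) simp
next
  assume *: "\<forall>k s0. \<exists>s\<ge>s0. restrict_to x (length (generic_approx s k)) = generic_approx s k"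
  have "x k = generic k" for k
  proof -
    obtain s0 where "\<And>s. s \<ge> s0 \<Longrightarrow> generic_approx s (Suc k) = generic_string (Suc k)"
      using generic_approx_limit by blast
    then have "restrict_to x (length (generic_string (Suc k))) = generic_string (Suc k)"
      using * by metis
    then have "agree (length (generic_string (Suc k))) x generic"
      by (simp add: agree_iff_restrict restrict_generic)
    then show ?thesis
      using le_length_generic_string[of "Suc k"] by (simp add: agree_def)
  qed
  then show "x = generic" by blast
qed

section \<open>Computable points and diagonally non-computable functions\<close>

definition computable_point :: "(nat \<Rightarrow> nat) \<Rightarrow> bool" where
  "computable_point x \<longleftrightarrow> computable_on UNIV (\<lambda>_. x)"

lemma computable_pointD: "computable_point x \<Longrightarrow> computable_on X (\<lambda>_. x)"
  unfolding computable_point_def by (rule computable_on_subset) auto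

lemma computable_point_run:
  assumes "computable_point x" "\<And>n. run c x n = Some (y n)"
  shows "computable_point y"
proof -
  have "computable_on {x} (\<lambda>_. y)" using assms(2) by (auto simp: computable_on_def)
  from computable_on_subst[OF this, of UNIV "\<lambda>_ _. x" "\<lambda>_ n. n"]
  show ?thesis
    using computable_on_comp[OF computable_pointD[OF assms(1), of UNIV] computable_on_snd[OF computable_on_id]]
    by (simp add: computable_point_def computable_on_id)
qed

text \<open>Differing from a computable point is a \<open>\<Sigma>\<^sup>0\<^sub>1\<close> event.
  The point itself does not meet it, but flipping one bit beyond any prefix does, so it is not
  avoided either.\<close>

lemma generic_not_computable: "\<not> computable_point generic"
proof
  assume comp: "computable_point generic"
  have "decidable_on UNIV (\<lambda>x m. x (snd (prod_decode m)) \<noteq> generic (snd (prod_decode m)))"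
    by (intro computable_intros computable_on_comp[OF computable_pointD[OF comp]])
  then obtain c where c: "\<And>x n. run c x n \<noteq> None \<longleftrightarrow> (\<exists>k. x k \<noteq> generic k)"
    using semidecidable[where X = UNIV and P = "\<lambda>x n k. x k \<noteq> generic k"] by auto
  then obtain n where n: "\<forall>x\<in>cantor. agree n generic x \<longrightarrow> run c x 0 = None"
    using generic_meets_or_avoids[of c] by blast
  let ?x = "generic(n := 1 - generic n)"
  have "?x \<in> cantor" using generic_cantor by (auto simp: cantor_def)
  moreover have "agree n generic ?x" by (simp add: agree_def)
  moreover have "generic n < 2" using generic_cantor by (simp add: cantor_def)
  then have "1 - generic n \<noteq> generic n" by arith
  then have "?x n \<noteq> generic n" by simp
  ultimately show False using n c by metis
qed

definition dnc2 :: "(nat \<Rightarrow> nat) set" where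
  "dnc2 = {x \<in> cantor. \<forall>e. run (code_of e) (\<lambda>_. 0) e \<noteq> Some (x e)}"

lemma dnc_not_computable:
  assumes "\<And>e. run (code_of e) (\<lambda>_. 0) e \<noteq> Some (x e)"
  shows "\<not> computable_point x"
proof
  assume "computable_point x"
  then obtain c where c: "\<And>g n. run c g n = Some (x n)"
    by (auto simp: computable_point_def computable_on_def)
  obtain e where "code_of e = c" using surj_code_of by (metis surjD)
  then show False using c assms by metis
qed

lemma dnc2_nonempty: "dnc2 \<noteq> {}"
proof -
  have "(\<lambda>e. if run (code_of e) (\<lambda>_. 0) e = Some 0 then 1 else 0) \<in> dnc2"
    by (auto simp: dnc2_def cantor_def)
  then show ?thesis by blast
qed

text \<open>If \<open>c\<close> computed such an \<open>f\<close>, then \<open>generic\<close> would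
  avoid the event that an output of \<open>c\<close> hits the diagonal. Above the avoiding prefix
  every convergent output misses the diagonal, and choosing outputs by search would give a
  computable function that misses it everywhere.\<close>

lemma generic_computes_no_dnc:
  assumes f: "\<And>n. run c generic n = Some (f n)"
    and dnc: "\<And>e. run (code_of e) (\<lambda>_. 0) e \<noteq> Some (f e)"
  shows False
proof -
  obtain d where d: "code_of d = c" using surj_code_of by (metis surjD)
  define P where "P = (\<lambda>x q. \<exists>k<q. \<exists>t<q. \<exists>t'<q. \<exists>v<q. derives x t d k v \<and> derives (\<lambda>_. 0) t' k k v)"
  have "decidable_on UNIV (\<lambda>x m. P x (snd (prod_decode m)))"
    unfolding P_def by (intro computable_intros decidable_derives)
  then obtain c' where c': "\<And>x n. run c' x n \<noteq> None \<longleftrightarrow> (\<exists>q. P x q)"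
    using semidecidable[where X = UNIV and P = "\<lambda>x n q. P x q"] by auto
  have "\<not> P generic q" for q
    unfolding P_def by (auto dest!: derives_run simp: d f dnc)
  then obtain n where n: "\<And>x q. x \<in> cantor \<Longrightarrow> agree n generic x \<Longrightarrow> \<not> P x q"
    using generic_meets_or_avoids[of c'] c' by blast
  define W where "W = (\<lambda>k p. binary (list_decode (fst (prod_decode p))) \<and>
     n \<le> length (list_decode (fst (prod_decode p))) \<and>
     take n (list_decode (fst (prod_decode p))) = restrict_to generic n \<and>
     (\<exists>t\<le>length (list_decode (fst (prod_decode p))).
       derives (pad (list_decode (fst (prod_decode p)))) t d k (snd (prod_decode p))))"
  have ex: "\<exists>p. W k p" for k
  proof -
    obtain t where t: "derives generic t d k (f k)" using f d derives_iff_run by metis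
    have "derives (pad (restrict_to generic (max n t))) t d k (f k)"
      by (rule derives_agree[OF t agree_pad_restrict]) simp
    then have "W k (prod_encode (list_encode (restrict_to generic (max n t)), f k))"
      by (auto simp: W_def binary_restrict generic_cantor take_restrict intro!: exI[of _ t])
    then show ?thesis ..
  qed
  \<comment> \<open>The first output found above the avoiding prefix. Being computable,
    \<open>h\<close> hits the diagonal at some \<open>e\<close>, and the string that produced
    \<open>h e\<close> then exhibits the avoided event.\<close>
  define h where "h = (\<lambda>k. snd (prod_decode (LEAST p. W k p)))"
  have "computable_point h"
    unfolding h_def computable_point_def W_def
    by (intro computable_intros computable_on_Least ex[unfolded W_def] decidable_binary decidable_derives)
  then obtain e where e: "run (code_of e) (\<lambda>_. 0) e = Some (h e)"
    using dnc_not_computable by blast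
  then obtain t' where t': "derives (\<lambda>_. 0) t' e e (h e)" using derives_iff_run by blast
  define p where "p = (LEAST p. W e p)"
  have p: "W e p" unfolding p_def using ex by (rule LeastI_ex)
  have he: "h e = snd (prod_decode p)" by (simp add: h_def p_def)
  let ?\<tau> = "list_decode (fst (prod_decode p))"
  obtain t where t: "derives (pad ?\<tau>) t d e (h e)" and "pad ?\<tau> \<in> cantor" and
    "n \<le> length ?\<tau>" "take n ?\<tau> = restrict_to generic n"
    using p unfolding W_def he by (auto simp: pad_cantor)
  then have "agree n generic (pad ?\<tau>)"
    unfolding agree_iff_restrict by (metis restrict_pad take_restrict)
  moreover have "P (pad ?\<tau>) (Suc (e + t + t' + h e))"
    unfolding P_def using t t' by (intro exI[of _ e] exI[of _ t] exI[of _ t'] exI[of _ "h e"] conjI) auto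
  ultimately show False using n \<open>pad ?\<tau> \<in> cantor\<close> by blast
qed

section \<open>Normal forms and reducibility\<close>

lemma recursive_relationI:
  "decidable_on X (\<lambda>x n. R x (list_decode n)) \<Longrightarrow> recursive_relation k X R"
  unfolding recursive_relation_def decidable_on_def computable_on_def of_bool_def
  by (metis list_encode_inverse)

lemma Pi0_1I:
  assumes "decidable_on cantor R"
  shows "{x \<in> cantor. \<forall>n. R x n} \<in> Pi0 1 cantor"
proof -
  have "decidable_on cantor (\<lambda>x n. \<not> R x (pad (list_decode n) 0))"
    by (intro computable_intros decidable_on_comp[OF assms])
  then have "recursive_relation 1 cantor (\<lambda>x as. \<not> R x (pad as 0))"
    by (rule recursive_relationI)
  moreover have "{x \<in> cantor. \<exists>n. \<not> R x n} = {x \<in> cantor. ex_prefix 1 (\<lambda>as. \<not> R x (pad as 0))}"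
    by (simp add: pad_def)
  ultimately have "{x \<in> cantor. \<exists>n. \<not> R x n} \<in> Sigma0 1 cantor"
    unfolding Sigma0_def by blast
  moreover have "{x \<in> cantor. \<forall>n. R x n} = cantor - {x \<in> cantor. \<exists>n. \<not> R x n}" by auto
  ultimately show ?thesis unfolding Pi0_def by blast
qed

lemma Sigma0_2I:
  assumes "decidable_on X (\<lambda>x m. R x (fst (prod_decode m)) (snd (prod_decode m)))"
  shows "{x \<in> X. \<exists>m. \<forall>n. R x m n} \<in> Sigma0 2 X"
proof -
  have "decidable_on X (\<lambda>x n. R x (pad (list_decode n) 0) (pad (list_decode n) 1))"
    using decidable_on_comp[OF assms, of "\<lambda>_ n. prod_encode (pad (list_decode n) 0, pad (list_decode n) 1)"]
    by (simp add: computable_on_pair computable_on_pad computable_on_const computable_on_id)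
  then have "recursive_relation 2 X (\<lambda>x as. R x (pad as 0) (pad as 1))"
    by (rule recursive_relationI)
  moreover have "{x \<in> X. \<exists>m. \<forall>n. R x m n} = {x \<in> X. ex_prefix 2 (\<lambda>as. R x (pad as 0) (pad as 1))}"
    by (simp add: pad_def numeral_2_eq_2)
  ultimately show ?thesis
    unfolding Sigma0_def by blast
qed

lemma Pi0_2I:
  assumes "decidable_on X (\<lambda>x m. R x (fst (prod_decode m)) (snd (prod_decode m)))"
  shows "{x \<in> X. \<forall>m. \<exists>n. R x m n} \<in> Pi0 2 X"
proof -
  have "{x \<in> X. \<forall>m. \<exists>n. R x m n} = X - {x \<in> X. \<exists>m. \<forall>n. \<not> R x m n}" by auto
  then show ?thesis
    using Sigma0_2I[OF decidable_on_not[OF assms]] unfolding Pi0_def by blast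
qed

lemma Sigma0_3I:
  assumes "decidable_on X (\<lambda>x m. R x (fst (prod_decode m)) (fst (prod_decode (snd (prod_decode m))))
    (snd (prod_decode (snd (prod_decode m)))))"
  shows "{x \<in> X. \<exists>m. \<forall>k. \<exists>s. R x m k s} \<in> Sigma0 3 X"
proof -
  have "decidable_on X (\<lambda>x n. R x (pad (list_decode n) 0) (pad (list_decode n) 1) (pad (list_decode n) 2))"
    using decidable_on_comp[OF assms, of "\<lambda>_ n. prod_encode (pad (list_decode n) 0,
        prod_encode (pad (list_decode n) 1, pad (list_decode n) 2))"]
    by (simp add: computable_on_pair computable_on_pad computable_on_const computable_on_id)
  then have "recursive_relation 3 X (\<lambda>x as. R x (pad as 0) (pad as 1) (pad as 2))"
    by (rule recursive_relationI)
  moreover have "{x \<in> X. \<exists>m. \<forall>k. \<exists>s. R x m k s} =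
      {x \<in> X. ex_prefix 3 (\<lambda>as. R x (pad as 0) (pad as 1) (pad as 2))}"
    by (simp add: pad_def numeral_3_eq_3 numeral_2_eq_2)
  ultimately show ?thesis
    unfolding Sigma0_def by blast
qed

text \<open>Since \<open>t\<close> bounds the use and is at most the length of \<open>l\<close>, the
  derivation never consults the zeros added by \<open>pad\<close>. What is seen therefore stays seen
  in longer strings.\<close>

definition sees :: "nat list \<Rightarrow> nat \<Rightarrow> nat \<Rightarrow> nat \<Rightarrow> bool" where
  "sees l e n y \<longleftrightarrow> (\<exists>t\<le>length l. derives (pad l) t e n y)"

lemma decidable_sees:
  assumes "computable_on X (\<lambda>g n. list_encode (L g n))" "computable_on X E" "computable_on X N" "computable_on X Y"
  shows "decidable_on X (\<lambda>g n. sees (L g n) (E g n) (N g n) (Y g n))"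
  unfolding sees_def
  by (intro computable_intros decidable_derives assms assms[THEN computable_on_comp])

lemma sees_take: "sees (take k l) e n y \<Longrightarrow> sees l e n y"
  unfolding sees_def
proof (elim exE conjE)
  fix t assume t: "t \<le> length (take k l)" "derives (pad (take k l)) t e n y"
  have "agree t (pad (take k l)) (pad l)" using t(1) by (auto simp: agree_def pad_def)
  then show "\<exists>t\<le>length l. derives (pad l) t e n y" using derives_agree[OF t(2)] t(1) by auto
qed

lemma sees_restrict_mono: "sees (restrict_to x k) e n y \<Longrightarrow> k \<le> m \<Longrightarrow> sees (restrict_to x m) e n y"
  by (rule sees_take[of k]) (simp add: take_restrict)

lemma sees_iff_run: "(\<exists>k. sees (restrict_to x k) e n y) \<longleftrightarrow> run (code_of e) x n = Some y"
proof
  assume "run (code_of e) x n = Some y"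
  then obtain t where "derives x t e n y" using derives_iff_run by blast
  then have "derives (pad (restrict_to x t)) t e n y" by (rule derives_agree) (rule agree_pad_restrict, simp)
  then show "\<exists>k. sees (restrict_to x k) e n y" by (auto simp: sees_def intro!: exI[of _ t])
next
  assume "\<exists>k. sees (restrict_to x k) e n y"
  then obtain k t where "t \<le> k" "derives (pad (restrict_to x k)) t e n y" by (auto simp: sees_def)
  then have "derives x t e n y" using derives_agree agree_sym[OF agree_pad_restrict] by blast
  then show "run (code_of e) x n = Some y" by (rule derives_run)
qed

text \<open>Bounding the extra parameter by the length as well turns an unbounded existential
  statement into the growth of decidable ones.\<close>

lemma sees_family_iff_run:
  "(\<exists>k. \<exists>b\<le>k. sees (restrict_to x k) e (f b) y) \<longleftrightarrow> (\<exists>b. run (code_of e) x (f b) = Some y)"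
proof
  assume "\<exists>b. run (code_of e) x (f b) = Some y"
  then obtain b k where "sees (restrict_to x k) e (f b) y" using sees_iff_run by blast
  then have "sees (restrict_to x (max b k)) e (f b) y" by (rule sees_restrict_mono) simp
  then show "\<exists>k. \<exists>b\<le>k. sees (restrict_to x k) e (f b) y" by (intro exI[of _ "max b k"] exI[of _ b]) simp
qed (use sees_iff_run in blast)

text \<open>A string stays in the tree until it sees a computation refuting membership. Seen
  computations persist, so the tree is closed under prefixes.\<close>

lemma Pi0_1E:
  assumes "Q \<in> Pi0 1 cantor"
  obtains q where "decidable_on UNIV (\<lambda>_ n. q (list_decode n))" "\<And>l k. q l \<Longrightarrow> q (take k l)"
    "Q = {x \<in> cantor. \<forall>n. q (restrict_to x n)}"
proof -
  obtain c R where c: "\<And>x as. x \<in> cantor \<Longrightarrow> length as = 1 \<Longrightarrow> run c x (list_encode as) = Some (if R x as then 1 else 0)"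
    and Q: "Q = {x \<in> cantor. \<forall>a. \<not> R x [a]}"
  proof -
    obtain R where R: "recursive_relation 1 cantor R" "Q = cantor - {x \<in> cantor. ex_prefix 1 (R x)}"
      using assms unfolding Pi0_def Sigma0_def by blast
    then have "Q = {x \<in> cantor. \<forall>a. \<not> R x [a]}" by auto
    then show ?thesis using that R(1) unfolding recursive_relation_def by blast
  qed
  obtain e where e: "code_of e = c" using surj_code_of by (metis surjD)
  define q where "q = (\<lambda>l. \<not> (\<exists>a\<le>length l. sees l e (list_encode [a]) 1))"
  have R: "R x [a] \<longleftrightarrow> run (code_of e) x (list_encode [a]) = Some 1" if "x \<in> cantor" for x a
    using c[OF that, of "[a]"] e by auto
  have "decidable_on UNIV (\<lambda>_ n. q (list_decode n))"
    unfolding q_def by (intro computable_intros decidable_sees)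
  moreover have "q l \<Longrightarrow> q (take k l)" for l k
    unfolding q_def by (auto dest: sees_take)
  moreover have "(\<forall>a. \<not> R x [a]) \<longleftrightarrow> (\<forall>n. q (restrict_to x n))" if "x \<in> cantor" for x
    using sees_family_iff_run[of x e "\<lambda>a. list_encode [a]" 1] R[OF that] unfolding q_def length_restrict by metis
  then have "Q = {x \<in> cantor. \<forall>n. q (restrict_to x n)}" unfolding Q by blast
  ultimately show ?thesis using that by blast
qed

lemma Sigma0_2E:
  assumes "S \<in> Sigma0 2 cantor"
  obtains A where "decidable_on UNIV (\<lambda>_ n. A (fst (prod_decode n)) (list_decode (snd (prod_decode n))))"
    "\<And>m l k. A m l \<Longrightarrow> A m (take k l)" "S = {x \<in> cantor. \<exists>m. \<forall>n. A m (restrict_to x n)}"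
proof -
  obtain c R where c: "\<And>x as. x \<in> cantor \<Longrightarrow> length as = 2 \<Longrightarrow> run c x (list_encode as) = Some (if R x as then 1 else 0)"
    and S: "S = {x \<in> cantor. \<exists>m. \<forall>a. R x [m, a]}"
  proof -
    obtain R where R: "recursive_relation 2 cantor R" "S = {x \<in> cantor. ex_prefix 2 (R x)}"
      using assms unfolding Sigma0_def by blast
    then have "S = {x \<in> cantor. \<exists>m. \<forall>a. R x [m, a]}" by (simp add: numeral_2_eq_2)
    then show ?thesis using that R(1) unfolding recursive_relation_def by blast
  qed
  obtain e where e: "code_of e = c" using surj_code_of by (metis surjD)
  define A where "A = (\<lambda>m l. \<not> (\<exists>a\<le>length l. sees l e (list_encode [m, a]) 0))"
  have R: "\<not> R x [m, a] \<longleftrightarrow> run (code_of e) x (list_encode [m, a]) = Some 0" if "x \<in> cantor" for x m a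
    using c[OF that, of "[m, a]"] e by auto
  have "decidable_on UNIV (\<lambda>_ n. A (fst (prod_decode n)) (list_decode (snd (prod_decode n))))"
    unfolding A_def by (intro computable_intros decidable_sees)
  moreover have "A m l \<Longrightarrow> A m (take k l)" for m l k
    unfolding A_def by (auto dest: sees_take)
  moreover have "(\<forall>a. R x [m, a]) \<longleftrightarrow> (\<forall>n. A m (restrict_to x n))" if "x \<in> cantor" for x m
    using sees_family_iff_run[of x e "\<lambda>a. list_encode [m, a]" 0] R[OF that] unfolding A_def length_restrict by metis
  then have "S = {x \<in> cantor. \<exists>m. \<forall>n. A m (restrict_to x n)}" unfolding S by blast
  ultimately show ?thesis using that by blast
qed

lemma Pi0_2E:
  assumes "S \<in> Pi0 2 baire"
  obtains A where "decidable_on UNIV (\<lambda>_ n. A (fst (prod_decode n)) (list_decode (snd (prod_decode n))))"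
    "S = {x. \<forall>m. \<exists>n. A m (restrict_to x n)}"
proof -
  obtain c R where c: "\<And>x as. length as = 2 \<Longrightarrow> run c x (list_encode as) = Some (if R x as then 1 else 0)"
    and S: "S = {x. \<forall>m. \<exists>a. \<not> R x [m, a]}"
  proof -
    obtain R where R: "recursive_relation 2 baire R" "S = baire - {x \<in> baire. ex_prefix 2 (R x)}"
      using assms unfolding Pi0_def Sigma0_def by blast
    then have "S = {x. \<forall>m. \<exists>a. \<not> R x [m, a]}" by (auto simp: numeral_2_eq_2)
    then show ?thesis using that R(1) unfolding recursive_relation_def by blast
  qed
  obtain e where e: "code_of e = c" using surj_code_of by (metis surjD)
  define A where "A = (\<lambda>m l. \<exists>a\<le>length l. sees l e (list_encode [m, a]) 0)"
  have R: "\<not> R x [m, a] \<longleftrightarrow> run (code_of e) x (list_encode [m, a]) = Some 0" for x m a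
    using c[of "[m, a]"] e by auto
  have "decidable_on UNIV (\<lambda>_ n. A (fst (prod_decode n)) (list_decode (snd (prod_decode n))))"
    unfolding A_def by (intro computable_intros decidable_sees)
  moreover have "(\<exists>a. \<not> R x [m, a]) \<longleftrightarrow> (\<exists>n. A m (restrict_to x n))" for x m
    using sees_family_iff_run[of x e "\<lambda>a. list_encode [m, a]" 0] R unfolding A_def length_restrict by metis
  then have "S = {x. \<forall>m. \<exists>n. A m (restrict_to x n)}" unfolding S by blast
  ultimately show ?thesis using that by blast
qed

section \<open>Reducibility in terms of programs and learners\<close>

lemma Phi_eq_Some_iff: "Phi e g = Some y \<longleftrightarrow> (\<forall>n. run (code_of e) g n = Some (y n))"
proof -
  have if_iff: "(if P then Some f else None) = Some y \<longleftrightarrow> P \<and> f = y" for P and f :: "nat \<Rightarrow> nat"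
    by simp
  have "(\<forall>n. run (code_of e) g n \<noteq> None) \<and> (\<lambda>n. the (run (code_of e) g n)) = y \<longleftrightarrow>
      (\<forall>n. run (code_of e) g n = Some (y n))" (is "?L \<longleftrightarrow> ?R")
  proof
    assume ?L
    then show ?R by (metis option.collapse)
  next
    assume ?R
    then show ?L by (simp add: fun_eq_iff)
  qed
  then show ?thesis unfolding Phi_def if_iff .
qed

definition limit_succeeds :: "(nat list \<Rightarrow> nat) \<Rightarrow> (nat \<Rightarrow> nat) set \<Rightarrow> (nat \<Rightarrow> nat) \<Rightarrow> bool" where
  "limit_succeeds \<psi> A g \<longleftrightarrow>
     (\<exists>c y. (\<forall>\<^sub>F n in sequentially. \<psi> (restrict_to g n) = c) \<and> Phi c g = Some y \<and> y \<in> A)"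

text \<open>All three notions constrain \<Gamma> one point at a time, once a uniform datum
  \<open>w\<close> (a bound or a learner) is fixed. So \<Gamma> can be assembled from a value chosen
  at each point, which removes it from later arguments.\<close>

lemma reducible_cases:
  assumes C: "\<And>\<Gamma>. C \<Gamma> \<longleftrightarrow> (\<exists>w. \<forall>g\<in>dom \<Gamma>. D w g (\<Gamma> g))"
  shows "reducible C A B \<longleftrightarrow> (\<exists>w. \<forall>g\<in>B. \<exists>y\<in>A. D w g (Some y))"
proof
  assume "reducible C A B"
  then obtain \<Gamma> w where w: "\<forall>g\<in>dom \<Gamma>. D w g (\<Gamma> g)" and B: "B \<subseteq> dom \<Gamma>" "\<forall>g\<in>B. the (\<Gamma> g) \<in> A"
    unfolding reducible_def C by blast
  have "\<exists>y\<in>A. D w g (Some y)" if "g \<in> B" for g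
  proof -
    have "g \<in> dom \<Gamma>" using B that by blast
    then obtain y where "\<Gamma> g = Some y" by blast
    then show ?thesis using w B that by force
  qed
  then show "\<exists>w. \<forall>g\<in>B. \<exists>y\<in>A. D w g (Some y)" by blast
next
  assume "\<exists>w. \<forall>g\<in>B. \<exists>y\<in>A. D w g (Some y)"
  then obtain w f where "\<forall>g\<in>B. f g \<in> A \<and> D w g (Some (f g))" by metis
  then have "\<forall>g\<in>dom (\<lambda>g. if g \<in> B then Some (f g) else None). D w g (if g \<in> B then Some (f g) else None)"
    and "B \<subseteq> dom (\<lambda>g. if g \<in> B then Some (f g) else None)"
    and "\<forall>g\<in>B. the (if g \<in> B then Some (f g) else None) \<in> A"
    by (auto split: if_splits)
  then show "reducible C A B" unfolding reducible_def C by blast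
qed

lemma reducible_fin_1_iff:
  "reducible computable_fin_1 A B \<longleftrightarrow> (\<exists>b. \<forall>g\<in>B. \<exists>e<b. \<exists>y. Phi e g = Some y \<and> y \<in> A)"
proof -
  have D: "computable_fin_1 \<Gamma> \<longleftrightarrow> (\<exists>b. \<forall>g\<in>dom \<Gamma>. \<exists>e<b. \<Gamma> g = Phi e g)" for \<Gamma>
    by (rule computable_fin_1_def)
  have "(\<exists>y\<in>A. \<exists>e<b. Some y = Phi e g) \<longleftrightarrow> (\<exists>e<b. \<exists>y. Phi e g = Some y \<and> y \<in> A)" for b g
    by (auto simp: eq_commute[of "Some _"])
  then show ?thesis unfolding reducible_cases[where C = computable_fin_1, OF D] by simp
qed

lemma reducible_1_omega_iff:
  "reducible computable_1_omega A B \<longleftrightarrow> (\<exists>\<psi>. learner \<psi> \<and> (\<forall>g\<in>B. limit_succeeds \<psi> A g))"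
proof -
  have 0: "learner (\<lambda>_. 0)"
    unfolding learner_iff_computable by (intro computable_intros)
  \<comment> \<open>Moving \<open>learner\<close> under the quantifier over the domain loses it when
    the domain is empty; there the constant learner steps in.\<close>
  have D: "computable_1_omega \<Gamma> \<longleftrightarrow> (\<exists>\<psi>. \<forall>g\<in>dom \<Gamma>. learner \<psi> \<and> identified_by \<psi> (\<lambda>_. \<Gamma> g) g)" for \<Gamma>
    unfolding computable_1_omega_def identified_by_def using 0 by blast
  have eq: "(\<exists>y\<in>A. learner \<psi> \<and> identified_by \<psi> (\<lambda>_. Some y) g) \<longleftrightarrow> learner \<psi> \<and> limit_succeeds \<psi> A g" for \<psi> g
    unfolding identified_by_def limit_succeeds_def by blast
  show ?thesis unfolding reducible_cases[where C = computable_1_omega, OF D] eq using 0 by blast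
qed

lemma reducible_fin_omega_iff:
  "reducible computable_fin_omega A B \<longleftrightarrow> (\<exists>b. \<forall>g\<in>B. \<exists>e<b. limit_succeeds (Psi e) A g)"
proof -
  have D: "computable_fin_omega \<Gamma> \<longleftrightarrow> (\<exists>b. \<forall>g\<in>dom \<Gamma>. \<exists>e<b. identified_by (Psi e) (\<lambda>_. \<Gamma> g) g)" for \<Gamma>
    unfolding computable_fin_omega_def identified_by_def by blast
  have "(\<exists>y\<in>A. \<exists>e<b. identified_by (Psi e) (\<lambda>_. Some y) g) \<longleftrightarrow> (\<exists>e<b. limit_succeeds (Psi e) A g)" for b g
    unfolding identified_by_def limit_succeeds_def by blast
  then show ?thesis unfolding reducible_cases[where C = computable_fin_omega, OF D] by simp
qed

section \<open>Sets without an equivalent closed set\<close>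

text \<open>In forcing terms: the first \<open>n\<close> values of \<open>x\<close> force that the
  guesses have no limit.\<close>

definition mind_changing :: "(nat list \<Rightarrow> nat) \<Rightarrow> (nat \<Rightarrow> nat) \<Rightarrow> nat \<Rightarrow> bool" where
  "mind_changing \<psi> x n \<longleftrightarrow> (\<forall>x'\<in>cantor. \<forall>n'\<ge>n. agree n x x' \<longrightarrow>
     (\<exists>x''\<in>cantor. \<exists>n''\<ge>n'. agree n' x' x'' \<and> \<psi> (restrict_to x'' n'') \<noteq> \<psi> (restrict_to x' n')))"

definition failing :: "(nat list \<Rightarrow> nat) \<Rightarrow> (nat \<Rightarrow> nat) set \<Rightarrow> (nat \<Rightarrow> nat) \<Rightarrow> nat \<Rightarrow> bool" where
  "failing \<psi> P x n \<longleftrightarrow> (\<forall>x'\<in>cantor. agree n x x' \<longrightarrow> \<not> limit_succeeds \<psi> P x')"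

text \<open>In forcing terms: the first \<open>n\<close> values of \<open>x\<close> force program
  \<open>c\<close> to be total with result in \<open>P\<close>. Convergence is only dense, so single
  points may diverge, while every total result above the condition lies in \<open>P\<close>.\<close>

definition forced_into :: "nat \<Rightarrow> (nat \<Rightarrow> nat) set \<Rightarrow> (nat \<Rightarrow> nat) \<Rightarrow> nat \<Rightarrow> bool" where
  "forced_into c P x n \<longleftrightarrow>
     (\<forall>x'\<in>cantor. agree n x x' \<longrightarrow> (\<forall>y. Phi c x' = Some y \<longrightarrow> y \<in> P)) \<and>
     (\<forall>k. \<forall>x'\<in>cantor. \<forall>n'\<ge>n. agree n x x' \<longrightarrow>
        (\<exists>x''\<in>cantor. agree n' x' x'' \<and> run (code_of c) x'' k \<noteq> None))"

definition decided :: "(nat list \<Rightarrow> nat) \<Rightarrow> (nat \<Rightarrow> nat) set \<Rightarrow> (nat \<Rightarrow> nat) \<Rightarrow> nat \<Rightarrow> bool" where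
  "decided \<psi> P x n \<longleftrightarrow> mind_changing \<psi> x n \<or> failing \<psi> P x n \<or> (\<exists>c. forced_into c P x n)"

definition closed_points :: "(nat \<Rightarrow> nat) set \<Rightarrow> bool" where
  "closed_points P \<longleftrightarrow> (\<forall>y. y \<notin> P \<longrightarrow> (\<exists>m. \<forall>y'. agree m y y' \<longrightarrow> y' \<notin> P))"

lemma closed_Pi0_1: "P \<in> Pi0 1 cantor \<Longrightarrow> closed_points P"
proof (unfold closed_points_def, intro allI impI)
  fix y assume "P \<in> Pi0 1 cantor" "y \<notin> P"
  obtain q where P: "P = {x \<in> cantor. \<forall>n. q (restrict_to x n)}"
    by (rule Pi0_1E[OF \<open>P \<in> Pi0 1 cantor\<close>]) blast
  show "\<exists>m. \<forall>y'. agree m y y' \<longrightarrow> y' \<notin> P"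
  proof (cases "y \<in> cantor")
    case True
    then obtain n where "\<not> q (restrict_to y n)" using \<open>y \<notin> P\<close> P by blast
    then show ?thesis unfolding P agree_iff_restrict by (intro exI[of _ n]) auto
  next
    case False
    then obtain i where "\<not> y i < 2" unfolding cantor_def by blast
    then show ?thesis unfolding P by (intro exI[of _ "Suc i"]) (auto simp: agree_def cantor_def)
  qed
qed

lemma run_use_upto:
  assumes "\<And>n. n < m \<Longrightarrow> run c x n = Some (y n)"
  shows "\<exists>k. \<forall>x'. agree k x x' \<longrightarrow> (\<forall>n<m. run c x' n = Some (y n))"
  using assms
proof (induction m)
  case (Suc m)
  then obtain k where k: "\<forall>x'. agree k x x' \<longrightarrow> (\<forall>n<m. run c x' n = Some (y n))"
    by (meson less_SucI)
  obtain l where l: "\<forall>x'. agree l x x' \<longrightarrow> run c x' m = Some (y m)"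
    using run_use[OF Suc.prems[of m]] by blast
  have "\<forall>n<Suc m. run c x' n = Some (y n)" if "agree (max k l) x x'" for x'
    using k l agree_mono[OF that, of k] agree_mono[OF that, of l] by (auto simp: less_Suc_eq)
  then show ?case by blast
qed simp

lemma decided_mono:
  assumes "decided \<psi> P x n" "agree n x x'" "n \<le> n'"
  shows "decided \<psi> P x' n'"
proof -
  have "agree n x x''" if "agree n' x' x''" for x''
    using agree_trans[OF assms(2) agree_mono[OF that assms(3)]] .
  moreover have "n \<le> m" if "n' \<le> m" for m using assms(3) that by simp
  ultimately have "mind_changing \<psi> x n \<Longrightarrow> mind_changing \<psi> x' n'" "failing \<psi> P x n \<Longrightarrow> failing \<psi> P x' n'"
      "forced_into c P x n \<Longrightarrow> forced_into c P x' n'" for c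
    unfolding mind_changing_def failing_def forced_into_def by blast+
  then show ?thesis using assms(1) unfolding decided_def by blast
qed

text \<open>If mind changes are not dense, the guess is a constant \<open>c\<close> above some
  string. Unless that string forces \<open>c\<close> into \<open>P\<close>, program \<open>c\<close>
  either leaves \<open>P\<close> at some point, which shows on finitely many values because
  \<open>P\<close> is closed, or diverges at some \<open>k\<close> above a longer string. Both make
  the learner fail above a string.\<close>

lemma decided_dense:
  assumes "closed_points P" "x \<in> cantor"
  shows "\<exists>x'\<in>cantor. \<exists>n'\<ge>n. agree n x x' \<and> decided \<psi> P x' n'"
proof (cases "mind_changing \<psi> x n")
  case True
  then show ?thesis using assms by (intro bexI[of _ x] exI[of _ n]) (auto simp: decided_def)
next
  case False
  then obtain x1 n1 where x1: "x1 \<in> cantor" "n1 \<ge> n" "agree n x x1"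
    and const: "\<And>x' n'. x' \<in> cantor \<Longrightarrow> n' \<ge> n1 \<Longrightarrow> agree n1 x1 x' \<Longrightarrow> \<psi> (restrict_to x' n') = \<psi> (restrict_to x1 n1)"
    unfolding mind_changing_def by blast
  define c where "c = \<psi> (restrict_to x1 n1)"
  have lim: "c' = c" 
    if x': "x' \<in> cantor" "agree n1 x1 x'" and c': "\<forall>\<^sub>F n in sequentially. \<psi> (restrict_to x' n) = c'" for x' c'
  proof -
    obtain N where "\<And>n. n \<ge> N \<Longrightarrow> \<psi> (restrict_to x' n) = c'"
      using c' by (auto simp: eventually_sequentially)
    then show ?thesis using const[OF x'(1) _ x'(2), of "max N n1"] c_def by (metis max.cobounded1 max.cobounded2)
  qed
  have fail: "\<exists>x'\<in>cantor. \<exists>n'\<ge>n. agree n x x' \<and> decided \<psi> P x' n'"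
    if x2: "x2 \<in> cantor" "n2 \<ge> n1" "agree n1 x1 x2"
      and no: "\<And>x' y. x' \<in> cantor \<Longrightarrow> agree n2 x2 x' \<Longrightarrow> Phi c x' = Some y \<Longrightarrow> y \<notin> P" for x2 n2
  proof -
    have "failing \<psi> P x2 n2"
      unfolding failing_def limit_succeeds_def
      using lim no x2 agree_trans agree_mono by blast
    moreover have "agree n x x2" using x1 x2 agree_trans agree_mono by blast
    ultimately show ?thesis using x1 x2 unfolding decided_def by (meson order_trans)
  qed
  show ?thesis
  proof (cases "forced_into c P x1 n1")
    case True
    then show ?thesis using x1 unfolding decided_def by blast
  next
    case False
    then consider x2 y where "x2 \<in> cantor" "agree n1 x1 x2" "Phi c x2 = Some y" "y \<notin> P"
      | x2 n2 k where "x2 \<in> cantor" "n2 \<ge> n1" "agree n1 x1 x2"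
        "\<And>x''. x'' \<in> cantor \<Longrightarrow> agree n2 x2 x'' \<Longrightarrow> run (code_of c) x'' k = None"
      unfolding forced_into_def by blast
    then show ?thesis
    proof cases
      case 1
      then obtain m where m: "\<And>y'. agree m y y' \<Longrightarrow> y' \<notin> P"
        using assms(1) unfolding closed_points_def by blast
      obtain k where k: "\<And>x' n. agree k x2 x' \<Longrightarrow> n < m \<Longrightarrow> run (code_of c) x' n = Some (y n)"
        using run_use_upto[of m "code_of c" x2 y] 1(3) by (auto simp: Phi_eq_Some_iff)
      have "y' \<notin> P" if "agree (max k n1) x2 x'" "Phi c x' = Some y'" for x' y'
      proof (rule m)
        show "agree m y y'"
          unfolding agree_def using k[OF agree_mono[OF that(1)]] that(2) by (simp add: Phi_eq_Some_iff)
      qed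
      then show ?thesis using fail[of x2 "max k n1"] 1 by auto
    next
      case 2
      show ?thesis
      proof (rule fail[OF 2(1-3)])
        fix x' y assume "x' \<in> cantor" "agree n2 x2 x'" "Phi c x' = Some y"
        then show "y \<notin> P" using 2(4)[of x'] by (simp add: Phi_eq_Some_iff)
      qed
    qed
  qed
qed

lemma decided_dense_finite:
  fixes \<psi> :: "nat \<Rightarrow> nat list \<Rightarrow> nat"
  assumes "closed_points P" "x \<in> cantor"
  shows "\<exists>x'\<in>cantor. \<exists>n'\<ge>n. agree n x x' \<and> (\<forall>e<b. decided (\<psi> e) P x' n')"
proof (induction b)
  case (Suc b)
  then obtain x1 n1 where 1: "x1 \<in> cantor" "n1 \<ge> n" "agree n x x1" "\<forall>e<b. decided (\<psi> e) P x1 n1" by blast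
  obtain x2 n2 where 2: "x2 \<in> cantor" "n2 \<ge> n1" "agree n1 x1 x2" "decided (\<psi> b) P x2 n2"
    using decided_dense[OF assms(1) 1(1)] by blast
  have "\<forall>e<Suc b. decided (\<psi> e) P x2 n2"
    using 1(4) 2 decided_mono by (auto simp: less_Suc_eq)
  moreover have "agree n x x2" "n \<le> n2" using 1 2 agree_trans agree_mono order_trans by blast+
  ultimately show ?case using 2(1) by blast
qed (use assms(2) in \<open>auto intro!: bexI[of _ x]\<close>)

lemma cantor_baire:
  fixes D :: "nat \<Rightarrow> (nat \<Rightarrow> nat) set"
  assumes dense: "\<And>k x n. x \<in> cantor \<Longrightarrow> n0 \<le> n \<Longrightarrow> agree n0 x0 x \<Longrightarrow>
      \<exists>x'\<in>cantor. \<exists>n'\<ge>n. agree n x x' \<and> (\<forall>x''\<in>cantor. agree n' x' x'' \<longrightarrow> x'' \<in> D k)"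
    and x0: "x0 \<in> cantor"
  shows "\<exists>x\<in>cantor. agree n0 x0 x \<and> (\<forall>k. x \<in> D k)"
proof -
  define Q where "Q = (\<lambda>k p p'. snd p < snd p' \<and> agree (snd p) (fst p) (fst p') \<and>
      (\<forall>x''\<in>cantor. agree (snd p') (fst p') x'' \<longrightarrow> x'' \<in> D k))"
  define ok where "ok = (\<lambda>p. fst p \<in> cantor \<and> n0 \<le> snd p \<and> agree n0 x0 (fst p))"
  have "\<exists>f. \<forall>k. (ok (f k) \<and> (k = 0 \<longrightarrow> f k = (x0, n0))) \<and> Q k (f k) (f (Suc k))"
  proof (rule dependent_nat_choice[where P = "\<lambda>k p. ok p \<and> (k = 0 \<longrightarrow> p = (x0, n0))"])
    show "\<exists>p. ok p \<and> (0 = (0::nat) \<longrightarrow> p = (x0, n0))" using x0 by (simp add: ok_def)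
  next
    fix p and k :: nat
    assume p: "ok p \<and> (k = 0 \<longrightarrow> p = (x0, n0))"
    obtain x n where xn: "p = (x, n)" by fastforce
    with p have x: "x \<in> cantor" "n0 \<le> n" "agree n0 x0 x" by (simp_all add: ok_def)
    \<comment> \<open>Starting from \<open>Suc n\<close> makes the lengths strictly increase, so the
      strings determine a limit.\<close>
    then obtain x' n' where "x' \<in> cantor" "n' \<ge> Suc n" "agree (Suc n) x x'"
        "\<forall>x''\<in>cantor. agree n' x' x'' \<longrightarrow> x'' \<in> D k"
      using dense[of x "Suc n" k] by auto
    moreover from this have "agree n x x'" "agree n0 x0 x'"
      using x(2,3) agree_trans agree_mono[of "Suc n" x x'] by auto
    ultimately show "\<exists>p'. (ok p' \<and> (Suc k = 0 \<longrightarrow> p' = (x0, n0))) \<and> Q k p p'"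
      using x by (intro exI[of _ "(x', n')"]) (simp add: ok_def Q_def xn)
  qed
  then obtain f where f: "\<And>k. ok (f k)" "f 0 = (x0, n0)" "\<And>k. Q k (f k) (f (Suc k))"
    by (metis (no_types, lifting))
  define X where "X k = fst (f k)" for k
  define N where "N k = snd (f k)" for k
  have step: "N k < N (Suc k)" "agree (N k) (X k) (X (Suc k))"
      "\<And>x. x \<in> cantor \<Longrightarrow> agree (N (Suc k)) (X (Suc k)) x \<Longrightarrow> x \<in> D k" for k
    using f(3)[of k] by (simp_all add: Q_def X_def N_def)
  have N: "k \<le> N k" for k
    by (induction k) (use step(1) in \<open>auto intro: Suc_leI order_le_less_trans\<close>)
  have mono: "N k \<le> N m \<and> agree (N k) (X k) (X m)" if "k \<le> m" for k m
    using that
  proof (induction m rule: dec_induct)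
    case (step m)
    then show ?case using \<open>N m < N (Suc m)\<close> \<open>agree (N m) (X m) (X (Suc m))\<close> agree_trans agree_mono
      by (meson less_imp_le_nat order_trans)
  qed simp
  define x where "x i = X (Suc i) i" for i
  have lim: "agree (N k) (X k) x" for k
    unfolding agree_def
  proof (intro allI impI)
    fix i assume i: "i < N k"
    have "i < N (Suc i)" using N[of "Suc i"] by simp
    then show "X k i = x i"
      using mono[of k "Suc i"] mono[of "Suc i" k] i by (cases "k \<le> Suc i") (auto simp: x_def agree_def)
  qed
  have "X k \<in> cantor" for k using f(1)[of k] by (simp add: ok_def X_def)
  then have "x \<in> cantor" by (auto simp: cantor_def x_def)
  moreover have "agree n0 x0 x" using lim[of 0] f(2) by (simp add: X_def N_def)
  ultimately show ?thesis using step(3) lim by blast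
qed

lemma run_Pair_halts: "run (Pair c d) x n \<noteq> None \<longleftrightarrow> run c x n \<noteq> None \<and> run d x n \<noteq> None"
  by (cases "run c x n"; cases "run d x n") simp_all

lemma learner_Psi: "learner (Psi i)"
  using range_Psi by blast

text \<open>With \<open>N\<close> and the guess \<open>c'\<close> fixed, returning successfully is a
  \<open>\<Pi>\<^sup>0\<^sub>2\<close> event, that is, totality of one program. In this form it can
  be forced densely and then followed by a computable point.\<close>

lemma return_halting_code:
  assumes R: "decidable_on UNIV (\<lambda>x n. R x (fst (prod_decode n)) (snd (prod_decode n)))"
    and \<psi>: "learner \<psi>"
  shows "\<exists>W. \<forall>x. (\<forall>j. run W x j \<noteq> None) \<longleftrightarrow>
     (\<exists>y y'. Phi c x = Some y \<and> (\<forall>j\<ge>N. \<psi> (restrict_to y j) = c') \<and> Phi c' y = Some y' \<and> (\<forall>k. \<exists>s. R y' k s))"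
proof -
  define X where "X = {x. Phi c x \<noteq> None}"
  define Y where "Y x = the (Phi c x)" for x
  define X' where "X' = {x \<in> X. Phi c' (Y x) \<noteq> None}"
  define Y' where "Y' x = the (Phi c' (Y x))" for x
  have run_c: "run (code_of c) x n = Some (Y x n)" if "x \<in> X" for x n
  proof -
    from that obtain y where "Phi c x = Some y" unfolding X_def by blast
    then show ?thesis by (simp add: Y_def Phi_eq_Some_iff[symmetric]) (simp add: Phi_eq_Some_iff)
  qed
  then have Y: "computable_on X Y" by (intro computable_onI[where c = "code_of c"])
  have "run (Comp (code_of c) Snd) x (prod_encode (p, n)) = Some (Y x n)" if "x \<in> X" for x p n
    using run_c[OF that] by simp
  then obtain c2 where c2: "\<And>x p n. x \<in> X \<Longrightarrow> run c2 x (prod_encode (p, n)) = run (code_of c') (Y x) n"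
    using run_subst_oracle[of "Comp (code_of c) Snd" "code_of c'"] by metis
  define W2 where "W2 = Comp c2 (Pair Zero (Pair Fst Snd))"
  have W2: "run W2 x n = run (code_of c') (Y x) n" if "x \<in> X" for x n
    using c2[OF that] by (simp add: W2_def)
  have "run W2 x n = Some (Y' x n)" if "x \<in> X'" for x n
  proof -
    from that obtain y where "Phi c' (Y x) = Some y" unfolding X'_def by blast
    then show ?thesis using that W2[of x n] by (simp add: X'_def Y'_def) (simp add: Phi_eq_Some_iff)
  qed
  then have Y': "computable_on X' Y'" by (intro computable_onI[where c = W2])
  have "decidable_on X (\<lambda>x m. N \<le> fst (prod_decode m) \<longrightarrow> \<psi> (restrict_to (Y x) (fst (prod_decode m))) = c')"
    by (intro computable_intros computable_on_learner[OF \<psi>] computable_on_comp[OF Y])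
  then obtain W1 where W1: "\<And>x j. x \<in> X \<Longrightarrow> run W1 x j \<noteq> None \<longleftrightarrow> (N \<le> j \<longrightarrow> \<psi> (restrict_to (Y x) j) = c')"
    using semidecidable[where P = "\<lambda>x j k. N \<le> j \<longrightarrow> \<psi> (restrict_to (Y x) j) = c'"] by auto
  have "decidable_on X' (\<lambda>x n. R (Y' x) (fst (prod_decode n)) (snd (prod_decode n)))"
    by (rule decidable_on_subst[OF R, where H = "\<lambda>x n. Y' x" and G = "\<lambda>x n. n"])
      (intro computable_intros computable_on_comp[OF Y'] UNIV_I)+
  then obtain W3 where W3: "\<And>x k. x \<in> X' \<Longrightarrow> run W3 x k \<noteq> None \<longleftrightarrow> (\<exists>s. R (Y' x) k s)"
    using semidecidable[where P = "\<lambda>x k s. R (Y' x) k s"] by auto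
  have "(\<forall>j. run (Pair (code_of c) (Pair W2 (Pair W1 W3))) x j \<noteq> None) \<longleftrightarrow>
     (\<exists>y y'. Phi c x = Some y \<and> (\<forall>j\<ge>N. \<psi> (restrict_to y j) = c') \<and> Phi c' y = Some y' \<and> (\<forall>k. \<exists>s. R y' k s))"
    (is "?L \<longleftrightarrow> ?R") for x
  proof
    assume L: ?L
    then have h: "\<forall>j. run (code_of c) x j \<noteq> None" "\<forall>j. run W2 x j \<noteq> None"
        "\<forall>j. run W1 x j \<noteq> None" "\<forall>j. run W3 x j \<noteq> None"
      unfolding run_Pair_halts by blast+
    \<comment> \<open>\<open>W2\<close> and \<open>W1\<close> behave as intended only on
      \<open>X\<close>, and \<open>W3\<close> only on \<open>X'\<close>. The membership facts must
      therefore come first, from the components that test totality.\<close>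
    have x: "x \<in> X" using h(1) by (simp add: X_def Phi_def)
    then have "\<forall>j. run (code_of c') (Y x) j \<noteq> None" using h(2) W2 by simp
    then have x': "x \<in> X'" using x by (simp add: X'_def Phi_def)
    have "Phi c x = Some (Y x)" using x by (auto simp: X_def Y_def)
    moreover have "Phi c' (Y x) = Some (Y' x)" using x' by (auto simp: X'_def Y'_def)
    moreover have "\<forall>j\<ge>N. \<psi> (restrict_to (Y x) j) = c'" using h(3) W1[OF x] by blast
    moreover have "\<forall>k. \<exists>s. R (Y' x) k s" using h(4) W3[OF x'] by blast
    ultimately show ?R by blast
  next
    assume ?R
    then obtain y y' where y: "Phi c x = Some y" "\<forall>j\<ge>N. \<psi> (restrict_to y j) = c'" "Phi c' y = Some y'"
        "\<forall>k. \<exists>s. R y' k s" by blast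
    then have x: "x \<in> X" "Y x = y" and x': "x \<in> X'" "Y' x = y'"
      by (simp_all add: X_def X'_def Y_def Y'_def)
    show ?L
      unfolding run_Pair_halts W1[OF x(1)] W3[OF x'(1)] W2[OF x(1)] run_c[OF x(1)] x(2) x'(2)
      using y by (simp add: Phi_eq_Some_iff)
  qed
  then show ?thesis by blast
qed

text \<open>
  The members of \<open>T\<close> supplied by \<open>diverge\<close> defeat all learners that densely change their mind, so
  above some string a fixed \<open>\<Phi>\<^sub>c\<close> maps all sufficiently generic points into \<open>P\<close>. By the Baire
  category theorem one fixed way of returning to one fixed \<open>\<Pi>\<^sup>0\<^sub>2\<close> part of \<open>T\<close> is then forced above a
  longer string, and a computable point following this forcing yields a computable member.
\<close>

lemma no_equivalent_closed_set:
  fixes \<psi> :: "nat \<Rightarrow> nat list \<Rightarrow> nat"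
  assumes R: "decidable_on UNIV (\<lambda>x n. R x (fst (prod_decode n)) (fst (prod_decode (snd (prod_decode n))))
      (snd (prod_decode (snd (prod_decode n)))))"
    and TR: "\<And>x. x \<in> T \<Longrightarrow> \<exists>m. \<forall>k. \<exists>s. R x m k s"
    and noncomp: "\<And>x m. \<forall>k. \<exists>s. R x m k s \<Longrightarrow> \<not> computable_point x"
    and T: "T \<subseteq> cantor"
    and P: "closed_points P"
    and to: "\<And>g. g \<in> T \<Longrightarrow> \<exists>e<b. limit_succeeds (\<psi> e) P g"
    and ret: "\<And>y. y \<in> P \<Longrightarrow> \<exists>i<b'. limit_succeeds (Psi i) T y"
    and diverge: "\<And>x n. x \<in> cantor \<Longrightarrow> \<exists>x'\<in>T. agree n x x' \<and>
        (\<forall>e<b. mind_changing (\<psi> e) x n \<longrightarrow> \<not> (\<exists>c. \<forall>\<^sub>F k in sequentially. \<psi> e (restrict_to x' k) = c))"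
  shows False
proof -
  have "(\<lambda>_. 0) \<in> cantor" by (simp add: cantor_def)
  then obtain x n where x: "x \<in> cantor" and dec: "\<forall>e<b. decided (\<psi> e) P x n"
    using decided_dense_finite[OF P, where \<psi> = \<psi> and b = b] by blast
  obtain x' where x': "x' \<in> T" "agree n x x'" and div: "\<And>e. e < b \<Longrightarrow> mind_changing (\<psi> e) x n \<Longrightarrow>
      \<not> (\<exists>c. \<forall>\<^sub>F k in sequentially. \<psi> e (restrict_to x' k) = c)"
    using diverge[OF x, of n] by blast
  obtain e where e: "e < b" "limit_succeeds (\<psi> e) P x'" using to[OF x'(1)] by blast
  then have "\<not> mind_changing (\<psi> e) x n" using div by (auto simp: limit_succeeds_def)
  moreover have "\<not> failing (\<psi> e) P x n" using e(2) x' T by (auto simp: failing_def)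
  ultimately obtain c where c: "forced_into c P x n" using dec e(1) by (auto simp: decided_def)
  \<comment> \<open>Learner, limit guess, settling time and index of the part reached: fixing all
    four leaves countably many ways of returning, each expressible by
    \<open>return_halting_code\<close>.\<close>
  define returns where "returns i c' N m x \<longleftrightarrow> (\<exists>y y'. Phi c x = Some y \<and>
      (\<forall>j\<ge>N. Psi i (restrict_to y j) = c') \<and> Phi c' y = Some y' \<and> (\<forall>k. \<exists>s. R y' m k s))" for i c' N m x
  have "\<exists>W. \<forall>x. (\<forall>j. run W x j \<noteq> None) \<longleftrightarrow> returns i c' N m x" for i c' N m
    unfolding returns_def
  proof (intro return_halting_code learner_Psi)
    show "decidable_on UNIV (\<lambda>x n. R x m (fst (prod_decode n)) (snd (prod_decode n)))"
      using decidable_on_comp[OF R, of "\<lambda>_ n. prod_encode (m, n)"]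
      by (simp add: computable_on_pair computable_on_const computable_on_id)
  qed
  then have "\<exists>W. {x. \<forall>j. run W x j \<noteq> None} = Collect (returns i c' N m)" for i c' N m
    by (simp only: set_eq_iff mem_Collect_eq)
  then obtain W where "\<And>i c' N m. {x. \<forall>j. run (W i c' N m) x j \<noteq> None} = Collect (returns i c' N m)"
    by metis
  then have W: "\<And>i c' N m x. (\<forall>j. run (W i c' N m) x j \<noteq> None) \<longleftrightarrow> returns i c' N m x"
    by (simp only: set_eq_iff mem_Collect_eq)
  define V where "V k = W (pad (list_decode k) 0) (pad (list_decode k) 1) (pad (list_decode k) 2)
      (pad (list_decode k) 3)" for k
  have "\<exists>k. \<exists>x1\<in>cantor. \<exists>n1\<ge>n. agree n x x1 \<and> (\<forall>x2\<in>cantor. \<forall>n2\<ge>n1. agree n1 x1 x2 \<longrightarrow>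
      (\<forall>j. \<exists>x3\<in>cantor. agree n2 x2 x3 \<and> run (V k) x3 j \<noteq> None))"
  proof (rule ccontr)
    assume neg: "\<not> ?thesis"
    \<comment> \<open>A point in all the even sets has a total image under \<open>c\<close>, hence
      an image in \<open>P\<close>; a point in all the odd ones escapes every way of returning. If
      no way were forced anywhere, the odd sets would contain dense open ones too.\<close>
    define D where "D k = (if even k then {x. run (code_of c) x (k div 2) \<noteq> None}
        else {x. \<exists>j. run (V (k div 2)) x j = None})" for k
    have "\<exists>g\<in>cantor. agree n x g \<and> (\<forall>k. g \<in> D k)"
    proof (rule cantor_baire[OF _ x])
      fix k x1 n1
      assume x1: "x1 \<in> cantor" "n \<le> n1" "agree n x x1"
      show "\<exists>x'\<in>cantor. \<exists>n'\<ge>n1. agree n1 x1 x' \<and> (\<forall>x''\<in>cantor. agree n' x' x'' \<longrightarrow> x'' \<in> D k)"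
      proof (cases "even k")
        case True
        obtain x2 v where x2: "x2 \<in> cantor" "agree n1 x1 x2" "run (code_of c) x2 (k div 2) = Some v"
          using c x1 unfolding forced_into_def by blast
        then obtain m where m: "\<And>x''. agree m x2 x'' \<Longrightarrow> run (code_of c) x'' (k div 2) = Some v"
          using run_use by blast
        have "x'' \<in> D k" if "agree (max m n1) x2 x''" for x''
          using True m[OF agree_mono[OF that]] by (simp add: D_def)
        then show ?thesis using x2(1,2) by (intro bexI[of _ x2] exI[of _ "max m n1"]) auto
      next
        case False
        obtain x2 n2 j where "x2 \<in> cantor" "n2 \<ge> n1" "agree n1 x1 x2"
            "\<forall>x3\<in>cantor. agree n2 x2 x3 \<longrightarrow> run (V (k div 2)) x3 j = None"
          using neg x1 by blast
        then show ?thesis using False by (auto simp: D_def)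
      qed
    qed
    then obtain g where g: "g \<in> cantor" "agree n x g" "\<And>k. g \<in> D k" by blast
    have "run (code_of c) g j \<noteq> None" for j using g(3)[of "2 * j"] by (simp add: D_def)
    then obtain y where y: "Phi c g = Some y" by (simp add: Phi_def)
    then have "y \<in> P" using c g(1,2) unfolding forced_into_def by blast
    then obtain i c' y' where "\<forall>\<^sub>F j in sequentially. Psi i (restrict_to y j) = c'" and y': "Phi c' y = Some y'" "y' \<in> T"
      using ret unfolding limit_succeeds_def by blast
    moreover obtain m where "\<forall>k. \<exists>s. R y' m k s" using TR y'(2) by blast
    ultimately obtain N where "\<forall>j. run (W i c' N m) g j \<noteq> None"
      using y unfolding W returns_def eventually_sequentially by blast
    moreover have "V (list_encode [i, c', N, m]) = W i c' N m"
      by (simp add: V_def pad_def numeral_3_eq_3 numeral_2_eq_2 del: list_encode.simps)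
    moreover have "\<exists>j. run (V (list_encode [i, c', N, m])) g j = None"
      using g(3)[of "2 * list_encode [i, c', N, m] + 1"] by (simp add: D_def del: list_encode.simps)
    ultimately show False by metis
  qed
  then obtain k x1 n1 where "x1 \<in> cantor" and "\<And>x2 n2 j. x2 \<in> cantor \<Longrightarrow> agree n1 x1 x2 \<Longrightarrow> n1 \<le> n2 \<Longrightarrow>
      \<exists>x3\<in>cantor. agree n2 x2 x3 \<and> run (V k) x3 j \<noteq> None" by blast
  \<comment> \<open>The category argument used a generic point only to single out \<open>k\<close>.
    Halting of \<open>V k\<close> is now dense above \<open>x1\<close>, so a computable point can
    achieve it at every argument.\<close>
  then obtain g where g: "computable_point g" "\<forall>j. run (V k) g j \<noteq> None"
    using computable_generic[of n1 x1 "V k"] unfolding computable_point_def by blast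
  then obtain c' y y' where "Phi c g = Some y" "Phi c' y = Some y'"
      and R': "\<forall>j. \<exists>s. R y' (pad (list_decode k) 3) j s"
    unfolding V_def W returns_def by blast
  then have "computable_point y'"
    using computable_point_run g(1) unfolding Phi_eq_Some_iff by metis
  then show False using noncomp R' by blast
qed

section \<open>The negative results on existential classes\<close>

lemma dnc2_Pi0_1: "dnc2 \<in> Pi0 1 cantor"
proof -
  \<comment> \<open>A derivation code exceeds the program numbers in it, so one universal quantifier
    over \<open>t\<close> covers \<open>e\<close> as well.\<close>
  have "decidable_on cantor (\<lambda>x t. \<forall>e<t. \<not> derives (\<lambda>_. 0) t e e (x e))"
    by (intro computable_intros decidable_derives)
  then have "{x \<in> cantor. \<forall>t. \<forall>e<t. \<not> derives (\<lambda>_. 0) t e e (x e)} \<in> Pi0 1 cantor" by (rule Pi0_1I)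
  moreover have "(\<forall>t. \<forall>e<t. \<not> derives (\<lambda>_. 0) t e e (x e)) \<longleftrightarrow> (\<forall>e. run (code_of e) (\<lambda>_. 0) e \<noteq> Some (x e))" for x
    using derives_iff_run derives_bounds by metis
  ultimately show ?thesis by (simp add: dnc2_def)
qed

lemma reducible_fin_1_imp_fin_omega:
  assumes "reducible computable_fin_1 A B"
  shows "reducible computable_fin_omega A B"
proof -
  obtain b where b: "\<And>g. g \<in> B \<Longrightarrow> \<exists>e<b. \<exists>y. Phi e g = Some y \<and> y \<in> A"
    using assms unfolding reducible_fin_1_iff by blast
  have "learner (\<lambda>_. e)" for e
    unfolding learner_iff_computable by (intro computable_intros)
  then have "\<forall>e. \<exists>i. Psi i = (\<lambda>_. e)" using range_Psi by (metis mem_Collect_eq rangeE)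
  then obtain f where f: "\<And>e. Psi (f e) = (\<lambda>_. e)" by metis
  \<comment> \<open>The sum is at least each of the finitely many learner indices
    \<open>f e\<close>.\<close>
  have "\<exists>i<Suc (\<Sum>e<b. f e). limit_succeeds (Psi i) A g" if g: "g \<in> B" for g
  proof -
    obtain e y where e: "e < b" "Phi e g = Some y" "y \<in> A" using b[OF g] by blast
    then have "limit_succeeds (Psi (f e)) A g" by (simp add: limit_succeeds_def f)
    moreover have "f e \<le> (\<Sum>e<b. f e)" using e(1) by (intro member_le_sum) auto
    ultimately show ?thesis using less_Suc_eq_le by blast
  qed
  then show ?thesis unfolding reducible_fin_omega_iff by blast
qed

lemma computable_point_shift: "computable_point x \<Longrightarrow> computable_point (\<lambda>e. x (m + e))"
  unfolding computable_point_def by (erule computable_on_comp) (intro computable_intros)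

lemma glue_cantor: "x \<in> cantor \<Longrightarrow> z \<in> cantor \<Longrightarrow> (\<lambda>i. if i < n then x i else z (i - n)) \<in> cantor"
  by (simp add: cantor_def)

lemma not_SEL_Sigma0_2_fin_1: "\<not> SEL (Sigma0 2 cantor) computable_fin_1"
proof
  assume SEL: "SEL (Sigma0 2 cantor) computable_fin_1"
  define R where "R = (\<lambda>x m t (s::nat). \<forall>e<t. \<not> derives (\<lambda>_. 0) t e e (x (m + e)))"
  define S where "S = {x \<in> cantor. \<exists>m. \<forall>t. R x m t 0}"
  have R_iff: "(\<forall>t. R x m t 0) \<longleftrightarrow> (\<forall>e. run (code_of e) (\<lambda>_. 0) e \<noteq> Some (x (m + e)))" for x m
    unfolding R_def using derives_iff_run derives_bounds by metis
  have "S \<in> Sigma0 2 cantor"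
    unfolding S_def R_def by (intro Sigma0_2I computable_intros decidable_derives)
  moreover have dnc: "dnc2 \<subseteq> S"
    unfolding S_def R_iff dnc2_def by (auto intro: exI[of _ 0])
  ultimately obtain P where "P \<in> Pi0 1 cantor" and "degree_equiv computable_fin_1 P (S \<union> dnc2)"
    using SEL dnc2_Pi0_1 dnc2_nonempty unfolding SEL_def by blast
  moreover have "S \<union> dnc2 = S" using dnc by blast
  ultimately have P: "closed_points P" and to: "reducible computable_fin_1 P S"
    and ret: "reducible computable_fin_omega S P"
    by (simp_all add: degree_equiv_def closed_Pi0_1 reducible_fin_1_imp_fin_omega)
  obtain b where b: "\<And>g. g \<in> S \<Longrightarrow> \<exists>e<b. \<exists>y. Phi e g = Some y \<and> y \<in> P"
    using to unfolding reducible_fin_1_iff by blast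
  obtain b' where b': "\<And>y. y \<in> P \<Longrightarrow> \<exists>i<b'. limit_succeeds (Psi i) S y"
    using ret unfolding reducible_fin_omega_iff by blast
  show False
  proof (rule no_equivalent_closed_set[where R = R and T = S and P = P and \<psi> = "\<lambda>e _. e"])
    show "decidable_on UNIV (\<lambda>x n. R x (fst (prod_decode n)) (fst (prod_decode (snd (prod_decode n))))
        (snd (prod_decode (snd (prod_decode n)))))"
      unfolding R_def by (intro computable_intros decidable_derives)
    show "\<exists>m. \<forall>k. \<exists>s. R x m k s" if "x \<in> S" for x using that unfolding S_def by blast
    show "\<not> computable_point x" if "\<forall>k. \<exists>s. R x m k s" for x m
    proof -
      have "\<forall>t. R x m t 0" using that by (simp add: R_def)
      then have "\<not> computable_point (\<lambda>e. x (m + e))" unfolding R_iff by (intro dnc_not_computable) simp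
      then show ?thesis using computable_point_shift by blast
    qed
    show "S \<subseteq> cantor" by (auto simp: S_def)
    show "closed_points P" by (rule P)
    show "\<exists>e<b. limit_succeeds (\<lambda>_. e) P g" if "g \<in> S" for g
      using b[OF that] by (simp add: limit_succeeds_def)
    show "\<exists>i<b'. limit_succeeds (Psi i) S y" if "y \<in> P" for y by (rule b'[OF that])
    \<comment> \<open>Constant learners never change their mind, so it suffices that some member of
      \<open>S\<close> extends the string.\<close>
    show "\<exists>x'\<in>S. agree n x x' \<and> (\<forall>e<b. mind_changing (\<lambda>_. e) x n \<longrightarrow>
        \<not> (\<exists>c. \<forall>\<^sub>F k in sequentially. e = c))" if x: "x \<in> cantor" for x n
    proof -
      obtain z where z: "z \<in> dnc2" using dnc2_nonempty by blast
      let ?x = "\<lambda>i. if i < n then x i else z (i - n)"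
      have "?x \<in> S"
        unfolding S_def R_iff using z x glue_cantor[of x z n] by (auto simp: dnc2_def intro!: exI[of _ n])
      moreover have "agree n x ?x" by (simp add: agree_def)
      moreover have "\<not> mind_changing (\<lambda>_. e) x n" for e
        unfolding mind_changing_def using x agree_refl by blast
      ultimately show ?thesis by blast
    qed
  qed
qed

text \<open>If the guesses on the shifted point settled at \<open>c\<close> from \<open>N\<close>
  on, a later different guess would be a \<open>\<Sigma>\<^sup>0\<^sub>1\<close> event not met by
  \<open>generic\<close>, hence avoided above some prefix. The guesses would be constant above a
  string, against density of mind changes.\<close>

lemma shifted_generic_diverges:
  assumes x: "x \<in> cantor" and \<psi>: "learner \<psi>" and mc: "mind_changing \<psi> x n"
  shows "\<not> (\<exists>c. \<forall>\<^sub>F k in sequentially. \<psi> (restrict_to (\<lambda>i. if i < n then x i else generic (i - n)) k) = c)"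
proof
  \<comment> \<open>The program below cannot consult \<open>x\<close>, which need not be computable;
    its first \<open>n\<close> values enter as a constant list.\<close>
  define glue where "glue h i = (if i < n then pad (restrict_to x n) i else h (i - n))" for h :: "nat \<Rightarrow> nat" and i
  have glue: "glue h = (\<lambda>i. if i < n then x i else h (i - n))" for h
    by (auto simp: glue_def pad_def restrict_to_def)
  assume "\<exists>c. \<forall>\<^sub>F k in sequentially. \<psi> (restrict_to (\<lambda>i. if i < n then x i else generic (i - n)) k) = c"
  then obtain c N where N: "\<And>k. k \<ge> N \<Longrightarrow> \<psi> (restrict_to (glue generic) k) = c"
    unfolding glue eventually_sequentially by blast
  have "decidable_on UNIV (\<lambda>h m. N \<le> snd (prod_decode m) \<and> \<psi> (restrict_to (glue h) (snd (prod_decode m))) \<noteq> c)"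
    unfolding glue_def
    by (intro computable_intros computable_on_learner[OF \<psi>] computable_on_restrict[where f = "\<lambda>h _. glue h", unfolded glue_def])
  then obtain W where W: "\<And>h j. run W h j \<noteq> None \<longleftrightarrow> (\<exists>k\<ge>N. \<psi> (restrict_to (glue h) k) \<noteq> c)"
    using semidecidable[where X = UNIV and P = "\<lambda>h j k. N \<le> k \<and> \<psi> (restrict_to (glue h) k) \<noteq> c"] by auto
  then have "run W generic 0 = None" using N by blast
  then obtain n1 where "\<And>h. h \<in> cantor \<Longrightarrow> agree n1 generic h \<Longrightarrow> run W h 0 = None"
    using generic_meets_or_avoids[of W] by blast
  then have n1: "\<And>h k. h \<in> cantor \<Longrightarrow> agree n1 generic h \<Longrightarrow> k \<ge> N \<Longrightarrow> \<psi> (restrict_to (glue h) k) = c"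
    using W by blast
  define n' where "n' = max N (n + n1)"
  have "glue generic \<in> cantor" unfolding glue by (rule glue_cantor[OF x generic_cantor])
  moreover have "agree n x (glue generic)" by (simp add: agree_def glue)
  ultimately obtain x2 n2 where x2: "x2 \<in> cantor" "n2 \<ge> n'" "agree n' (glue generic) x2"
      "\<psi> (restrict_to x2 n2) \<noteq> \<psi> (restrict_to (glue generic) n')"
    using mc unfolding mind_changing_def n'_def by (metis max.coboundedI2 le_add1)
  define h where "h i = x2 (n + i)" for i
  have "glue h = x2"
  proof
    fix i
    show "glue h i = x2 i"
    proof (cases "i < n")
      case True
      then have "glue generic i = x2 i" using x2(3) by (simp add: agree_def n'_def)
      then show ?thesis using True by (simp add: glue)
    qed (simp add: glue h_def)
  qed
  moreover have "h \<in> cantor" using x2(1) by (simp add: cantor_def h_def)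
  moreover have "agree n1 generic h"
    unfolding agree_def
  proof (intro allI impI)
    fix i assume "i < n1"
    then have "glue generic (n + i) = x2 (n + i)" using x2(3) by (simp add: agree_def n'_def)
    then show "generic i = h i" by (simp add: glue h_def)
  qed
  ultimately have "\<psi> (restrict_to x2 n2) = c" using n1[of h n2] x2(2) by (simp add: n'_def)
  moreover have "\<psi> (restrict_to (glue generic) n') = c" by (rule N) (simp add: n'_def)
  ultimately show False using x2(4) by simp
qed

lemma not_SEL_Sigma0_3_fin_omega: "\<not> SEL (Sigma0 3 cantor) computable_fin_omega"
proof
  assume SEL: "SEL (Sigma0 3 cantor) computable_fin_omega"
  define A where "A = (\<lambda>x m k s. snd (prod_decode k) \<le> s \<and>
      restrict_to (\<lambda>i. x (m + i)) (length (generic_approx s (fst (prod_decode k)))) = generic_approx s (fst (prod_decode k)))"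
  \<comment> \<open>One index serves both parts: 0 stands for \<open>dnc2\<close>, and
    \<open>m + 1\<close> for having \<open>generic\<close> as the tail from \<open>m\<close> on. In
    \<open>A\<close>, the number \<open>k\<close> pairs a string index with the lower bound on the
    stage \<open>s\<close>.\<close>
  define R where "R = (\<lambda>x m k s. m = 0 \<and> (\<forall>e<k. \<not> derives (\<lambda>_. 0) k e e (x e)) \<or> 0 < m \<and> A x (m - 1) k s)"
  define S where "S = {x \<in> cantor. \<exists>m. \<forall>k. \<exists>s. A x m k s}"
  have dA: "decidable_on X (\<lambda>x n. A x (M x n) (K x n) (N x n))"
    if "computable_on X M" "computable_on X K" "computable_on X N" for X M K N
    unfolding A_def by (intro computable_intros computable_on_generic_approx that computable_on_comp[OF that(1)])
  have A_iff: "(\<forall>k. \<exists>s. A x m k s) \<longleftrightarrow> (\<lambda>i. x (m + i)) = generic" for x m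
    unfolding A_def eq_generic_iff by (metis fst_conv snd_conv prod_encode_inverse)
  have dnc: "(\<forall>k. \<forall>e<k. \<not> derives (\<lambda>_. 0) k e e (x e)) \<longleftrightarrow> (\<forall>e. run (code_of e) (\<lambda>_. 0) e \<noteq> Some (x e))" for x
    using derives_iff_run derives_bounds by metis
  have "S \<in> Sigma0 3 cantor"
    unfolding S_def by (intro Sigma0_3I dA computable_intros)
  then obtain P where "P \<in> Pi0 1 cantor" and "degree_equiv computable_fin_omega P (S \<union> dnc2)"
    using SEL dnc2_Pi0_1 dnc2_nonempty unfolding SEL_def by blast
  then have P: "closed_points P" and to: "reducible computable_fin_omega P (S \<union> dnc2)"
    and ret: "reducible computable_fin_omega (S \<union> dnc2) P"
    by (simp_all add: degree_equiv_def closed_Pi0_1)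
  obtain b where b: "\<And>g. g \<in> S \<union> dnc2 \<Longrightarrow> \<exists>e<b. limit_succeeds (Psi e) P g"
    using to unfolding reducible_fin_omega_iff by blast
  obtain b' where b': "\<And>y. y \<in> P \<Longrightarrow> \<exists>i<b'. limit_succeeds (Psi i) (S \<union> dnc2) y"
    using ret unfolding reducible_fin_omega_iff by blast
  show False
  proof (rule no_equivalent_closed_set[where R = R and T = "S \<union> dnc2" and P = P and \<psi> = Psi])
    show "decidable_on UNIV (\<lambda>x n. R x (fst (prod_decode n)) (fst (prod_decode (snd (prod_decode n))))
        (snd (prod_decode (snd (prod_decode n)))))"
      unfolding R_def by (intro computable_intros decidable_derives dA)
    show "\<exists>m. \<forall>k. \<exists>s. R x m k s" if x: "x \<in> S \<union> dnc2" for x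
    proof (cases "x \<in> dnc2")
      case True
      then have "\<forall>k. R x 0 k 0" using dnc[of x] by (simp add: R_def dnc2_def)
      then show ?thesis by blast
    next
      case False
      then obtain m where "\<forall>k. \<exists>s. A x m k s" using x unfolding S_def by blast
      then have "\<forall>k. \<exists>s. R x (Suc m) k s" by (simp add: R_def)
      then show ?thesis by blast
    qed
    show "\<not> computable_point x" if "\<forall>k. \<exists>s. R x m k s" for x m
    proof (cases m)
      case 0
      then show ?thesis using that dnc[of x] dnc_not_computable by (simp add: R_def)
    next
      case (Suc m')
      then have "(\<lambda>i. x (m' + i)) = generic" using that unfolding A_iff[symmetric] by (simp add: R_def)
      then show ?thesis using computable_point_shift generic_not_computable by metis
    qed
    show "S \<union> dnc2 \<subseteq> cantor" by (auto simp: S_def dnc2_def)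
    show "closed_points P" by (rule P)
    show "\<exists>e<b. limit_succeeds (Psi e) P g" if "g \<in> S \<union> dnc2" for g by (rule b[OF that])
    show "\<exists>i<b'. limit_succeeds (Psi i) (S \<union> dnc2) y" if "y \<in> P" for y by (rule b'[OF that])
    show "\<exists>x'\<in>S \<union> dnc2. agree n x x' \<and> (\<forall>e<b. mind_changing (Psi e) x n \<longrightarrow>
        \<not> (\<exists>c. \<forall>\<^sub>F k in sequentially. Psi e (restrict_to x' k) = c))" if x: "x \<in> cantor" for x n
    proof -
      let ?x = "\<lambda>i. if i < n then x i else generic (i - n)"
      have "(\<lambda>i. ?x (n + i)) = generic" by simp
      then have "\<forall>k. \<exists>s. A ?x n k s" unfolding A_iff .
      then have "?x \<in> S"
        unfolding S_def using glue_cantor[OF x generic_cantor, of n] by blast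
      moreover have "agree n x ?x" by (simp add: agree_def)
      ultimately show ?thesis
        using shifted_generic_diverges[OF x learner_Psi] by (intro bexI[of _ ?x]) auto
    qed
  qed
qed

section \<open>Constant functionals on effectively closed sets\<close>

lemma koenig_binary:
  assumes G_take: "\<And>l k. G l \<Longrightarrow> G (take k l)"
    and ex: "\<And>n. \<exists>l. length l = n \<and> binary l \<and> G l"
  shows "\<exists>x\<in>cantor. \<forall>n. G (restrict_to x n)"
proof -
  \<comment> \<open>The strings with infinitely many extensions in the tree, as in the usual proof
    of Koenig's lemma.\<close>
  define ext where "ext \<sigma> \<longleftrightarrow> (\<forall>n\<ge>length \<sigma>. \<exists>l. length l = n \<and> binary l \<and> G l \<and> take (length \<sigma>) l = \<sigma>)" for \<sigma>
  have step: "ext (\<sigma> @ [0]) \<or> ext (\<sigma> @ [1])" if \<sigma>: "ext \<sigma>" for \<sigma>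
  proof (rule ccontr)
    assume "\<not> (ext (\<sigma> @ [0]) \<or> ext (\<sigma> @ [1]))"
    then obtain n0 n1 where n: "n0 > length \<sigma>" "n1 > length \<sigma>"
      and n0: "\<And>l. length l = n0 \<Longrightarrow> binary l \<Longrightarrow> G l \<Longrightarrow> take (Suc (length \<sigma>)) l \<noteq> \<sigma> @ [0]"
      and n1: "\<And>l. length l = n1 \<Longrightarrow> binary l \<Longrightarrow> G l \<Longrightarrow> take (Suc (length \<sigma>)) l \<noteq> \<sigma> @ [1]"
      unfolding ext_def by (auto simp: Suc_le_eq)
    obtain l where l: "length l = max n0 n1" "binary l" "G l" "take (length \<sigma>) l = \<sigma>"
      using \<sigma> n(1) unfolding ext_def by (metis less_imp_le_nat max.coboundedI1)
    have bin: "binary (take k l)" for k using l(2) by (simp add: binary_def pad_def)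
    have "take (Suc (length \<sigma>)) l = \<sigma> @ [l ! length \<sigma>]"
      using l(1,4) n by (simp add: take_Suc_conv_app_nth)
    moreover have "l ! length \<sigma> < 2" using l(1,2) n by (auto simp: binary_def pad_def split: if_splits)
    then have "l ! length \<sigma> = 0 \<or> l ! length \<sigma> = 1" by auto
    ultimately show False
      using n0[of "take n0 l"] n1[of "take n1 l"] G_take[OF l(3)] bin l(1) n by (auto simp: min_absorb1)
  qed
  define s where "s = rec_nat [] (\<lambda>_ \<sigma>. if ext (\<sigma> @ [0]) then \<sigma> @ [0] else \<sigma> @ [1])"
  have s_Suc: "s (Suc k) = (if ext (s k @ [0]) then s k @ [0] else s k @ [1])" for k by (simp add: s_def)
  have ext_s: "ext (s k) \<and> length (s k) = k" for k
  proof (induction k)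
    case 0
    show ?case using ex by (simp add: s_def ext_def)
  next
    case (Suc k)
    then show ?case using step[of "s k"] by (auto simp: s_Suc)
  qed
  have s: "G (s k) \<and> binary (s k)" for k
    using ext_s[of k] unfolding ext_def by (metis order_refl take_all)
  define x where "x = (\<lambda>n. pad (s (Suc n)) n)"
  have "restrict_to x (length (s k)) = s k" for k
    unfolding x_def by (rule chain_limit[where s = s]) (auto simp: s_Suc)
  moreover have "x \<in> cantor" unfolding x_def by (rule chain_limit_cantor[where s = s]) (use s in blast)
  ultimately show ?thesis using s ext_s by metis
qed

lemma prod_encode_mono:
  assumes "a \<le> b" "c \<le> d"
  shows "prod_encode (a, c) \<le> prod_encode (b, d)"
proof -
  have "triangle (a + c) \<le> triangle (b + d)"
    unfolding triangle_def using assms by (intro div_le_mono mult_le_mono) auto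
  then show ?thesis using assms(1) by (simp add: prod_encode_def)
qed

text \<open>The all-ones string bounds the codes of its length, so a statement about a whole level
  of the binary tree is decidable.\<close>

lemma list_encode_binary_le: "binary l \<Longrightarrow> list_encode l \<le> list_encode (replicate (length l) 1)"
proof (induction l)
  case (Cons a l)
  have "binary l" using Cons.prems by (fastforce simp: binary_def pad_def)
  moreover have "a \<le> 1" using Cons.prems by (force simp: binary_def pad_def)
  ultimately show ?case using Cons.IH prod_encode_mono[of a 1] by simp
qed simp

text \<open>By compactness, for each argument some level of the tree has all its strings seeing the
  common value. A search for a level and a value on which all its strings agree computes
  \<open>z\<close>.\<close>

lemma unique_value_computable:
  assumes dec: "decidable_on UNIV (\<lambda>_ n. f (list_decode n))"
    and y: "y \<in> cantor" "\<And>n. f (restrict_to y n)"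
    and val: "\<And>x n. x \<in> cantor \<Longrightarrow> (\<And>k. f (restrict_to x k)) \<Longrightarrow> run (code_of e) x n = Some (z n)"
  shows "computable_point z"
proof -
  \<comment> \<open>\<open>f\<close> is not assumed closed under prefixes, so all prefixes are
    required here to make the strings a tree.\<close>
  define tree where "tree l \<longleftrightarrow> binary l \<and> (\<forall>i\<le>length l. f (take i l))" for l
  have tree_y: "tree (restrict_to y n)" for n
    using y by (simp add: tree_def binary_restrict take_restrict)
  have settled: "\<exists>n. \<forall>l. length l = n \<and> tree l \<longrightarrow> sees l e k (z k)" for k
  proof (rule ccontr)
    assume neg: "\<not> ?thesis"
    have "\<exists>x\<in>cantor. \<forall>n. tree (restrict_to x n) \<and> \<not> sees (restrict_to x n) e k (z k)"
    proof (rule koenig_binary)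
      show "\<exists>l. length l = n \<and> binary l \<and> tree l \<and> \<not> sees l e k (z k)" for n
        using neg unfolding tree_def by blast
      show "tree (take j l) \<and> \<not> sees (take j l) e k (z k)" if "tree l \<and> \<not> sees l e k (z k)" for j l
        using that sees_take[of j l] by (auto simp: tree_def binary_def pad_def min_def)
    qed
    then obtain x where x: "x \<in> cantor" "\<And>n. tree (restrict_to x n)" "\<And>n. \<not> sees (restrict_to x n) e k (z k)"
      by blast
    have "f (restrict_to x n)" for n
      using x(2)[of n] unfolding tree_def by (metis length_restrict order_refl take_restrict)
    then show False using val[OF x(1)] x(3) sees_iff_run by blast
  qed
  define Q where "Q k p \<longleftrightarrow> (\<forall>t\<le>list_encode (map (\<lambda>_. 1) [0..<fst (prod_decode p)]).
      length (list_decode t) = fst (prod_decode p) \<and> tree (list_decode t) \<longrightarrow>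
      sees (list_decode t) e k (snd (prod_decode p)))" for k p
  have Q_iff: "Q k (prod_encode (n, v)) \<longleftrightarrow> (\<forall>l. length l = n \<and> tree l \<longrightarrow> sees l e k v)" for k n v
  proof -
    have "list_encode l \<le> list_encode (map (\<lambda>_. 1) [0..<n])" if "length l = n" "tree l" for l
      using list_encode_binary_le[of l] that by (simp add: tree_def map_replicate_const)
    then show ?thesis unfolding Q_def by (metis fst_conv snd_conv list_encode_inverse prod_encode_inverse)
  qed
  have ex: "\<exists>p. Q k p" for k using settled Q_iff by blast
  have "z k = snd (prod_decode (LEAST p. Q k p))" for k
  proof -
    obtain n v where p: "(LEAST p. Q k p) = prod_encode (n, v)" by (metis prod.collapse prod_decode_inverse)
    have "Q k (prod_encode (n, v))" unfolding p[symmetric] using ex by (rule LeastI_ex)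
    \<comment> \<open>The prefix of \<open>y\<close> lies on level \<open>n\<close>; agreement on
      that level is not vacuous, and the value found is the right one.\<close>
    then have "sees (restrict_to y n) e k v" unfolding Q_iff using tree_y by simp
    then have "run (code_of e) y k = Some v" using sees_iff_run by blast
    then show ?thesis using val[OF y] p by simp
  qed
  then have z: "z = (\<lambda>k. snd (prod_decode (LEAST p. Q k p)))" by blast
  have df: "decidable_on UNIV (\<lambda>g n. f (L g n))" if "computable_on UNIV (\<lambda>g n. list_encode (L g n))" for L
    using decidable_on_comp[OF dec that] by simp
  have dec_tree: "decidable_on UNIV (\<lambda>g n. tree (L g n))" if "computable_on UNIV (\<lambda>g n. list_encode (L g n))" for L
    unfolding tree_def by (intro computable_intros decidable_binary df that computable_on_comp[OF that])
  show ?thesis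
    unfolding z computable_point_def
    by (rule computable_on_snd, rule computable_on_Least[OF _ ex], unfold Q_def)
      (intro computable_intros dec_tree decidable_sees)
qed

lemma run_relative:
  assumes "\<And>n. run c x n = Some (y n)" "\<And>n. run d y n = Some (z n)"
  obtains c' where "\<And>n. run c' x n = Some (z n)"
proof -
  have "computable_on {y} (\<lambda>_. z)" "computable_on {x} (\<lambda>_. y)" using assms by (auto simp: computable_on_def)
  then have "computable_on {x} (\<lambda>_ n. z n)"
    using computable_on_subst[of "{y}" "\<lambda>_. z" "{x}" "\<lambda>_ _. y" "\<lambda>_ n. n"]
    by (simp add: computable_on_id computable_on_comp[of _ "\<lambda>_. y"] computable_on_snd)
  then show ?thesis using that by (auto simp: computable_on_def)
qed

lemma not_SEL_Pi0_2_1_omega: "\<not> SEL (Pi0 2 cantor) computable_1_omega"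
proof
  assume SEL: "SEL (Pi0 2 cantor) computable_1_omega"
  define T where "T = {generic} \<union> dnc2"
  have "{generic} = {x \<in> cantor. \<forall>k. \<exists>s. snd (prod_decode k) \<le> s \<and>
      restrict_to x (length (generic_approx s (fst (prod_decode k)))) = generic_approx s (fst (prod_decode k))}"
  proof -
    have "x = generic \<longleftrightarrow> (\<forall>k. \<exists>s. snd (prod_decode k) \<le> s \<and>
        restrict_to x (length (generic_approx s (fst (prod_decode k)))) = generic_approx s (fst (prod_decode k)))" for x
      unfolding eq_generic_iff by (metis fst_conv snd_conv prod_encode_inverse)
    then show ?thesis using generic_cantor by blast
  qed
  also have "\<dots> \<in> Pi0 2 cantor"
    by (intro Pi0_2I computable_intros computable_on_generic_approx)
  finally obtain P where "P \<in> Pi0 1 cantor" and "degree_equiv computable_1_omega P T"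
    using SEL dnc2_Pi0_1 dnc2_nonempty unfolding SEL_def T_def by blast
  then obtain \<psi> \<psi>' where \<psi>: "\<And>g. g \<in> T \<Longrightarrow> limit_succeeds \<psi> P g"
      and \<psi>': "learner \<psi>'" "\<And>y. y \<in> P \<Longrightarrow> limit_succeeds \<psi>' T y"
    unfolding degree_equiv_def reducible_1_omega_iff by blast
  obtain q where q: "decidable_on UNIV (\<lambda>_ n. q (list_decode n))" "\<And>l k. q l \<Longrightarrow> q (take k l)"
      and P: "P = {x \<in> cantor. \<forall>n. q (restrict_to x n)}"
    by (rule Pi0_1E[OF \<open>P \<in> Pi0 1 cantor\<close>]) blast
  have "generic \<in> T" by (simp add: T_def)
  then obtain c y where y: "Phi c generic = Some y" "y \<in> P" using \<psi> unfolding limit_succeeds_def by blast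
  obtain c' z where lim: "\<forall>\<^sub>F n in sequentially. \<psi>' (restrict_to y n) = c'" and z: "Phi c' y = Some z" "z \<in> T"
    using \<psi>'(2)[OF y(2)] unfolding limit_succeeds_def by blast
  obtain N where N: "\<And>n. n \<ge> N \<Longrightarrow> \<psi>' (restrict_to y n) = c'" using lim unfolding eventually_sequentially by blast
  have no_dnc: "z' \<notin> dnc2" if "\<And>n. run d generic n = Some (z' n)" for d z'
    using generic_computes_no_dnc[OF that] by (auto simp: dnc2_def)
  have "z \<notin> dnc2"
  proof -
    obtain d where "\<And>n. run d generic n = Some (z n)"
      using run_relative[of "code_of c" generic y "code_of c'" z] y(1) z(1) by (auto simp: Phi_eq_Some_iff)
    then show ?thesis by (rule no_dnc)
  qed
  then have z: "Phi c' y = Some generic" using z by (simp add: T_def)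
  have "generic \<notin> dnc2" by (rule no_dnc[of Oracle]) simp
  then obtain m where m: "\<And>x. agree m generic x \<Longrightarrow> x \<notin> dnc2"
    using closed_Pi0_1[OF dnc2_Pi0_1] unfolding closed_points_def by blast
  obtain k where k: "\<And>x n. agree k y x \<Longrightarrow> n < m \<Longrightarrow> run (code_of c') x n = Some (generic n)"
    using run_use_upto[of m "code_of c'" y generic] z by (auto simp: Phi_eq_Some_iff)
  \<comment> \<open>The paths are the points of \<open>P\<close> that share with \<open>y\<close>
    the use of the first \<open>m\<close> outputs and on which the guess is \<open>c'\<close> from
    \<open>N\<close> on. Then \<open>c'\<close> is the limit of the guesses, so program
    \<open>c'\<close> yields a member of \<open>T\<close>; its first \<open>m\<close> values exclude
    \<open>dnc2\<close> and leave only \<open>generic\<close>.\<close>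
  define f where "f l \<longleftrightarrow> q l \<and> (\<forall>i<k. i < length l \<longrightarrow> pad l i = pad (restrict_to y k) i) \<and> (N \<le> length l \<longrightarrow> \<psi>' l = c')" for l
  have "computable_point generic"
  proof (rule unique_value_computable[where f = f and y = y and e = c'])
    show "decidable_on UNIV (\<lambda>_ n. f (list_decode n))"
      unfolding f_def by (intro computable_intros q(1) computable_on_learner[OF \<psi>'(1)])
    show "y \<in> cantor" using y(2) P by blast
    show "f (restrict_to y n)" for n
      using y(2) N[of n] unfolding f_def P by (simp add: pad_def restrict_to_def)
    show "run (code_of c') x n = Some (generic n)" if x: "x \<in> cantor" "\<And>n. f (restrict_to x n)" for x n
    proof -
      have "x \<in> P" using x unfolding P f_def by blast
      then obtain c'' z' where c'': "\<forall>\<^sub>F n in sequentially. \<psi>' (restrict_to x n) = c''"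
          and z': "Phi c'' x = Some z'" "z' \<in> T"
        using \<psi>'(2) unfolding limit_succeeds_def by blast
      have "\<forall>\<^sub>F n in sequentially. \<psi>' (restrict_to x n) = c'"
        using x(2) unfolding eventually_sequentially f_def by auto
      then have "\<forall>\<^sub>F n in sequentially. c' = c''" using c'' by eventually_elim simp
      then have "c'' = c'" by simp
      have "agree k y x"
        using x(2)[of k] unfolding f_def by (auto simp: agree_def pad_def restrict_to_def)
      then have "agree m generic z'"
        using k[of x] z'(1) \<open>c'' = c'\<close> by (simp add: agree_def Phi_eq_Some_iff)
      then have "z' = generic" using m z'(2) by (auto simp: T_def)
      then show ?thesis using z'(1) \<open>c'' = c'\<close> by (simp add: Phi_eq_Some_iff)
    qed
  qed
  then show False using generic_not_computable by blast
qed

section \<open>Concatenation along one marker\<close>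

lemma computable_index:
  assumes "computable_on X F"
  obtains e where "\<And>g. g \<in> X \<Longrightarrow> Phi e g = Some (F g)"
proof -
  obtain c where c: "\<And>g n. g \<in> X \<Longrightarrow> run c g n = Some (F g n)"
    using assms by (auto simp: computable_on_def)
  obtain e where "code_of e = c" using surj_code_of by (metis surjD)
  then show ?thesis using that[of e] c by (simp add: Phi_eq_Some_iff)
qed

text \<open>The s-m-n theorem: \<open>K p\<close> stacks \<open>p\<close> successors on
  \<open>Zero\<close>, and \<open>I p\<close> pairs this constant with the input before running
  \<open>e\<close>.\<close>

lemma smn:
  assumes "computable_on X (\<lambda>g m. F (fst (prod_decode m)) g (snd (prod_decode m)))"
  obtains I where "computable_on UNIV (\<lambda>_. I)" "\<And>p g. g \<in> X \<Longrightarrow> Phi (I p) g = Some (F p g)"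
proof -
  obtain c where c: "\<And>g m. g \<in> X \<Longrightarrow> run c g m = Some (F (fst (prod_decode m)) g (snd (prod_decode m)))"
    using assms by (auto simp: computable_on_def)
  obtain e where e: "code_of e = c" using surj_code_of by (metis surjD)
  obtain i where i: "code_of i = Pair Fst Snd" using surj_code_of by (metis surjD)
  define K where "K = rec_nat 0 (\<lambda>_ y. node 1 y 1)"
  have K: "run (code_of (K p)) g n = Some p" for p g n
    by (induction p) (simp_all add: K_def code_of_atom[simplified] code_of_node[simplified])
  define I where "I p = node e (node (K p) i 0) 1" for p
  have "Phi (I p) g = Some (F p g)" if "g \<in> X" for p g
    unfolding Phi_eq_Some_iff using c[OF that] by (simp add: I_def code_of_node[simplified] K i e)
  moreover have "computable_on UNIV (\<lambda>_. I)"
    unfolding I_def K_def node_def by (intro computable_intros)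
  ultimately show ?thesis using that by blast
qed

lemma decidable_string_predicate:
  assumes "decidable_on UNIV (\<lambda>_ n. q (list_decode n))" "computable_on X (\<lambda>g n. list_encode (L g n))"
  shows "decidable_on X (\<lambda>g n. q (L g n))"
proof -
  have "decidable_on X (\<lambda>_ n. q (list_decode n))"
    using assms(1) unfolding decidable_on_def by (rule computable_on_subset) simp
  from decidable_on_comp[OF this assms(2)] show ?thesis by simp
qed

lemma decidable_indexed_string_predicate:
  assumes "decidable_on UNIV (\<lambda>_ n. A (fst (prod_decode n)) (list_decode (snd (prod_decode n))))"
    and "computable_on X M" "computable_on X (\<lambda>g n. list_encode (L g n))"
  shows "decidable_on X (\<lambda>g n. A (M g n) (L g n))"
proof -
  have "decidable_on X (\<lambda>_ n. A (fst (prod_decode n)) (list_decode (snd (prod_decode n))))"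
    using assms(1) unfolding decidable_on_def by (rule computable_on_subset) simp
  from decidable_on_comp[OF this computable_on_pair[OF assms(2,3)]] show ?thesis by simp
qed

text \<open>A computable supply of finite pieces of a tree that may have no computable path.\<close>

definition tree_string :: "(nat list \<Rightarrow> bool) \<Rightarrow> nat \<Rightarrow> nat list" where
  "tree_string q n = list_decode (LEAST t. length (list_decode t) = n \<and> binary (list_decode t) \<and> q (list_decode t))"

lemma tree_string:
  assumes "x \<in> cantor" "\<And>n. q (restrict_to x n)"
  shows "length (tree_string q n) = n" "binary (tree_string q n)" "q (tree_string q n)"
    "\<exists>t. length (list_decode t) = n \<and> binary (list_decode t) \<and> q (list_decode t)"
proof -
  show ex: "\<exists>t. length (list_decode t) = n \<and> binary (list_decode t) \<and> q (list_decode t)"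
    using assms binary_restrict by (intro exI[of _ "list_encode (restrict_to x n)"]) simp
  show "length (tree_string q n) = n" "binary (tree_string q n)" "q (tree_string q n)"
    using LeastI_ex[OF ex] unfolding tree_string_def by blast+
qed

lemma computable_tree_string:
  assumes "decidable_on UNIV (\<lambda>_ n. q (list_decode n))" "computable_on X N"
    and "x \<in> cantor" "\<And>n. q (restrict_to x n)"
  shows "computable_on X (\<lambda>g n. list_encode (tree_string q (N g n)))"
  unfolding tree_string_def
  by (intro computable_intros computable_on_Least tree_string(4)[where x = x and q = q, OF assms(3,4)] decidable_binary
      decidable_string_predicate[OF assms(1)] computable_on_comp[OF assms(2)])

lemma restrict_pad_take: "k \<le> length l \<Longrightarrow> restrict_to (pad l) k = take k l"
  by (auto simp: restrict_to_def pad_def intro!: nth_equalityI)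

lemma SEL_Sigma0_2_1_omega: "SEL (Sigma0 2 cantor) computable_1_omega"
  unfolding SEL_def
proof (intro ballI impI)
  fix S Q
  assume "S \<in> Sigma0 2 cantor" "Q \<in> Pi0 1 cantor" "Q \<noteq> {}"
  obtain A where A: "decidable_on UNIV (\<lambda>_ n. A (fst (prod_decode n)) (list_decode (snd (prod_decode n))))"
      "\<And>m l k. A m l \<Longrightarrow> A m (take k l)" and S: "S = {x \<in> cantor. \<exists>m. \<forall>n. A m (restrict_to x n)}"
    by (rule Sigma0_2E[OF \<open>S \<in> _\<close>]) blast
  obtain q where q: "decidable_on UNIV (\<lambda>_ n. q (list_decode n))" "\<And>l k. q l \<Longrightarrow> q (take k l)"
      and Q: "Q = {x \<in> cantor. \<forall>n. q (restrict_to x n)}"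
    by (rule Pi0_1E[OF \<open>Q \<in> _\<close>]) blast
  obtain u where u: "u \<in> cantor" "\<And>n. q (restrict_to u n)" using \<open>Q \<noteq> {}\<close> Q by blast
  note tree_u = tree_string[where x = u and q = q, OF u]
  \<comment> \<open>Track 0 of \<open>w\<close> carries the marker, track 1 a point of \<open>Q\<close>, track 2 a point of \<open>S\<close>; a first
    marker at \<open>m\<close> releases track 1 and puts track 2 into the \<open>m\<close>-th closed part of \<open>S\<close>.\<close>
  define R where "R w n \<longleftrightarrow>
      ((\<forall>i<snd (prod_decode n). w (prod_encode (0, i)) = 0) \<longrightarrow>
        q (restrict_to (\<lambda>i. w (prod_encode (1, i))) (snd (prod_decode n)))) \<and>
      (w (prod_encode (0, fst (prod_decode n))) \<noteq> 0 \<and> (\<forall>i<fst (prod_decode n). w (prod_encode (0, i)) = 0) \<longrightarrow>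
        A (fst (prod_decode n)) (restrict_to (\<lambda>i. w (prod_encode (2, i))) (snd (prod_decode n))))" for w n
  define P where "P = {w \<in> cantor. \<forall>n. R w n}"
  have "P \<in> Pi0 1 cantor"
    unfolding P_def R_def
    by (intro Pi0_1I computable_intros decidable_string_predicate[OF q(1)] decidable_indexed_string_predicate[OF A(1)])
  moreover have "reducible computable_1_omega (S \<union> Q) P"
  proof -
    obtain ey where ey: "\<And>w. Phi ey w = Some (\<lambda>i. w (prod_encode (1, i)))"
      by (rule computable_index[where X = UNIV and F = "\<lambda>w i. w (prod_encode (1, i))"]) (intro computable_intros, blast)
    obtain ex where ex: "\<And>w. Phi ex w = Some (\<lambda>i. w (prod_encode (2, i)))"
      by (rule computable_index[where X = UNIV and F = "\<lambda>w i. w (prod_encode (2, i))"]) (intro computable_intros, blast)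
    define \<psi> where "\<psi> \<sigma> = (if \<exists>i<length \<sigma>. pad \<sigma> (prod_encode (0, i)) \<noteq> 0 then ex else ey)" for \<sigma>
    have "learner \<psi>"
      unfolding learner_iff_computable \<psi>_def by (intro computable_intros)
    moreover have "limit_succeeds \<psi> (S \<union> Q) w" if w: "w \<in> P" for w
    proof (cases "\<exists>i. w (prod_encode (0, i)) \<noteq> 0")
      case True
      define m where "m = (LEAST i. w (prod_encode (0, i)) \<noteq> 0)"
      have m: "w (prod_encode (0, m)) \<noteq> 0" unfolding m_def using True by (rule LeastI_ex)
      have "\<forall>i<m. w (prod_encode (0, i)) = 0" using not_less_Least unfolding m_def by blast
      then have "A m (restrict_to (\<lambda>i. w (prod_encode (2, i))) k)" for k :: nat
      proof -
        have "R w (prod_encode (m, k))" using w by (simp add: P_def)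
        with m \<open>\<forall>i<m. w (prod_encode (0, i)) = 0\<close> show ?thesis by (simp add: R_def)
      qed
      then have "(\<lambda>i. w (prod_encode (2, i))) \<in> S" using w by (auto simp: S P_def cantor_def)
      moreover have "\<psi> (restrict_to w n) = ex" if "n > prod_encode (0, m)" for n
      proof -
        have "m < n" using that le_prod_encode_2[of m 0] by simp
        moreover have "pad (restrict_to w n) (prod_encode (0, m)) \<noteq> 0" using m that by (simp add: pad_def restrict_to_def)
        ultimately show ?thesis by (auto simp: \<psi>_def)
      qed
      then have "\<forall>\<^sub>F n in sequentially. \<psi> (restrict_to w n) = ex"
        unfolding eventually_sequentially by (meson Suc_le_lessD)
      ultimately show ?thesis unfolding limit_succeeds_def using ex by blast
    next
      case False
      then have "q (restrict_to (\<lambda>i. w (prod_encode (1, i))) k)" for k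
      proof -
        have "R w (prod_encode (0, k))" using w by (simp add: P_def)
        with False show ?thesis by (simp add: R_def)
      qed
      then have "(\<lambda>i. w (prod_encode (1, i))) \<in> Q" using w by (auto simp: Q P_def cantor_def)
      moreover have "\<psi> (restrict_to w n) = ey" for n
        using False by (simp add: \<psi>_def pad_def restrict_to_def)
      ultimately show ?thesis unfolding limit_succeeds_def using ey by auto
    qed
    ultimately show ?thesis unfolding reducible_1_omega_iff by blast
  qed
  moreover have "reducible computable_1_omega P (S \<union> Q)"
  proof -
    \<comment> \<open>\<open>p = 0\<close> means no marker and \<open>g\<close> on track 1.
      \<open>p = m + 1\<close> means a marker at \<open>m\<close>, \<open>g\<close> on track 2, and
      a tree string of length \<open>m\<close> on track 1, which is constrained only up to the
      marker.\<close>
    define F where "F p g n =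
      (if fst (prod_decode n) = 0 then (if snd (prod_decode n) + 1 = p then 1 else 0)
       else if fst (prod_decode n) = 1 then
         (if p = 0 then g (snd (prod_decode n)) else pad (tree_string q (p - 1)) (snd (prod_decode n)))
       else if p = 0 then 0 else g (snd (prod_decode n)))" for p n and g :: "nat \<Rightarrow> nat"
    have "computable_on UNIV (\<lambda>g m. F (fst (prod_decode m)) g (snd (prod_decode m)))"
      unfolding F_def by (intro computable_intros computable_tree_string[where x = u and q = q, OF q(1) _ u])
    then obtain I where I: "computable_on UNIV (\<lambda>_. I)" "\<And>p g. Phi (I p) g = Some (F p g)"
      by (rule smn) blast
    define ok where "ok p \<sigma> \<longleftrightarrow> (p = 0 \<longrightarrow> q \<sigma>) \<and> (p \<noteq> 0 \<longrightarrow> A (p - 1) \<sigma>)" for p \<sigma>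
    have ok_take: "ok p l \<Longrightarrow> ok p (take k l)" for p l k
      using q(2) A(2) by (auto simp: ok_def)
    \<comment> \<open>The guess is the least candidate not yet refuted by the string. The bound by
      the length keeps the search total and drops out once the length exceeds the correct
      candidate.\<close>
    define \<psi> where "\<psi> \<sigma> = I (LEAST p. length \<sigma> \<le> p \<or> ok p \<sigma>)" for \<sigma>
    have "computable_on UNIV (\<lambda>_ n. LEAST p. length (list_decode n) \<le> p \<or> ok p (list_decode n))"
      unfolding ok_def
      by (intro computable_on_Least computable_intros decidable_string_predicate[OF q(1)]
          decidable_indexed_string_predicate[OF A(1)]) (rule exI, rule disjI1, rule order_refl)
    then have "learner \<psi>"
      unfolding learner_iff_computable \<psi>_def by (rule computable_on_comp[OF I(1)])
    moreover have "limit_succeeds \<psi> P g" if g: "g \<in> S \<union> Q" for g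
    proof -
      have "\<exists>p. \<forall>n. ok p (restrict_to g n)"
      proof (cases "g \<in> Q")
        case True
        then show ?thesis by (intro exI[of _ 0]) (simp add: ok_def Q)
      next
        case False
        then obtain m where "\<forall>n. A m (restrict_to g n)" using g S by blast
        then show ?thesis by (intro exI[of _ "Suc m"]) (simp add: ok_def)
      qed
      then have p: "\<forall>n. ok (LEAST p. \<forall>n. ok p (restrict_to g n)) (restrict_to g n)" by (rule LeastI_ex)
      define p where "p = (LEAST p. \<forall>n. ok p (restrict_to g n))"
      have "\<forall>\<^sub>F n in sequentially. \<forall>p'\<in>{..<p}. \<not> ok p' (restrict_to g n)"
      proof (rule eventually_ball_finite)
        show "\<forall>p'\<in>{..<p}. \<forall>\<^sub>F n in sequentially. \<not> ok p' (restrict_to g n)"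
        proof
          fix p' assume "p' \<in> {..<p}"
          then obtain k where k: "\<not> ok p' (restrict_to g k)" using not_less_Least unfolding p_def by blast
          then have "\<not> ok p' (restrict_to g n)" if "n \<ge> k" for n
            using ok_take[of p' "restrict_to g n" k] that k by (auto simp: take_restrict)
          then show "\<forall>\<^sub>F n in sequentially. \<not> ok p' (restrict_to g n)" unfolding eventually_sequentially by blast
        qed
      qed simp
      moreover have "\<forall>\<^sub>F n in sequentially. p < n" by (rule eventually_gt_at_top)
      ultimately have "\<forall>\<^sub>F n in sequentially. \<psi> (restrict_to g n) = I p"
      proof eventually_elim
        case (elim n)
        have "(LEAST p'. n \<le> p' \<or> ok p' (restrict_to g n)) = p"
        proof (rule Least_equality)
          show "n \<le> p \<or> ok p (restrict_to g n)" using p by (simp add: p_def)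
          show "p \<le> p'" if "n \<le> p' \<or> ok p' (restrict_to g n)" for p'
            using elim that by (meson lessThan_iff less_imp_le_nat not_le order_less_le_trans)
        qed
        then show ?case by (simp add: \<psi>_def)
      qed
      moreover have "F p g \<in> P"
      proof -
        have gc: "g \<in> cantor" using g S Q by blast
        have "pad (tree_string q k) i < 2" for k i
          using pad_cantor[OF tree_u(2)] by (simp add: cantor_def)
        then have "F p g \<in> cantor" using gc by (auto simp: cantor_def F_def)
        moreover have "R (F p g) n" for n
        proof (cases p)
          case 0
          then show ?thesis using p unfolding p_def[symmetric] by (simp add: R_def F_def ok_def)
        next
          case (Suc m)
          have A: "A m (restrict_to g k)" for k using p unfolding p_def[symmetric] by (simp add: ok_def Suc)
          have mark: "F p g (prod_encode (0, i)) = (if i = m then 1 else 0)" for i by (simp add: F_def Suc)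
          \<comment> \<open>No marker below \<open>k\<close> means \<open>k \<le> m\<close>, so only
            entries inside the tree string are tested.\<close>
          have "q (restrict_to (pad (tree_string q m)) k)" if "\<forall>i<k. i \<noteq> m" for k
          proof -
            have "k \<le> m" using that not_less by blast
            then show ?thesis using q(2)[OF tree_u(3)] by (simp add: restrict_pad_take tree_u(1))
          qed
          moreover have "(\<lambda>i. F p g (prod_encode (1, i))) = pad (tree_string q m)" "(\<lambda>i. F p g (prod_encode (2, i))) = g"
            by (simp_all add: F_def Suc fun_eq_iff)
          ultimately show ?thesis unfolding R_def mark using A by auto
        qed
        ultimately show ?thesis unfolding P_def by blast
      qed
      ultimately show ?thesis unfolding limit_succeeds_def using I(2) by blast
    qed
    ultimately show ?thesis unfolding reducible_1_omega_iff by blast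
  qed
  ultimately show "\<exists>P\<in>Pi0 1 cantor. degree_equiv computable_1_omega P (S \<union> Q)"
    unfolding degree_equiv_def by blast
qed

section \<open>Mixing finite histories with a tree\<close>

lemma reducible_fin_omega_two:
  assumes "learner \<psi>1" "learner \<psi>2"
    and "\<And>g. g \<in> B \<Longrightarrow> limit_succeeds \<psi>1 A g \<or> limit_succeeds \<psi>2 A g"
  shows "reducible computable_fin_omega A B"
proof -
  obtain i j where "Psi i = \<psi>1" "Psi j = \<psi>2" using assms(1,2) range_Psi by (metis mem_Collect_eq rangeE)
  then have "\<exists>e<Suc (i + j). limit_succeeds (Psi e) A g" if "g \<in> B" for g
    using assms(3)[OF that] by (metis add.commute le_add1 less_Suc_eq_le)
  then show ?thesis unfolding reducible_fin_omega_iff by blast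
qed

text \<open>Among codes of initial segments of one sequence, the larger code thus belongs to the
  longer segment; marks come in the order of their histories.\<close>

lemma list_encode_take_le: "list_encode (take k l) \<le> list_encode l"
proof (induction l arbitrary: k)
  case (Cons a l)
  show ?case
  proof (cases k)
    case (Suc k')
    then show ?thesis using prod_encode_mono[OF order_refl Cons.IH[of k'], of a] by simp
  qed simp
qed simp

lemma length_le_list_encode: "length l \<le> list_encode l"
proof (induction l)
  case (Cons a l)
  then show ?case using le_prod_encode_2[of "list_encode l" a] by simp
qed simp

text \<open>The position just behind the last mark below \<open>b\<close>, or 0 if there is
  none.\<close>

definition gap_start :: "(nat \<Rightarrow> bool) \<Rightarrow> nat \<Rightarrow> nat" where
  "gap_start M b = (LEAST a. \<forall>j<b. a \<le> j \<longrightarrow> \<not> M j)"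

lemma gap_start:
  "gap_start M b \<le> j \<Longrightarrow> j < b \<Longrightarrow> \<not> M j" "gap_start M b \<le> b"
  "(\<And>j. j < b \<Longrightarrow> a \<le> j \<Longrightarrow> \<not> M j) \<Longrightarrow> gap_start M b \<le> a"
proof -
  have ex: "\<forall>j<b. b \<le> j \<longrightarrow> \<not> M j" by simp
  show "gap_start M b \<le> j \<Longrightarrow> j < b \<Longrightarrow> \<not> M j"
    using LeastI[of "\<lambda>a. \<forall>j<b. a \<le> j \<longrightarrow> \<not> M j", OF ex] unfolding gap_start_def by blast
  show "gap_start M b \<le> b" unfolding gap_start_def using ex by (rule Least_le)
  show "(\<And>j. j < b \<Longrightarrow> a \<le> j \<Longrightarrow> \<not> M j) \<Longrightarrow> gap_start M b \<le> a"
    unfolding gap_start_def by (rule Least_le) blast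
qed

lemma gap_start_inside:
  assumes "gap_start M b \<le> i" "i \<le> b"
  shows "gap_start M i = gap_start M b"
proof (rule antisym)
  show "gap_start M i \<le> gap_start M b"
    using assms gap_start(1)[of M b] by (intro gap_start(3)) simp
  show "gap_start M b \<le> gap_start M i"
  proof (rule gap_start(3))
    fix j assume "j < b" "gap_start M i \<le> j"
    then show "\<not> M j" using gap_start(1)[of M i j] gap_start(1)[of M b j] assms by (cases "j < i") auto
  qed
qed

lemma computable_gap_start:
  assumes "decidable_on X (\<lambda>g m. M g (snd (prod_decode m)))" "computable_on X B"
  shows "computable_on X (\<lambda>g n. gap_start (M g) (B g n))"
proof -
  have M: "decidable_on X (\<lambda>g n. M g (J g n))" if "computable_on X J" for J
    using decidable_on_comp[OF assms(1) computable_on_pair[OF computable_on_const[of X 0] that]] by simp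
  have "\<exists>a. \<forall>j<b. a \<le> j \<longrightarrow> \<not> M g j" for g b by (rule exI[of _ b]) simp
  then show ?thesis
    unfolding gap_start_def
    by (intro computable_on_Least) (intro computable_intros M computable_on_comp[OF assms(2)])
qed

definition first_coords :: "nat list \<Rightarrow> nat \<Rightarrow> nat list" where
  "first_coords l k = map (\<lambda>j. fst (prod_decode (pad l j))) [0..<k]"

text \<open>The second component of entry \<open>i\<close> claims a length at which
  \<open>A i\<close> holds of the point. The claim is tested as soon as the history has that length,
  so a claim beyond the end does no harm yet.\<close>

definition witnessed :: "(nat \<Rightarrow> nat list \<Rightarrow> bool) \<Rightarrow> nat list \<Rightarrow> bool" where
  "witnessed A l \<longleftrightarrow> (\<forall>i<length l. snd (prod_decode (pad l i)) \<le> length l \<longrightarrow>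
     A i (first_coords l (snd (prod_decode (pad l i)))))"

text \<open>
  The set \<open>mixed A q\<close> consists of the binary \<open>w\<close> whose track \<open>0\<close> marks positions and whose
  track \<open>1\<close> carries, between consecutive marks, strings of the tree \<open>q\<close>. A marked position is the
  code of a finite history: a list of pairs of a value of a point of the \<open>\<Pi>\<^sup>0\<^sub>2\<close> set and a witness.
\<close>

definition mixed_condition :: "(nat \<Rightarrow> nat list \<Rightarrow> bool) \<Rightarrow> (nat list \<Rightarrow> bool) \<Rightarrow> (nat \<Rightarrow> nat) \<Rightarrow> nat \<Rightarrow> bool" where
  "mixed_condition A q w b \<longleftrightarrow>
     q (map (\<lambda>i. w (prod_encode (1, i))) [gap_start (\<lambda>j. w (prod_encode (0, j)) \<noteq> 0) b..<b]) \<and>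
     (\<forall>a<b. w (prod_encode (0, a)) \<noteq> 0 \<and> w (prod_encode (0, b)) \<noteq> 0 \<longrightarrow>
        length (list_decode a) < length (list_decode b) \<and>
        take (length (list_decode a)) (list_decode b) = list_decode a) \<and>
     (w (prod_encode (0, b)) \<noteq> 0 \<longrightarrow> witnessed A (list_decode b))"

definition mixed :: "(nat \<Rightarrow> nat list \<Rightarrow> bool) \<Rightarrow> (nat list \<Rightarrow> bool) \<Rightarrow> (nat \<Rightarrow> nat) set" where
  "mixed A q = {w \<in> cantor. \<forall>b. mixed_condition A q w b}"

locale pi02_union =
  fixes A :: "nat \<Rightarrow> nat list \<Rightarrow> bool" and q :: "nat list \<Rightarrow> bool" and u :: "nat \<Rightarrow> nat"
  assumes A: "decidable_on UNIV (\<lambda>_ n. A (fst (prod_decode n)) (list_decode (snd (prod_decode n))))"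
    and q: "decidable_on UNIV (\<lambda>_ n. q (list_decode n))"
    and q_take: "\<And>l k. q l \<Longrightarrow> q (take k l)"
    and u: "u \<in> cantor" "\<And>n. q (restrict_to u n)"
begin

definition target :: "(nat \<Rightarrow> nat) set" where
  "target = {x. \<forall>m. \<exists>n. A m (restrict_to x n)} \<union> {x \<in> cantor. \<forall>n. q (restrict_to x n)}"

lemma mixed_Pi0_1: "mixed A q \<in> Pi0 1 cantor"
  unfolding mixed_def mixed_condition_def witnessed_def first_coords_def
  by (intro Pi0_1I computable_intros decidable_string_predicate[OF q] decidable_indexed_string_predicate[OF A]
      computable_gap_start)

text \<open>A point of the \<open>\<Pi>\<^sup>0\<^sub>2\<close> part computes its own history with
  least witnesses, marks exactly the codes of its initial segments and fills the gaps with tree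
  strings. Any other point of the union is copied to track 1 without marks. Each case has its own
  constant learner.\<close>

lemma mixed_below_target: "reducible computable_fin_omega (mixed A q) target"
proof -
  define F2 where "F2 g n = (if fst (prod_decode n) = 1 then g (snd (prod_decode n)) else 0)"
    for n and g :: "nat \<Rightarrow> nat"
  obtain e2 where e2: "\<And>g. Phi e2 g = Some (F2 g)"
    by (rule computable_index[where X = UNIV and F = F2]) (unfold F2_def, intro computable_intros, blast)
  define X where "X = {x. \<forall>m. \<exists>n. A m (restrict_to x n)}"
  define h where "h g i = (LEAST k. A i (restrict_to g k))" for g i
  define f where "f g i = prod_encode (g i, h g i)" for g i
  define M where "M g b \<longleftrightarrow> list_decode b = restrict_to (f g) (length (list_decode b))" for g b
  define nx where "nx g i = (LEAST b. i \<le> b \<and> M g b)" for g i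
  have h: "A i (restrict_to g (h g i))" if "g \<in> X" for g i
    using that unfolding X_def h_def by (auto intro: LeastI_ex)
  have M_code: "M g (list_encode (restrict_to (f g) n))" for g n by (simp add: M_def)
  have ex_nx: "\<exists>b. i \<le> b \<and> M g b" for g i
    using length_le_list_encode[of "restrict_to (f g) i"] M_code by auto
  have nx: "i \<le> nx g i" "M g (nx g i)" "\<And>b. i \<le> b \<Longrightarrow> M g b \<Longrightarrow> nx g i \<le> b" for g i
    using LeastI_ex[OF ex_nx[of i g]] by (simp_all add: nx_def Least_le)
  define F1 where "F1 g n =
    (if fst (prod_decode n) = 0 then of_bool (M g (snd (prod_decode n)))
     else if fst (prod_decode n) = 1
     then pad (tree_string q (nx g (snd (prod_decode n)))) (snd (prod_decode n) - gap_start (M g) (snd (prod_decode n)))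
     else 0)" for g n
  have ch: "computable_on X h"
    unfolding h_def[abs_def]
    by (intro computable_on_Least decidable_indexed_string_predicate[OF A] computable_intros) (auto simp: X_def)
  have cf: "computable_on X f"
    unfolding f_def[abs_def] by (intro computable_intros ch)
  have dM: "decidable_on X (\<lambda>g n. M g (K g n))" if "computable_on X K" for K
    unfolding M_def by (intro computable_intros computable_on_comp[OF cf] that)
  have cnx: "computable_on X (\<lambda>g n. nx g (K g n))" if "computable_on X K" for K
    unfolding nx_def by (intro computable_on_Least ex_nx computable_intros dM computable_on_comp[OF that])
  have "computable_on X F1"
    unfolding F1_def
    by (intro computable_on_if computable_on_pad computable_tree_string[where x = u and q = q, OF q _ u]
       computable_intros dM[unfolded decidable_on_def] cnx computable_gap_start dM)
  then obtain e1 where e1: "\<And>g. g \<in> X \<Longrightarrow> Phi e1 g = Some (F1 g)" by (rule computable_index) blast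
  note tree_u = tree_string[where x = u and q = q, OF u]
  have F1: "F1 g \<in> mixed A q" if g: "g \<in> X" for g
    unfolding mixed_def
  proof (intro CollectI conjI allI)
    have "pad (tree_string q k) i < 2" for k i
      using pad_cantor[OF tree_u(2)] by (simp add: cantor_def)
    then show "F1 g \<in> cantor" by (simp add: cantor_def F1_def)
    fix b
    have mark: "F1 g (prod_encode (0, j)) \<noteq> 0 \<longleftrightarrow> M g j" for j by (simp add: F1_def)
    let ?a = "gap_start (M g) b"
    \<comment> \<open>Positions in one gap have the same next mark. Choosing the tree string by that
      mark gives the whole gap a single string, and one that is long enough.\<close>
    have nx_eq: "nx g i = nx g b" if "?a \<le> i" "i < b" for i
    proof (rule antisym)
      show "nx g i \<le> nx g b" using nx(1)[of b g] nx(2)[of g b] that by (intro nx(3)) auto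
      have "\<not> nx g i < b" using gap_start(1)[of "M g" b "nx g i"] nx(1)[of i g] nx(2)[of g i] that by force
      then show "nx g b \<le> nx g i" using nx(2)[of g i] by (intro nx(3)) auto
    qed
    have "map (\<lambda>i. F1 g (prod_encode (1, i))) [?a..<b] = take (b - ?a) (tree_string q (nx g b))"
    proof (rule nth_equalityI)
      show "length (map (\<lambda>i. F1 g (prod_encode (1, i))) [?a..<b]) = length (take (b - ?a) (tree_string q (nx g b)))"
        using nx(1)[of b g] by (simp add: tree_u(1))
      fix i assume "i < length (map (\<lambda>i. F1 g (prod_encode (1, i))) [?a..<b])"
      then have i: "?a + i < b" by simp
      then have "nx g (?a + i) = nx g b" "gap_start (M g) (?a + i) = ?a"
        by (auto intro: nx_eq gap_start_inside)
      then show "map (\<lambda>i. F1 g (prod_encode (1, i))) [?a..<b] ! i = take (b - ?a) (tree_string q (nx g b)) ! i"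
        using i nx(1)[of b g] by (simp add: F1_def pad_def tree_u(1))
    qed
    then have "q (map (\<lambda>i. F1 g (prod_encode (1, i))) [?a..<b])" using q_take[OF tree_u(3)] by simp
    moreover have "length (list_decode a) < length (list_decode b) \<and>
        take (length (list_decode a)) (list_decode b) = list_decode a" if "a < b" "M g a" "M g b" for a
    proof -
      define m n where "m = length (list_decode a)" and "n = length (list_decode b)"
      have l: "list_decode a = restrict_to (f g) m" "list_decode b = restrict_to (f g) n"
        using that(2,3) unfolding M_def m_def n_def by auto
      have "m < n"
      proof (rule ccontr)
        assume "\<not> m < n"
        then have "list_decode b = take n (list_decode a)" by (simp add: l take_restrict)
        then have "b \<le> a" using list_encode_take_le[of n "list_decode a"] by (metis list_decode_inverse)
        then show False using that(1) by simp
      qed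
      then show ?thesis by (simp add: l take_restrict)
    qed
    moreover have "witnessed A (list_decode b)" if "M g b"
    proof -
      define n where "n = length (list_decode b)"
      have l: "list_decode b = restrict_to (f g) n" using that unfolding M_def n_def .
      have p: "pad (list_decode b) i = f g i" if "i < n" for i
        using that by (simp add: l pad_def restrict_to_def)
      have "first_coords (list_decode b) k = restrict_to g k" if "k \<le> n" for k
        using that by (simp add: first_coords_def restrict_to_def p f_def)
      then show ?thesis unfolding witnessed_def n_def[symmetric] using h[OF g] by (simp add: p f_def)
    qed
    ultimately show "mixed_condition A q (F1 g) b" unfolding mixed_condition_def mark by blast
  qed
  have F2: "F2 g \<in> mixed A q" if "g \<in> cantor" "\<And>n. q (restrict_to g n)" for g
  proof -
    have "gap_start (\<lambda>j. F2 g (prod_encode (0, j)) \<noteq> 0) b = 0" for b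
      using gap_start(3)[of b 0 "\<lambda>j. F2 g (prod_encode (0, j)) \<noteq> 0"] by (simp add: F2_def)
    then show ?thesis
      using that by (simp add: mixed_def mixed_condition_def F2_def cantor_def flip: restrict_to_def)
  qed
  show ?thesis
  proof (rule reducible_fin_omega_two)
    show "learner (\<lambda>_. e1)" "learner (\<lambda>_. e2)"
      unfolding learner_iff_computable by (intro computable_intros)+
    show "limit_succeeds (\<lambda>_. e1) (mixed A q) g \<or> limit_succeeds (\<lambda>_. e2) (mixed A q) g" if g: "g \<in> target" for g
    proof (cases "g \<in> X")
      case True
      then show ?thesis using F1 e1 by (simp add: limit_succeeds_def)
    next
      case False
      then have "F2 g \<in> mixed A q" using g F2 unfolding target_def X_def by blast
      then show ?thesis using e2 by (simp add: limit_succeeds_def)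
    qed
  qed
qed

text \<open>With infinitely many marks, a fixed program reads the point off the histories. Otherwise
  a second learner guesses that the last mark seen is the final one and reads track 1 behind it; its
  guess settles.\<close>

lemma target_below_mixed: "reducible computable_fin_omega target (mixed A q)"
proof -
  define M where "M w b \<longleftrightarrow> w (prod_encode (0, b)) \<noteq> 0" for w :: "nat \<Rightarrow> nat" and b
  define X where "X = {w \<in> mixed A q. \<forall>n. \<exists>b\<ge>n. M w b}"
  \<comment> \<open>Any mark with a long enough history would do, as the histories extend one
    another; the first one makes the choice computable.\<close>
  define mark where "mark w i = (LEAST b. M w b \<and> i < length (list_decode b))" for w i
  define F1 where "F1 w i = fst (prod_decode (pad (list_decode (mark w i)) i))" for w i
  have cond: "mixed_condition A q w b" if "w \<in> mixed A q" for w b using that by (simp add: mixed_def)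
  have incr: "length (list_decode a) < length (list_decode b) \<and> take (length (list_decode a)) (list_decode b) = list_decode a"
    if "w \<in> mixed A q" "a < b" "M w a" "M w b" for w a b
    using cond[OF that(1), of b] that(2-) unfolding mixed_condition_def M_def by blast
  have ex_mark: "\<exists>b. M w b \<and> i < length (list_decode b)" if w: "w \<in> X" for w i
  proof (induction i)
    case 0
    obtain a where a: "M w a" using w unfolding X_def by blast
    obtain b where "b \<ge> Suc a" "M w b" using w unfolding X_def by blast
    then show ?case using incr[of w a b] a w unfolding X_def by (auto simp: Suc_le_eq)
  next
    case (Suc i)
    then obtain a where a: "M w a" "i < length (list_decode a)" by blast
    obtain b where "b \<ge> Suc a" "M w b" using w unfolding X_def by blast
    then show ?case using incr[of w a b] a w unfolding X_def by (auto simp: Suc_le_eq)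
  qed
  have "computable_on X F1"
    unfolding F1_def mark_def M_def
    by (intro computable_intros computable_on_Least ex_mark[unfolded M_def])
  then obtain e1 where e1: "\<And>w. w \<in> X \<Longrightarrow> Phi e1 w = Some (F1 w)" by (rule computable_index) blast
  have F1: "F1 w \<in> target" if w: "w \<in> X" for w
  proof -
    have wm: "w \<in> mixed A q" using w by (simp add: X_def)
    have same: "pad (list_decode a) i = pad (list_decode b) i"
      if "M w a" "M w b" "i < length (list_decode a)" "i < length (list_decode b)" for a b i
      using incr[OF wm, of a b] incr[OF wm, of b a] that unfolding pad_def
      by (metis nat_neq_iff nth_take)
    have F1_eq: "F1 w i = fst (prod_decode (pad (list_decode b) i))" if "M w b" "i < length (list_decode b)" for b i
      using LeastI_ex[OF ex_mark[OF w, of i]] same[OF _ that(1) _ that(2)] unfolding F1_def mark_def by auto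
    have "\<exists>n. A m (restrict_to (F1 w) n)" for m
    proof -
      obtain a where a: "M w a" "m < length (list_decode a)" using ex_mark[OF w] by blast
      define k where "k = snd (prod_decode (pad (list_decode a) m))"
      obtain b where b: "M w b" "max m k < length (list_decode b)" using ex_mark[OF w] by blast
      have k: "snd (prod_decode (pad (list_decode b) m)) = k" using same[OF a(1) b(1) a(2)] b(2) by (simp add: k_def)
      have "witnessed A (list_decode b)"
        using cond[OF wm, of b] b(1) unfolding mixed_condition_def M_def by blast
      then have "A m (first_coords (list_decode b) k)" using b(2) k unfolding witnessed_def by fastforce
      moreover have "first_coords (list_decode b) k = restrict_to (F1 w) k"
        using F1_eq[OF b(1)] b(2) by (simp add: first_coords_def restrict_to_def)
      ultimately show ?thesis by auto
    qed
    then show ?thesis by (simp add: target_def)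
  qed
  obtain I where I: "computable_on UNIV (\<lambda>_. I)" "\<And>a w. Phi (I a) w = Some (\<lambda>i. w (prod_encode (1, a + i)))"
    by (rule smn[where X = UNIV and F = "\<lambda>a w i. w (prod_encode (1, a + i))"]) (intro computable_intros, blast)
  define \<psi> where "\<psi> \<sigma> = I (gap_start (\<lambda>j. pad \<sigma> (prod_encode (0, j)) \<noteq> 0) (length \<sigma>))" for \<sigma>
  have "learner \<psi>"
    unfolding learner_iff_computable \<psi>_def gap_start_def
    by (rule computable_on_comp[OF I(1)], rule computable_on_Least)
      (intro computable_intros, rule exI, rule allI, rule impI, rule impI, erule (1) leD[THEN notE])
  have F2: "limit_succeeds \<psi> target w" if w: "w \<in> mixed A q" "w \<notin> X" for w
  proof -
    obtain N where N: "\<And>b. b \<ge> N \<Longrightarrow> \<not> M w b" using w unfolding X_def by blast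
    define a where "a = gap_start (M w) N"
    have start: "gap_start (M w) b = a" if "b \<ge> N" for b
    proof (rule antisym)
      have "\<not> M w j" if "a \<le> j" for j
        using N[of j] gap_start(1)[of "M w" N j] that unfolding a_def by (cases "j < N") auto
      then show "gap_start (M w) b \<le> a" by (intro gap_start(3))
      show "a \<le> gap_start (M w) b"
        unfolding a_def using that gap_start(1)[of "M w" b] by (intro gap_start(3)) auto
    qed
    have "q (restrict_to (\<lambda>i. w (prod_encode (1, a + i))) k)" for k
    proof -
      have "q (map (\<lambda>i. w (prod_encode (1, i))) [a..<a + (N + k)])"
        using cond[OF w(1), of "a + (N + k)"] start[of "a + (N + k)"]
        unfolding mixed_condition_def M_def by simp
      moreover have "map (\<lambda>i. w (prod_encode (1, i))) [a..<a + (N + k)] =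
          restrict_to (\<lambda>i. w (prod_encode (1, a + i))) (N + k)"
        by (auto simp: restrict_to_def intro!: nth_equalityI)
      ultimately show ?thesis using q_take[of _ k] by (metis le_add2 take_restrict)
    qed
    moreover have "w \<in> cantor" using w(1) by (simp add: mixed_def)
    ultimately have "(\<lambda>i. w (prod_encode (1, a + i))) \<in> target"
      by (simp add: target_def cantor_def)
    \<comment> \<open>The sum bounds the places \<open>(0, j)\<close> for all \<open>j < N\<close>,
      so every real mark is visible by then. A place beyond the string reads 0 and counts as
      unmarked, which is correct for the remaining \<open>j\<close>.\<close>
    moreover have "\<psi> (restrict_to w n) = I a" if n: "n \<ge> N + (\<Sum>j<N. Suc (prod_encode (0, j)))" for n
    proof -
      let ?V = "\<lambda>j. pad (restrict_to w n) (prod_encode (0, j)) \<noteq> 0"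
      have "?V j \<longleftrightarrow> M w j" for j
      proof (cases "j < N")
        case True
        then have "Suc (prod_encode (0, j)) \<le> (\<Sum>j<N. Suc (prod_encode (0, j)))"
          by (intro member_le_sum) auto
        then have "prod_encode (0, j) < n" using n by linarith
        then show ?thesis by (simp add: M_def pad_def restrict_to_def)
      next
        case False
        then show ?thesis using N[of j] by (simp add: M_def pad_def restrict_to_def)
      qed
      then have "?V = M w" by blast
      then show ?thesis unfolding \<psi>_def using start[of n] n by simp
    qed
    then have "\<forall>\<^sub>F n in sequentially. \<psi> (restrict_to w n) = I a"
      unfolding eventually_sequentially by blast
    ultimately show ?thesis unfolding limit_succeeds_def using I(2) by blast
  qed
  show ?thesis
  proof (rule reducible_fin_omega_two)
    show "learner (\<lambda>_. e1)" unfolding learner_iff_computable by (intro computable_intros)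
    show "learner \<psi>" by fact
    show "limit_succeeds (\<lambda>_. e1) target w \<or> limit_succeeds \<psi> target w" if "w \<in> mixed A q" for w
    proof (cases "w \<in> X")
      case True
      then show ?thesis using F1 e1 by (simp add: limit_succeeds_def)
    qed (use F2 that in blast)
  qed
qed

end

lemma SEL_Pi0_2_fin_omega: "SEL (Pi0 2 baire) computable_fin_omega"
  unfolding SEL_def
proof (intro ballI impI)
  fix S Q
  assume "S \<in> Pi0 2 baire" "Q \<in> Pi0 1 cantor" "Q \<noteq> {}"
  obtain A where A: "decidable_on UNIV (\<lambda>_ n. A (fst (prod_decode n)) (list_decode (snd (prod_decode n))))"
      and S: "S = {x. \<forall>m. \<exists>n. A m (restrict_to x n)}"
    by (rule Pi0_2E[OF \<open>S \<in> _\<close>])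
  obtain q where q: "decidable_on UNIV (\<lambda>_ n. q (list_decode n))" "\<And>l k. q l \<Longrightarrow> q (take k l)"
      and Q: "Q = {x \<in> cantor. \<forall>n. q (restrict_to x n)}"
    by (rule Pi0_1E[OF \<open>Q \<in> _\<close>]) blast
  obtain u where "u \<in> cantor" "\<And>n. q (restrict_to u n)" using \<open>Q \<noteq> {}\<close> Q by blast
  then interpret pi02_union A q u using A q by unfold_locales
  have "target = S \<union> Q" by (simp add: target_def S Q)
  then show "\<exists>P\<in>Pi0 1 cantor. degree_equiv computable_fin_omega P (S \<union> Q)"
    using mixed_Pi0_1 mixed_below_target target_below_mixed unfolding degree_equiv_def by auto
qed

theorem theorem75:
  "\<not> SEL (Sigma0 2 cantor) computable_fin_1 \<and>
   SEL (Sigma0 2 cantor) computable_1_omega \<and>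
   \<not> SEL (Pi0 2 cantor) computable_1_omega \<and>
   SEL (Pi0 2 baire) computable_fin_omega \<and>
   \<not> SEL (Sigma0 3 cantor) computable_fin_omega"
  using not_SEL_Sigma0_2_fin_1 SEL_Sigma0_2_1_omega not_SEL_Pi0_2_1_omega SEL_Pi0_2_fin_omega
    not_SEL_Sigma0_3_fin_omega by blast

end
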